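(* The following decision problem (Strong geodetic set restricted to bipartite graphs) is NP-complete: given a bipartite graph $G$ and an integer $k$, does $G$ have a strong geodetic set of size at most $k$?
   Context: Let $G=(V,E)$ be a finite simple graph. For a set $S\subseteq V$ and for each pair of distinct vertices $\{x,y\}\subseteq S$, select one fixed shortest path $\widetilde{g}(x,y)$ between $x$ and $y$ in $G$. If the selection can be made so that the selected shortest paths (one per pair) together cover all vertices of $G$, i.e. the union of their vertex sets is $V$, then $S$ is called a strong geodetic set of $G$. If $G$ has just one vertex, that vertex is considered the unique strong geodetic set. *)

theory Defs
  imports Main "HOL-Computational_Algebra.Polynomial"
begin

section \<open>Multi-tape Turing machines\<close>

text \<open>
  Deterministic machines with finitely many states \<open>{..<nstates}\<close>, finitely many tape symbols
  \<open>{..<nsyms}\<close> and \<open>ntapes\<close> two-way infinite tapes. Symbol \<open>0\<close> is the blank, \<open>1\<close> and \<open>2\<close> are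
  the input symbols 0 and 1. Only the values of \<open>delta\<close> on states below \<open>nstates\<close> and on lists of
  \<open>ntapes\<close> symbols below \<open>nsyms\<close> matter, so \<open>delta\<close> is in effect a finite table.
\<close>

datatype move = MoveLeft | Stay | MoveRight

record tm =
  ntapes :: nat
  nsyms :: nat
  nstates :: nat
  start :: nat
  halt :: nat
  delta :: "nat \<Rightarrow> nat list \<Rightarrow> nat \<times> (nat \<times> move) list"

definition wf_tm :: "tm \<Rightarrow> bool" where
  "wf_tm M \<longleftrightarrow>
     1 \<le> ntapes M \<and> 3 \<le> nsyms M \<and> start M < nstates M \<and> halt M < nstates M \<and>
     (\<forall>q ss. q < nstates M \<longrightarrow> length ss = ntapes M \<longrightarrow> (\<forall>s\<in>set ss. s < nsyms M) \<longrightarrow>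
        fst (delta M q ss) < nstates M \<and>
        length (snd (delta M q ss)) = ntapes M \<and>
        (\<forall>(s, d)\<in>set (snd (delta M q ss)). s < nsyms M))"

text \<open>A tape is its contents together with the position of the head.\<close>

type_synonym tape = "(int \<Rightarrow> nat) \<times> int"
type_synonym config = "nat \<times> tape list"

fun offset :: "move \<Rightarrow> int" where
  "offset MoveLeft = -1"
| "offset Stay = 0"
| "offset MoveRight = 1"

definition read_tape :: "tape \<Rightarrow> nat" where
  "read_tape tp = fst tp (snd tp)"

definition act :: "nat \<times> move \<Rightarrow> tape \<Rightarrow> tape" where
  "act a tp = ((fst tp)(snd tp := fst a), snd tp + offset (snd a))"

definition step :: "tm \<Rightarrow> config \<Rightarrow> config" where
  "step M c =
     (if fst c = halt M then c
      else let r = delta M (fst c) (map read_tape (snd c))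
           in (fst r, map2 act (snd r) (snd c)))"

definition word_contents :: "bool list \<Rightarrow> int \<Rightarrow> nat" where
  "word_contents w i =
     (if 0 \<le> i \<and> i < int (length w) then (if w ! nat i then 2 else 1) else 0)"

text \<open>The \<open>i\<close>-th input word is written on the \<open>i\<close>-th tape; the remaining tapes are blank.\<close>

definition init_config :: "tm \<Rightarrow> bool list list \<Rightarrow> config" where
  "init_config M ws =
     (start M, map (\<lambda>w. (word_contents w, 0)) (ws @ replicate (ntapes M - length ws) []))"

text \<open>
  The output is the contents of the last tape. Halting configurations are fixed points of
  \<open>step\<close>, hence \<open>t\<close> is an upper bound on the number of steps.
\<close>

definition halts_with :: "tm \<Rightarrow> bool list list \<Rightarrow> nat \<Rightarrow> bool list \<Rightarrow> bool" where
  "halts_with M ws t w \<longleftrightarrow>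
     (let c = (step M ^^ t) (init_config M ws)
      in fst c = halt M \<and> fst (last (snd c)) = word_contents w)"


section \<open>Polynomial time and NP-completeness\<close>

definition polytime_computable :: "nat \<Rightarrow> (bool list list \<Rightarrow> bool list) \<Rightarrow> bool" where
  "polytime_computable m f \<longleftrightarrow>
     (\<exists>M (p :: nat poly). wf_tm M \<and> m \<le> ntapes M \<and>
        (\<forall>ws. length ws = m \<longrightarrow> halts_with M ws (poly p (sum_list (map length ws))) (f ws)))"

type_synonym language = "bool list set"

definition in_NP :: "language \<Rightarrow> bool" where
  "in_NP L \<longleftrightarrow>
     (\<exists>(R :: bool list \<Rightarrow> bool list \<Rightarrow> bool) (q :: nat poly).
        polytime_computable 2 (\<lambda>ws. [R (ws ! 0) (ws ! 1)]) \<and>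
        (\<forall>x. x \<in> L \<longleftrightarrow> (\<exists>y. length y \<le> poly q (length x) \<and> R x y)))"

definition polytime_reducible :: "language \<Rightarrow> language \<Rightarrow> bool" where
  "polytime_reducible L L' \<longleftrightarrow>
     (\<exists>f. polytime_computable 1 (\<lambda>ws. f (ws ! 0)) \<and> (\<forall>x. x \<in> L \<longleftrightarrow> f x \<in> L'))"

definition NP_hard :: "language \<Rightarrow> bool" where
  "NP_hard L \<longleftrightarrow> (\<forall>L'. in_NP L' \<longrightarrow> polytime_reducible L' L)"

definition NP_complete :: "language \<Rightarrow> bool" where
  "NP_complete L \<longleftrightarrow> in_NP L \<and> NP_hard L"


section \<open>Strong geodetic sets\<close>

definition simple_graph :: "'a set \<Rightarrow> 'a set set \<Rightarrow> bool" where
  "simple_graph V E \<longleftrightarrow> finite V \<and> (\<forall>e\<in>E. e \<subseteq> V \<and> card e = 2)"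

definition bipartite :: "'a set \<Rightarrow> 'a set set \<Rightarrow> bool" where
  "bipartite V E \<longleftrightarrow>
     (\<exists>A B. A \<union> B = V \<and> A \<inter> B = {} \<and> (\<forall>e\<in>E. \<exists>a\<in>A. \<exists>b\<in>B. e = {a, b}))"

definition path_between :: "'a set \<Rightarrow> 'a set set \<Rightarrow> 'a \<Rightarrow> 'a \<Rightarrow> 'a list \<Rightarrow> bool" where
  "path_between V E x y p \<longleftrightarrow>
     p \<noteq> [] \<and> distinct p \<and> set p \<subseteq> V \<and> successively (\<lambda>u v. {u, v} \<in> E) p \<and>
     {hd p, last p} = {x, y}"

definition shortest_path_between :: "'a set \<Rightarrow> 'a set set \<Rightarrow> 'a \<Rightarrow> 'a \<Rightarrow> 'a list \<Rightarrow> bool" where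
  "shortest_path_between V E x y p \<longleftrightarrow>
     path_between V E x y p \<and> (\<forall>q. path_between V E x y q \<longrightarrow> length p \<le> length q)"

text \<open>
  The selection \<open>g\<close> is indexed by unordered pairs, so exactly one path is selected for each of
  them. If two elements of \<open>S\<close> are not connected by any path, there is no selection.
\<close>

definition strong_geodetic_set :: "'a set \<Rightarrow> 'a set set \<Rightarrow> 'a set \<Rightarrow> bool" where
  "strong_geodetic_set V E S \<longleftrightarrow>
     S \<subseteq> V \<and>
     (if card V = 1 then S = V
      else \<exists>g :: 'a set \<Rightarrow> 'a list.
        (\<forall>x\<in>S. \<forall>y\<in>S. x \<noteq> y \<longrightarrow> shortest_path_between V E x y (g {x, y})) \<and>
        \<Union> {set (g {x, y}) | x y. x \<in> S \<and> y \<in> S \<and> x \<noteq> y} = V)"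


section \<open>The decision problem\<close>

text \<open>Binary representation, least significant bit first, without leading zeros.\<close>

fun binary :: "nat \<Rightarrow> bool list" where
  "binary n = (if n = 0 then [] else odd n # binary (n div 2))"

declare binary.simps [simp del]

definition adjacency_matrix :: "nat \<Rightarrow> nat set set \<Rightarrow> bool list" where
  "adjacency_matrix n E = concat (map (\<lambda>i. map (\<lambda>j. {i, j} \<in> E) [0..<n]) [0..<n])"

text \<open>
  An instance is a graph on the vertex set \<open>{..<n}\<close> and an integer \<open>k\<close>. It is encoded as \<open>n\<close> in
  unary, the rows of the adjacency matrix, the sign of \<open>k\<close> and the absolute value of \<open>k\<close> in binary.
\<close>

definition encode_instance :: "nat \<Rightarrow> nat set set \<Rightarrow> int \<Rightarrow> bool list" where
  "encode_instance n E k =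
     replicate n True @ [False] @ adjacency_matrix n E @ [k < 0] @ binary (nat \<bar>k\<bar>)"

lemma binary_inj: "binary m = binary n \<Longrightarrow> m = n"
proof (induction m arbitrary: n rule: less_induct)
  case (less m)
  show ?case
  proof (cases "m = 0 \<or> n = 0")
    case True
    with less.prems show ?thesis by (auto simp: binary.simps split: if_splits)
  next
    case False
    with less.prems have "odd m = odd n" "binary (m div 2) = binary (n div 2)"
      by (simp_all add: binary.simps[of m] binary.simps[of n])
    with less.IH[of "m div 2" "n div 2"] False have "m div 2 = n div 2" "m mod 2 = n mod 2"
      by (auto simp: odd_iff_mod_2_eq_one)
    then show ?thesis by (metis div_mult_mod_eq)
  qed
qed

lemma length_adjacency_matrix [simp]: "length (adjacency_matrix n E) = n * n"
  by (simp add: adjacency_matrix_def length_concat comp_def sum_list_triv)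

lemma adjacency_matrix_inj:
  assumes "simple_graph {..<n} E" "simple_graph {..<n} F"
    and "adjacency_matrix n E = adjacency_matrix n F"
  shows "E = F"
proof -
  have "map (\<lambda>i. map (\<lambda>j. {i, j} \<in> E) [0..<n]) [0..<n] =
        map (\<lambda>i. map (\<lambda>j. {i, j} \<in> F) [0..<n]) [0..<n]"
    using assms(3) unfolding adjacency_matrix_def
    by (rule concat_injective) (auto simp: set_zip)
  then have *: "({i, j} \<in> E) = ({i, j} \<in> F)" if "i < n" "j < n" for i j
    using that by auto
  have "e \<in> E \<longleftrightarrow> e \<in> F" for e
  proof (cases "e \<in> E \<or> e \<in> F")
    case True
    then have "e \<subseteq> {..<n}" "card e = 2" using assms by (auto simp: simple_graph_def)
    then obtain i j where "e = {i, j}" "i < n" "j < n" by (auto simp: card_2_iff)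
    with * show ?thesis by simp
  qed simp
  then show ?thesis by blast
qed

lemma encode_instance_inj:
  assumes "simple_graph {..<n} E" "simple_graph {..<n'} E'"
    and "encode_instance n E k = encode_instance n' E' k'"
  shows "n = n' \<and> E = E' \<and> k = k'"
proof -
  have "takeWhile id (encode_instance m F l) = replicate m True" for m F l
    by (simp add: encode_instance_def takeWhile_append)
  then have n: "n' = n" using assms(3) by (metis length_replicate)
  with assms(3) have "adjacency_matrix n E = adjacency_matrix n E'"
    and k: "(k < 0) = (k' < 0)" "binary (nat \<bar>k\<bar>) = binary (nat \<bar>k'\<bar>)"
    by (simp_all add: encode_instance_def)
  with adjacency_matrix_inj assms n have "E = E'" by blast
  moreover from binary_inj[OF k(2)] k(1) have "k = k'" by auto
  ultimately show ?thesis using n by simp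
qed

definition BIPARTITE_STRONG_GEODETIC_SET :: language where
  "BIPARTITE_STRONG_GEODETIC_SET =
     {encode_instance n E k | n E k.
        simple_graph {..<n} E \<and> bipartite {..<n} E \<and>
        (\<exists>S. strong_geodetic_set {..<n} E S \<and> int (card S) \<le> k)}"

end

theory Submission
  imports Defs
begin

text \<open>Membership in NP and hardness both need explicit Turing machines. They are obtained from a
  small language whose programs move the heads of input tapes and of counters. The functions that
  such programs compute with polynomially bounded counters contain the bits of the input words and
  are closed under composition and bounded recursion, so predicates written with arithmetic and
  bounded quantifiers are decidable in polynomial time. A certificate consists of the set, the
  selected paths, a bipartition and a distance function that proves the paths to be shortest.

  For hardness, the run of a verifier is encoded by multi-valued variables and positive clauses. A set of
  literals \<open>variable = value\<close> that is no larger than the number of variables and meets all clauses,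
  including one for each variable, is a satisfying assignment. Such a covering problem becomes a bipartite graph
  in which pendant vertices belong to every strong geodetic set, and in which a clause vertex can only be
  covered by choosing it or an adjacent literal.\<close>

section \<open>A structured language for multi-tape machines\<close>

text \<open>A covering problem has no negation; the budget supplies it. As the clauses that ask for
  a value of each variable use up the whole budget, a cover holds exactly one value per variable,
  and "the variable differs from a" becomes the positive condition that one of its other values is
  chosen. This is why variables are multi-valued, and how an implication between cells of a tableau
  becomes a positive clause. The obstacle on the graph side is that a pair of vertices contributes
  only one path, while one literal may have to cover many clauses. Each clause is therefore given a
  pendant of its own: a literal has a shortest path to any pendant of the clause hub through any
  clause that it satisfies. Literals are covered likewise by pairs of pendants of two further hubs,
  whether they are chosen or not. Pendants are in every solution anyway, so the threshold is the
  number of variables plus the number of pendants.\<close>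

datatype com =
    Skip
  | Inc nat
  | Dec nat
  | Out bool
  | Seq com com
  | Cond nat nat com com
  | Until nat nat com

text \<open>The tapes after the input tapes are counters: cell 0 is marked, and the position of the head is the
  value.\<close>

definition content :: "bool list list \<Rightarrow> nat \<Rightarrow> int \<Rightarrow> nat" where
  "content ws i = (if i < length ws then word_contents (ws ! i) else (\<lambda>p. if p = 0 then 3 else 0))"

definition symbol :: "bool list list \<Rightarrow> (nat \<Rightarrow> nat) \<Rightarrow> nat \<Rightarrow> nat" where
  "symbol ws v i = content ws i (int (v i))"

text \<open>The count \<open>t\<close> is the exact number of steps of the compiled code: a taken
  then-branch pays for the jump over the else-branch, and each round of \<open>Until\<close> pays
  for its test and for the jump back. There is no rule for \<open>Dec\<close> at value 0, so a
  derivation also shows that no head moves to the left of cell 0.\<close>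

inductive run :: "bool list list \<Rightarrow> com \<Rightarrow> (nat \<Rightarrow> nat) \<Rightarrow> bool list \<Rightarrow> nat \<Rightarrow> (nat \<Rightarrow> nat) \<Rightarrow> bool list \<Rightarrow> bool"
  for ws where
  run_Skip: "run ws Skip v w 0 v w"
| run_Inc: "run ws (Inc i) v w 1 (v(i := Suc (v i))) w"
| run_Dec: "v i = Suc k \<Longrightarrow> run ws (Dec i) v w 1 (v(i := k)) w"
| run_Out: "run ws (Out b) v w 1 v (w @ [b])"
| run_Seq: "run ws c v w t v' w' \<Longrightarrow> run ws c' v' w' t' v'' w'' \<Longrightarrow>
    run ws (Seq c c') v w (t + t') v'' w''"
| run_CondT: "symbol ws v i = s \<Longrightarrow> run ws c v w t v' w' \<Longrightarrow> run ws (Cond i s c c') v w (Suc (t + 1)) v' w'"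
| run_CondF: "symbol ws v i \<noteq> s \<Longrightarrow> run ws c' v w t v' w' \<Longrightarrow> run ws (Cond i s c c') v w (Suc t) v' w'"
| run_UntilT: "symbol ws v i = s \<Longrightarrow> run ws (Until i s c) v w 1 v w"
| run_UntilF: "symbol ws v i \<noteq> s \<Longrightarrow> run ws c v w t v' w' \<Longrightarrow> run ws (Until i s c) v' w' t' v'' w'' \<Longrightarrow>
    run ws (Until i s c) v w (Suc (t + (1 + t'))) v'' w''"

section \<open>Compilation of programs to Turing machines\<close>

datatype instr =
    Move nat move nat
  | Write bool nat
  | Branch nat nat nat nat
  | Mark nat nat

fun exec :: "nat \<Rightarrow> instr \<Rightarrow> nat list \<Rightarrow> nat \<times> (nat \<times> move) list" where
  "exec n (Move i d q) ss = (q, map (\<lambda>j. (ss ! j, if j = i then d else Stay)) [0..<Suc n])"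
| "exec n (Write b q) ss =
    (q, map (\<lambda>j. if j = n then (if b then 2 else 1, MoveRight) else (ss ! j, Stay)) [0..<Suc n])"
| "exec n (Branch i s q q') ss =
    (if ss ! i = s then q else q', map (\<lambda>j. (ss ! j, Stay)) [0..<Suc n])"
| "exec n (Mark m q) ss =
    (q, map (\<lambda>j. (if m \<le> j \<and> j < n then 3 else ss ! j, Stay)) [0..<Suc n])"

text \<open>Tape \<open>n\<close> is the output tape, and symbol 3 marks the counters. Control that
  runs off the end of the program is in state \<open>length P\<close>, the halting state; the entry
  of \<open>delta\<close> for that state makes \<open>wf_tm\<close> hold there.\<close>

definition machine :: "nat \<Rightarrow> instr list \<Rightarrow> tm" where
  "machine n P = \<lparr>ntapes = Suc n, nsyms = 4, nstates = Suc (length P), start = 0, halt = length P,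
     delta = (\<lambda>q. if q < length P then exec n (P ! q)
                  else (\<lambda>ss. (length P, map (\<lambda>s. (s, Stay)) ss)))\<rparr>"

fun targets :: "instr \<Rightarrow> nat set" where
  "targets (Move i d q) = {q}"
| "targets (Write b q) = {q}"
| "targets (Branch i s q q') = {q, q'}"
| "targets (Mark m q) = {q}"

lemma wf_machine:
  assumes "\<And>x. x \<in> set P \<Longrightarrow> \<forall>q\<in>targets x. q \<le> length P"
  shows "wf_tm (machine n P)"
proof -
  have "fst (exec n x ss) \<le> length P \<and> length (snd (exec n x ss)) = Suc n \<and>
        (\<forall>(s, d)\<in>set (snd (exec n x ss)). s < 4)"
    if "x \<in> set P" "length ss = Suc n" "\<forall>s\<in>set ss. s < 4" for x ss
  proof -
    have "ss ! j < 4" if "j < Suc n" for j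
      using that \<open>length ss = Suc n\<close> \<open>\<forall>s\<in>set ss. s < 4\<close> by (metis nth_mem)
    then show ?thesis using assms[OF that(1)] by (cases x) (auto simp del: upt_Suc)
  qed
  then have "fst (exec n (P ! q) ss) \<le> length P \<and> length (snd (exec n (P ! q) ss)) = Suc n \<and>
        (\<forall>(s, d)\<in>set (snd (exec n (P ! q) ss)). s < 4)"
    if "q < length P" "length ss = Suc n" "\<forall>s\<in>set ss. s < 4" for q ss
    using that by (meson nth_mem)
  then show ?thesis unfolding wf_tm_def machine_def
    by (simp add: less_Suc_eq_le split_beta)
qed

fun csize :: "com \<Rightarrow> nat" where
  "csize Skip = 0"
| "csize (Inc i) = 1"
| "csize (Dec i) = 1"
| "csize (Out b) = 1"
| "csize (Seq c c') = csize c + csize c'"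
| "csize (Cond i s c c') = csize c + csize c' + 2"
| "csize (Until i s c) = csize c + 2"

text \<open>Code placed at address \<open>a\<close> is left at \<open>a + csize c\<close>, so
  sequential composition is concatenation. A jump is a \<open>Branch\<close> whose two targets
  agree.\<close>

fun comp :: "com \<Rightarrow> nat \<Rightarrow> instr list" where
  "comp Skip a = []"
| "comp (Inc i) a = [Move i MoveRight (Suc a)]"
| "comp (Dec i) a = [Move i MoveLeft (Suc a)]"
| "comp (Out b) a = [Write b (Suc a)]"
| "comp (Seq c c') a = comp c a @ comp c' (a + csize c)"
| "comp (Cond i s c c') a =
    Branch i s (Suc a) (a + csize c + 2) # comp c (Suc a) @
    Branch 0 0 (a + csize c + csize c' + 2) (a + csize c + csize c' + 2) # comp c' (a + csize c + 2)"
| "comp (Until i s c) a =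
    Branch i s (a + csize c + 2) (Suc a) # comp c (Suc a) @ [Branch 0 0 a a]"

lemma length_comp [simp]: "length (comp c a) = csize c"
  by (induction c arbitrary: a) auto

lemma targets_comp: "x \<in> set (comp c a) \<Longrightarrow> q \<in> targets x \<Longrightarrow> q \<le> a + csize c"
  by (induction c arbitrary: a) fastforce+

fun tapes_below :: "nat \<Rightarrow> com \<Rightarrow> bool" where
  "tapes_below n Skip = True"
| "tapes_below n (Inc i) = (i < n)"
| "tapes_below n (Dec i) = (i < n)"
| "tapes_below n (Out b) = True"
| "tapes_below n (Seq c c') = (tapes_below n c \<and> tapes_below n c')"
| "tapes_below n (Cond i s c c') = (i < n \<and> tapes_below n c \<and> tapes_below n c')"
| "tapes_below n (Until i s c) = (i < n \<and> tapes_below n c)"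

lemma tapes_below_mono: "tapes_below n c \<Longrightarrow> n \<le> n' \<Longrightarrow> tapes_below n' c"
  by (induction c) auto

lemma tapes_below_exists: "\<exists>n. tapes_below n c"
proof (induction c)
  case (Seq c1 c2)
  then obtain n1 n2 where "tapes_below n1 c1" "tapes_below n2 c2" by auto
  then have "tapes_below (n1 + n2) (Seq c1 c2)" by (auto elim: tapes_below_mono)
  then show ?case by blast
next
  case (Cond i s c1 c2)
  then obtain n1 n2 where "tapes_below n1 c1" "tapes_below n2 c2" by auto
  then have "tapes_below (Suc (n1 + n2 + i)) (Cond i s c1 c2)" by (auto elim: tapes_below_mono)
  then show ?case by blast
next
  case (Until i s c)
  then obtain n where "tapes_below n c" by auto
  then have "tapes_below (Suc (n + i)) (Until i s c)" by (auto elim: tapes_below_mono)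
  then show ?case by blast
qed (auto intro: lessI)

definition tapes :: "bool list list \<Rightarrow> nat \<Rightarrow> (nat \<Rightarrow> nat) \<Rightarrow> bool list \<Rightarrow> tape list" where
  "tapes ws n v w = map (\<lambda>j. if j < n then (content ws j, int (v j)) else (word_contents w, int (length w)))
     [0..<Suc n]"

lemma length_tapes [simp]: "length (tapes ws n v w) = Suc n"
  by (simp add: tapes_def)

lemma nth_tapes: "j < Suc n \<Longrightarrow>
    tapes ws n v w ! j = (if j < n then (content ws j, int (v j)) else (word_contents w, int (length w)))"
  unfolding tapes_def by (subst nth_map) (auto simp del: upt_Suc)

lemma step_machine:
  assumes "q < length P"
  shows "step (machine n P) (q, tps) =
    (fst (exec n (P ! q) (map read_tape tps)), map2 act (snd (exec n (P ! q) (map read_tape tps))) tps)"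
  using assms by (simp add: step_def machine_def Let_def)

lemma act_read_tape: "act (read_tape tp, d) tp = (fst tp, snd tp + offset d)"
  by (simp add: act_def read_tape_def)

lemma nth_map_read_tapes: "j < Suc n \<Longrightarrow> map read_tape (tapes ws n v w) ! j = read_tape (tapes ws n v w ! j)"
  by (rule nth_map) simp

lemma read_tapes: "j < n \<Longrightarrow> read_tape (tapes ws n v w ! j) = symbol ws v j"
  by (simp add: nth_tapes read_tape_def symbol_def)

lemma map2_act_tapes:
  assumes "\<And>j. j < Suc n \<Longrightarrow> act (f j) (tapes ws n v w ! j) = tapes ws n v' w' ! j"
  shows "map2 act (map f [0..<Suc n]) (tapes ws n v w) = tapes ws n v' w'"
  using assms by (intro nth_equalityI) (auto simp del: upt_Suc)

text \<open>Admitting the output tape lets \<open>Branch 0 0 a a\<close> act as a jump even when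
  \<open>n = 0\<close> and tape 0 is the output tape.\<close>

lemma step_Branch_out:
  assumes "q < length P" "P ! q = Branch i s a b" "i < Suc n"
  shows "step (machine n P) (q, tapes ws n v w) =
    (if read_tape (tapes ws n v w ! i) = s then a else b, tapes ws n v w)"
proof -
  have "map2 act (map (\<lambda>j. (map read_tape (tapes ws n v w) ! j, Stay)) [0..<Suc n]) (tapes ws n v w) =
      tapes ws n v w"
    by (rule map2_act_tapes) (simp add: nth_map_read_tapes act_read_tape)
  then show ?thesis
    unfolding step_machine[OF assms(1)] assms(2) using assms(3) by (simp del: upt_Suc add: nth_map_read_tapes)
qed

lemma step_Branch:
  assumes "q < length P" "P ! q = Branch i s a b" "i < n"
  shows "step (machine n P) (q, tapes ws n v w) = (if symbol ws v i = s then a else b, tapes ws n v w)"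
  using step_Branch_out[OF assms(1,2)] assms(3) by (simp add: read_tapes)

lemma step_jump:
  assumes "q < length P" "P ! q = Branch 0 0 a a"
  shows "step (machine n P) (q, tapes ws n v w) = (a, tapes ws n v w)"
  using step_Branch_out[OF assms] by simp

lemma step_Move:
  assumes "q < length P" "P ! q = Move i d a" "i < n" "int k = int (v i) + offset d"
  shows "step (machine n P) (q, tapes ws n v w) = (a, tapes ws n (v(i := k)) w)"
proof -
  have "map2 act (map (\<lambda>j. (map read_tape (tapes ws n v w) ! j, if j = i then d else Stay)) [0..<Suc n])
      (tapes ws n v w) = tapes ws n (v(i := k)) w"
    by (rule map2_act_tapes) (use assms in \<open>auto simp: nth_map_read_tapes act_read_tape nth_tapes\<close>)
  then show ?thesis
    unfolding step_machine[OF assms(1)] assms(2) using assms(3) by (simp del: upt_Suc)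
qed

lemma word_contents_snoc:
  "word_contents (w @ [b]) = (word_contents w)(int (length w) := (if b then 2 else 1))"
  by (auto simp: word_contents_def fun_eq_iff nth_append)

lemma step_Write:
  assumes "q < length P" "P ! q = Write b a"
  shows "step (machine n P) (q, tapes ws n v w) = (a, tapes ws n v (w @ [b]))"
proof -
  have "map2 act (map (\<lambda>j. if j = n then (if b then 2 else 1, MoveRight)
        else (map read_tape (tapes ws n v w) ! j, Stay)) [0..<Suc n])
      (tapes ws n v w) = tapes ws n v (w @ [b])"
    by (rule map2_act_tapes)
      (auto simp: nth_map_read_tapes act_read_tape nth_tapes act_def read_tape_def word_contents_snoc)
  then show ?thesis
    unfolding step_machine[OF assms(1)] assms(2) by (simp del: upt_Suc)
qed

lemma funpow_step_trans:
  "(f ^^ t) x = y \<Longrightarrow> (f ^^ t') y = z \<Longrightarrow> (f ^^ (t + t')) x = z"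
  by (simp only: add.commute[of t t'] funpow_add comp_apply)

lemma funpow_step_Suc: "f x = y \<Longrightarrow> (f ^^ t) y = z \<Longrightarrow> (f ^^ Suc t) x = z"
  by (simp only: funpow_Suc_right comp_apply)

lemma funpow_step_one:
  fixes f :: "'a \<Rightarrow> 'a"
  shows "f x = y \<Longrightarrow> (f ^^ 1) x = y"
  by simp

text \<open>Induction on the derivation of \<open>run\<close>. The surrounding code
  \<open>pre\<close> and \<open>post\<close> is arbitrary because the parts of a compound command
  sit at inner addresses of the same program.\<close>

lemma run_machine:
  assumes "run ws c v w t v' w'" "tapes_below n c"
    and "P = pre @ comp c a @ post" "length pre = a"
  shows "(step (machine n P) ^^ t) (a, tapes ws n v w) = (a + csize c, tapes ws n v' w')"
  using assms
proof (induction arbitrary: pre post a rule: run.induct)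
  case (run_Inc i v w)
  then show ?case by (intro funpow_step_one) (subst step_Move[where k = "Suc (v i)"], auto simp: nth_append)
next
  case (run_Dec v i k w)
  then show ?case by (intro funpow_step_one) (subst step_Move[where k = k], auto simp: nth_append)
next
  case (run_Out b v w)
  then show ?case by (intro funpow_step_one) (subst step_Write, auto simp: nth_append)
next
  case (run_Seq c v w t v' w' c' t' v'' w'')
  have "(step (machine n P) ^^ t) (a, tapes ws n v w) = (a + csize c, tapes ws n v' w')"
    using run_Seq by (intro run_Seq.IH(1)) auto
  moreover have "(step (machine n P) ^^ t') (a + csize c, tapes ws n v' w') =
      ((a + csize c) + csize c', tapes ws n v'' w'')"
    using run_Seq by (intro run_Seq.IH(2)[where pre = "pre @ comp c a"]) auto
  ultimately show ?case by (auto intro: funpow_step_trans)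
next
  case (run_CondT v i s c w t v' w' c')
  have 1: "step (machine n P) (a, tapes ws n v w) = (Suc a, tapes ws n v w)"
    using run_CondT by (subst step_Branch) (auto simp: nth_append)
  have 2: "(step (machine n P) ^^ t) (Suc a, tapes ws n v w) = (Suc a + csize c, tapes ws n v' w')"
    using run_CondT by (intro run_CondT.IH[where pre = "pre @ [Branch i s (Suc a) (a + csize c + 2)]"]) auto
  have 3: "step (machine n P) (Suc a + csize c, tapes ws n v' w') = (a + csize (Cond i s c c'), tapes ws n v' w')"
    using run_CondT by (subst step_jump[where a = "a + csize (Cond i s c c')"]) (auto simp: nth_append)
  show ?case
    by (rule funpow_step_Suc[where f = "step (machine n P)", OF 1
        funpow_step_trans[OF 2 funpow_step_one[where f = "step (machine n P)", OF 3]]])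
next
  case (run_CondF v i s c' w t v' w' c)
  have 1: "step (machine n P) (a, tapes ws n v w) = (a + csize c + 2, tapes ws n v w)"
    using run_CondF by (subst step_Branch) (auto simp: nth_append)
  have 2: "(step (machine n P) ^^ t) (a + csize c + 2, tapes ws n v w) =
      (a + csize c + 2 + csize c', tapes ws n v' w')"
    using run_CondF
    by (intro run_CondF.IH[where pre = "pre @ Branch i s (Suc a) (a + csize c + 2) # comp c (Suc a) @
      [Branch 0 0 (a + csize c + csize c' + 2) (a + csize c + csize c' + 2)]"]) auto
  show ?case using funpow_step_Suc[OF 1 2] by (simp add: algebra_simps)
next
  case (run_UntilT v i s c w)
  then show ?case by (intro funpow_step_one) (subst step_Branch, auto simp: nth_append)
next
  case (run_UntilF v i s c w t v' w' t' v'' w'')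
  have 1: "step (machine n P) (a, tapes ws n v w) = (Suc a, tapes ws n v w)"
    using run_UntilF by (subst step_Branch) (auto simp: nth_append)
  have 2: "(step (machine n P) ^^ t) (Suc a, tapes ws n v w) = (Suc a + csize c, tapes ws n v' w')"
    using run_UntilF by (intro run_UntilF.IH(1)[where pre = "pre @ [Branch i s (a + csize c + 2) (Suc a)]"]) auto
  have 3: "step (machine n P) (Suc a + csize c, tapes ws n v' w') = (a, tapes ws n v' w')"
    using run_UntilF by (subst step_jump[where a = a]) (auto simp: nth_append)
  have 4: "(step (machine n P) ^^ t') (a, tapes ws n v' w') = (a + csize (Until i s c), tapes ws n v'' w'')"
    using run_UntilF.IH(2)[OF run_UntilF.prems] .
  show ?case
    by (rule funpow_step_Suc[where f = "step (machine n P)", OF 1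
        funpow_step_trans[OF 2 funpow_step_trans[OF funpow_step_one[where f = "step (machine n P)", OF 3] 4]]])
qed simp

text \<open>The first instruction marks cell 0 of every counter, which is blank initially; hence the
  code proper starts at address 1.\<close>

definition program :: "nat \<Rightarrow> com \<Rightarrow> instr list" where
  "program m c = Mark m 1 # comp c 1"

lemma step_Mark:
  assumes "length ws = m" "m \<le> n"
  shows "step (machine n (program m c)) (init_config (machine n (program m c)) ws) = (1, tapes ws n (\<lambda>_. 0) [])"
proof -
  let ?tps = "map (\<lambda>w. (word_contents w, 0 :: int)) (ws @ replicate (Suc n - m) [])"
  have nth: "?tps ! j = (word_contents (if j < m then ws ! j else []), 0)" if "j < Suc n" for j
    using that assms by (auto simp del: upt_Suc simp: nth_append)
  have len: "length ?tps = Suc n" using assms by simp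
  have "map2 act (snd (exec n (Mark m 1) (map read_tape ?tps))) ?tps = tapes ws n (\<lambda>_. 0) []"
  proof (rule nth_equalityI)
    show "length (map2 act (snd (exec n (Mark m 1) (map read_tape ?tps))) ?tps) = length (tapes ws n (\<lambda>_. 0) [])"
      using len by (simp del: upt_Suc)
  next
    fix j assume "j < length (map2 act (snd (exec n (Mark m 1) (map read_tape ?tps))) ?tps)"
    then have j: "j < Suc n" using len by (simp del: upt_Suc)
    have "map2 act (snd (exec n (Mark m 1) (map read_tape ?tps))) ?tps ! j =
        act (if m \<le> j \<and> j < n then 3 else read_tape (?tps ! j), Stay) (?tps ! j)"
      using j len by (simp del: upt_Suc map_append add: nth_map[of j ?tps])
    also have "\<dots> = tapes ws n (\<lambda>_. 0) [] ! j"
      unfolding nth[OF j] nth_tapes[OF j] using assms j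
      by (auto simp: act_def read_tape_def content_def word_contents_def fun_eq_iff)
    finally show "map2 act (snd (exec n (Mark m 1) (map read_tape ?tps))) ?tps ! j = tapes ws n (\<lambda>_. 0) [] ! j" .
  qed
  then show ?thesis unfolding init_config_def using assms
    by (subst step_machine) (simp_all del: upt_Suc map_append exec.simps add: program_def,
        simp_all del: map_append exec.simps add: machine_def, simp)
qed

lemma funpow_fixpoint: "f x = x \<Longrightarrow> (f ^^ t) x = x"
  by (induction t) auto

text \<open>The strict bound leaves room for the marking step. A halted configuration is a fixed
  point, so the run can be padded to exactly the value of the polynomial.\<close>

theorem polytime_computableI:
  fixes p :: "nat poly"
  assumes "\<And>ws. length ws = m \<Longrightarrow>
    \<exists>t v. t < poly p (sum_list (map length ws)) \<and> run ws c (\<lambda>_. 0) [] t v (f ws)"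
  shows "polytime_computable m f"
proof -
  obtain n where n: "m \<le> n" "tapes_below n c"
    using tapes_below_exists[of c] tapes_below_mono by (metis max.cobounded1 max.cobounded2)
  define M where "M = machine n (program m c)"
  have "wf_tm M" unfolding M_def
    by (rule wf_machine) (auto simp: program_def dest: targets_comp)
  moreover have "halts_with M ws (poly p (sum_list (map length ws))) (f ws)" if ws: "length ws = m" for ws
  proof -
    obtain t v where t: "t < poly p (sum_list (map length ws))" and r: "run ws c (\<lambda>_. 0) [] t v (f ws)"
      using assms[OF ws] by blast
    have "(step M ^^ t) (1, tapes ws n (\<lambda>_. 0) []) = (1 + csize c, tapes ws n v (f ws))"
      unfolding M_def by (rule run_machine[OF r n(2), where pre = "[Mark m 1]" and post = "[]"])
        (auto simp: program_def)
    then have "(step M ^^ Suc t) (init_config M ws) = (1 + csize c, tapes ws n v (f ws))"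
      using step_Mark[OF ws n(1)] by (intro funpow_step_Suc) (auto simp: M_def)
    moreover have "step M (1 + csize c, tapes ws n v (f ws)) = (1 + csize c, tapes ws n v (f ws))"
      by (simp add: step_def M_def machine_def program_def)
    ultimately have "(step M ^^ (Suc t + (poly p (sum_list (map length ws)) - Suc t))) (init_config M ws) =
        (1 + csize c, tapes ws n v (f ws))"
      by (intro funpow_step_trans) (auto simp: funpow_fixpoint)
    then have "(step M ^^ poly p (sum_list (map length ws))) (init_config M ws) =
        (1 + csize c, tapes ws n v (f ws))" using t by simp
    moreover have "last (tapes ws n v (f ws)) = (word_contents (f ws), int (length (f ws)))"
      by (simp add: tapes_def)
    ultimately show ?thesis
      by (simp add: halts_with_def M_def machine_def program_def)
  qed
  ultimately show ?thesis unfolding polytime_computable_def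
    using n(1) by (intro exI[of _ M] exI[of _ p]) (auto simp: M_def machine_def)
qed

section \<open>Functions computed by programs in polynomial time\<close>

text \<open>With a base of at least 2, constants and sums are absorbed by the exponent:
  \<open>c\<close> is at most \<open>2 ^ c\<close>, and a sum of two bounds costs one further
  factor.\<close>

definition polybounded :: "(nat \<Rightarrow> nat) \<Rightarrow> bool" where
  "polybounded f \<longleftrightarrow> (\<exists>k. \<forall>N. f N \<le> (N + 2) ^ k)"

lemma polybounded_const: "polybounded (\<lambda>N. c)"
proof -
  have "c \<le> (N + 2) ^ c" for N
    by (rule order.trans[OF less_imp_le[OF less_exp] power_mono]) auto
  then show ?thesis unfolding polybounded_def by blast
qed

lemma polybounded_id: "polybounded (\<lambda>N. N)"
  unfolding polybounded_def by (rule exI[of _ 1]) auto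

lemma polybounded_mult:
  assumes "polybounded f" "polybounded g"
  shows "polybounded (\<lambda>N. f N * g N)"
  using assms unfolding polybounded_def by (metis mult_le_mono power_add)

lemma polybounded_add:
  assumes "polybounded f" "polybounded g"
  shows "polybounded (\<lambda>N. f N + g N)"
proof -
  obtain k l where k: "\<And>N. f N \<le> (N + 2) ^ k" and l: "\<And>N. g N \<le> (N + 2) ^ l"
    using assms unfolding polybounded_def by blast
  have "f N + g N \<le> (N + 2) ^ Suc (k + l)" for N
  proof -
    have "f N \<le> (N + 2) ^ (k + l)" by (rule order.trans[OF k power_increasing]) auto
    moreover have "g N \<le> (N + 2) ^ (k + l)" by (rule order.trans[OF l power_increasing]) auto
    ultimately have "f N + g N \<le> 2 * (N + 2) ^ (k + l)" by simp
    also have "\<dots> \<le> (N + 2) ^ Suc (k + l)" by simp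
    finally show ?thesis .
  qed
  then show ?thesis unfolding polybounded_def by blast
qed

lemma polybounded_comp:
  assumes "polybounded f" "polybounded g"
  shows "polybounded (\<lambda>N. f (g N))"
proof -
  obtain k where k: "\<And>N. f N \<le> (N + 2) ^ k" using assms(1) unfolding polybounded_def by blast
  have "polybounded (\<lambda>N. g N + 2)" using polybounded_add[OF assms(2) polybounded_const] .
  then have "polybounded (\<lambda>N. (g N + 2) ^ k)"
    by (induction k) (auto simp del: add_2_eq_Suc' intro: polybounded_const polybounded_mult)
  then show ?thesis using k unfolding polybounded_def by (meson order.trans)
qed

lemma polybounded_Suc: "polybounded f \<Longrightarrow> polybounded (\<lambda>N. Suc (f N))"
  using polybounded_add[OF _ polybounded_const[of 1]] by simp

lemmas polybounded_intros = polybounded_const polybounded_id polybounded_mult polybounded_add polybounded_Suc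

lemma polybounded_poly:
  assumes "polybounded f"
  shows "\<exists>p :: nat poly. \<forall>N. f N < poly p N"
proof -
  obtain k where "\<And>N. f N \<le> (N + 2) ^ k" using assms unfolding polybounded_def by blast
  then have "f N < poly ([:2, 1:] ^ k + 1) N" for N
    by (simp add: poly_power add.commute le_imp_less_Suc)
  then show ?thesis by blast
qed

text \<open>Upper bounds replace exact counts, so that the branches of \<open>Cond\<close> and the
  rounds of \<open>Until\<close> can share a bound.\<close>

definition runs :: "bool list list \<Rightarrow> com \<Rightarrow> (nat \<Rightarrow> nat) \<Rightarrow> bool list \<Rightarrow> nat \<Rightarrow> (nat \<Rightarrow> nat) \<Rightarrow> bool list \<Rightarrow> bool" where
  "runs ws c v w B v' w' \<longleftrightarrow> (\<exists>t\<le>B. run ws c v w t v' w')"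

lemma runs_mono: "runs ws c v w B v' w' \<Longrightarrow> B \<le> B' \<Longrightarrow> runs ws c v w B' v' w'"
  unfolding runs_def by (meson order.trans)

lemma runs_Skip: "runs ws Skip v w 0 v w"
  unfolding runs_def using run_Skip by blast

lemma runs_cong: "runs ws c v w B v1 w \<Longrightarrow> v1 = v' \<Longrightarrow> runs ws c v w B v' w"
  by simp

lemma runs_Inc: "runs ws (Inc i) v w 1 (v(i := Suc (v i))) w"
  unfolding runs_def using run_Inc by blast

lemma runs_Dec: "0 < v i \<Longrightarrow> runs ws (Dec i) v w 1 (v(i := v i - 1)) w"
  unfolding runs_def using run_Dec[of v i "v i - 1"] by auto

lemma runs_Out: "runs ws (Out b) v w 1 v (w @ [b])"
  unfolding runs_def using run_Out by blast

lemma runs_Seq: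
  "runs ws c v w B v' w' \<Longrightarrow> runs ws c' v' w' B' v'' w'' \<Longrightarrow> runs ws (Seq c c') v w (B + B') v'' w''"
  unfolding runs_def by (meson add_mono run_Seq)

lemma runs_Cond:
  assumes "symbol ws v i = s \<Longrightarrow> runs ws c v w B v' w'" "symbol ws v i \<noteq> s \<Longrightarrow> runs ws c' v w B v' w'"
  shows "runs ws (Cond i s c c') v w (B + 2) v' w'"
proof (cases "symbol ws v i = s")
  case True
  with assms(1) obtain t where "t \<le> B" "run ws c v w t v' w'" by (auto simp: runs_def)
  with True show ?thesis unfolding runs_def
    by (intro exI[of _ "Suc (t + 1)"]) (auto intro!: run_CondT simp del: add_Suc_right One_nat_def)
next
  case False
  with assms(2) obtain t where "t \<le> B" "run ws c' v w t v' w'" by (auto simp: runs_def)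
  with False show ?thesis unfolding runs_def by (intro exI[of _ "Suc t"]) (auto intro: run_CondF)
qed

text \<open>Loops are described by explicit sequences: \<open>V k\<close> and \<open>W k\<close> are
  the registers and the output before round \<open>k\<close>.\<close>

lemma runs_Until:
  assumes "\<And>k. k < n \<Longrightarrow> symbol ws (V k) i \<noteq> s"
    and "\<And>k. k < n \<Longrightarrow> runs ws c (V k) (W k) B (V (Suc k)) (W (Suc k))"
    and "symbol ws (V n) i = s" and "v = V 0" "v' = V n" "w = W 0" "w' = W n"
  shows "runs ws (Until i s c) v w (n * (B + 2) + 1) v' w'"
  using assms
proof (induction n arbitrary: V W v v' w w')
  case 0
  then show ?case unfolding runs_def using run_UntilT by fastforce
next
  case (Suc n)
  obtain t where t: "t \<le> B" "run ws c (V 0) (W 0) t (V 1) (W 1)"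
    using Suc.prems(2)[of 0] by (auto simp: runs_def)
  have "runs ws (Until i s c) (V 1) (W 1) (n * (B + 2) + 1) (V (Suc n)) (W (Suc n))"
    by (rule Suc.IH[where V = "\<lambda>k. V (Suc k)" and W = "\<lambda>k. W (Suc k)"]) (use Suc.prems in auto)
  then obtain t' where t': "t' \<le> n * (B + 2) + 1" "run ws (Until i s c) (V 1) (W 1) t' (V (Suc n)) (W (Suc n))"
    by (auto simp: runs_def)
  have "run ws (Until i s c) (V 0) (W 0) (Suc (t + (1 + t'))) (V (Suc n)) (W (Suc n))"
    by (rule run_UntilF[OF _ t(2) t'(2)]) (use Suc.prems(1)[of 0] in auto)
  then show ?case unfolding runs_def using t(1) t'(1) Suc.prems
    by (intro exI[of _ "Suc (t + (1 + t'))"]) auto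
qed

lemma symbol_counter: "length ws \<le> i \<Longrightarrow> symbol ws v i = (if v i = 0 then 3 else 0)"
  by (simp add: symbol_def content_def)

lemma symbol_input: "i < length ws \<Longrightarrow> symbol ws v i =
    (if v i < length (ws ! i) then if ws ! i ! v i then 2 else 1 else 0)"
  by (simp add: symbol_def content_def word_contents_def)

lemma fun_upd_cong_val: "x = y \<Longrightarrow> v(i := x) = v(i := y)"
  by simp

lemma runs_clear:
  assumes "length ws \<le> i" "v i \<le> B" "v' = v(i := 0)"
  shows "runs ws (Until i 3 (Dec i)) v w (B * 3 + 1) v' w"
proof (rule runs_mono)
  show "runs ws (Until i 3 (Dec i)) v w (v i * (1 + 2) + 1) v' w"
    by (rule runs_Until[where V = "\<lambda>k. v(i := v i - k)" and W = "\<lambda>_. w"])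
      (use assms in \<open>auto simp: symbol_counter simp del: One_nat_def intro!: runs_cong[OF runs_Dec] fun_upd_cong_val\<close>)
qed (use assms in auto)

lemma runs_transfer:
  assumes "length ws \<le> i" "i \<noteq> j" "v i \<le> B" "v' = v(i := 0, j := v j + v i)"
  shows "runs ws (Until i 3 (Seq (Dec i) (Inc j))) v w (B * 4 + 1) v' w"
proof (rule runs_mono)
  show "runs ws (Until i 3 (Seq (Dec i) (Inc j))) v w (v i * ((1 + 1) + 2) + 1) v' w"
  proof (rule runs_Until[where V = "\<lambda>k. v(i := v i - k, j := v j + k)" and W = "\<lambda>_. w"])
    fix k assume "k < v i"
    then show "runs ws (Seq (Dec i) (Inc j)) (v(i := v i - k, j := v j + k)) w (1 + 1)
        (v(i := v i - Suc k, j := v j + Suc k)) w"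
      by (intro runs_cong[OF runs_Seq[OF runs_Dec runs_Inc]]) (use assms in auto)
  qed (use assms in \<open>auto simp: symbol_counter\<close>)
qed (use assms in auto)

text \<open>A counter can be read only by counting it down. The second copy serves to restore the
  source afterwards or, when one of the targets is the head of an input tape, to bring that head
  back.\<close>

lemma runs_copy:
  assumes "length ws \<le> i" "i \<noteq> j" "i \<noteq> k" "j \<noteq> k" "v j = 0" "v k = 0" "v i \<le> B" "v' = v(i := 0, j := v i, k := v i)"
  shows "runs ws (Until i 3 (Seq (Dec i) (Seq (Inc j) (Inc k)))) v w (B * 5 + 1) v' w"
proof (rule runs_mono)
  show "runs ws (Until i 3 (Seq (Dec i) (Seq (Inc j) (Inc k)))) v w (v i * ((1 + (1 + 1)) + 2) + 1) v' w"
  proof (rule runs_Until[where V = "\<lambda>l. v(i := v i - l, j := l, k := l)" and W = "\<lambda>_. w"])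
    fix l assume "l < v i"
    then show "runs ws (Seq (Dec i) (Seq (Inc j) (Inc k))) (v(i := v i - l, j := l, k := l)) w (1 + (1 + 1))
        (v(i := v i - Suc l, j := Suc l, k := Suc l)) w"
      by (intro runs_cong[OF runs_Seq[OF runs_Dec runs_Seq[OF runs_Inc runs_Inc]]])
        (use assms in \<open>auto simp: fun_eq_iff\<close>)
  qed (use assms in \<open>auto simp: symbol_counter fun_eq_iff\<close>)
qed (use assms in auto)

text \<open>An input tape carries no mark at cell 0, so its head \<open>j\<close> is brought home
  with the help of a counter \<open>i\<close> of equal value.\<close>

lemma runs_unwind:
  assumes "length ws \<le> i" "i \<noteq> j" "v i = v j" "v i \<le> B" "v' = v(i := 0, j := 0)"
  shows "runs ws (Until i 3 (Seq (Dec i) (Dec j))) v w (B * 4 + 1) v' w"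
proof (rule runs_mono)
  show "runs ws (Until i 3 (Seq (Dec i) (Dec j))) v w (v i * ((1 + 1) + 2) + 1) v' w"
  proof (rule runs_Until[where V = "\<lambda>l. v(i := v i - l, j := v i - l)" and W = "\<lambda>_. w"])
    fix l assume "l < v i"
    then show "runs ws (Seq (Dec i) (Dec j)) (v(i := v i - l, j := v i - l)) w (1 + 1)
        (v(i := v i - Suc l, j := v i - Suc l)) w"
      by (intro runs_cong[OF runs_Seq[OF runs_Dec runs_Dec]]) (use assms in \<open>auto simp: fun_eq_iff\<close>)
  qed (use assms in \<open>auto simp: symbol_counter fun_eq_iff\<close>)
qed (use assms in auto)

section \<open>Functions of the input words and of an environment\<close>

type_synonym env = "nat \<Rightarrow> nat"

definition push :: "nat \<Rightarrow> env \<Rightarrow> env" where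
  "push x e = case_nat x e"

lemma push_simps [simp]: "push x e 0 = x" "push x e (Suc i) = e i"
  by (simp_all add: push_def)

definition bounded_inputs :: "nat \<Rightarrow> bool list list \<Rightarrow> nat \<Rightarrow> bool" where
  "bounded_inputs m ws N \<longleftrightarrow> length ws = m \<and> (\<forall>w\<in>set ws. length w \<le> N)"

definition growth :: "nat \<Rightarrow> (bool list list \<Rightarrow> env \<Rightarrow> nat) \<Rightarrow> (nat \<Rightarrow> nat) \<Rightarrow> bool" where
  "growth m F g \<longleftrightarrow> (\<forall>ws e N. bounded_inputs m ws N \<longrightarrow> (\<forall>i. e i \<le> N) \<longrightarrow> F ws e \<le> g N)"

definition poly_growth :: "nat \<Rightarrow> (bool list list \<Rightarrow> env \<Rightarrow> nat) \<Rightarrow> bool" where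
  "poly_growth m F \<longleftrightarrow> (\<exists>g. polybounded g \<and> growth m F g)"

text \<open>Variable \<open>i\<close> (a de Bruijn index) is held in register \<open>rs ! i\<close>. The result is left in register \<open>b\<close>, and
  the registers from \<open>b\<close> on, which are zero on entry, serve as scratch space.\<close>

definition reg_env :: "nat list \<Rightarrow> (nat \<Rightarrow> nat) \<Rightarrow> env" where
  "reg_env rs v i = (if i < length rs then v (rs ! i) else 0)"

definition ready :: "nat \<Rightarrow> nat \<Rightarrow> nat \<Rightarrow> (nat \<Rightarrow> nat) \<Rightarrow> bool" where
  "ready m b N v \<longleftrightarrow> (\<forall>i<m. v i = 0) \<and> (\<forall>i\<ge>b. v i = 0) \<and> (\<forall>i. v i \<le> N)"

text \<open>Only register \<open>b\<close> changes: scratch registers are cleared again, variables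
  are restored and the heads of the input tapes return to cell 0. The time depends on a common bound
  \<open>N\<close> for input lengths and register contents.\<close>

definition computes :: "nat \<Rightarrow> (bool list list \<Rightarrow> env \<Rightarrow> nat) \<Rightarrow> nat list \<Rightarrow> nat \<Rightarrow> com \<Rightarrow> (nat \<Rightarrow> nat) \<Rightarrow> bool" where
  "computes m F rs b c f \<longleftrightarrow> (\<forall>ws v w N. bounded_inputs m ws N \<longrightarrow> ready m b N v \<longrightarrow>
     runs ws c v w (f N) (v(b := F ws (reg_env rs v))) w)"

text \<open>Time bounds refer to the contents of registers, so a nested evaluation needs a bound on
  intermediate values; hence \<open>poly_growth\<close> is part of the notion. A program must exist
  for every placement \<open>rs\<close> of the variables, since binders add registers.\<close>

definition feasible :: "nat \<Rightarrow> (bool list list \<Rightarrow> env \<Rightarrow> nat) \<Rightarrow> bool" where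
  "feasible m F \<longleftrightarrow> poly_growth m F \<and> (\<forall>rs b. set rs \<subseteq> {m..<b} \<longrightarrow> m \<le> b \<longrightarrow>
     (\<exists>c f. polybounded f \<and> computes m F rs b c f))"

lemma feasible_computes:
  assumes "feasible m F" "set rs \<subseteq> {m..<b}" "m \<le> b"
  obtains c f where "polybounded f" "computes m F rs b c f"
  using assms unfolding feasible_def by blast

lemma feasible_growth: "feasible m F \<Longrightarrow> poly_growth m F"
  by (simp add: feasible_def)

lemma growthD: "growth m F g \<Longrightarrow> bounded_inputs m ws N \<Longrightarrow> (\<And>i. e i \<le> N) \<Longrightarrow> F ws e \<le> g N"
  by (auto simp: growth_def)

lemma growth_reg_env:
  "growth m F g \<Longrightarrow> bounded_inputs m ws N \<Longrightarrow> ready m b N v \<Longrightarrow> F ws (reg_env rs v) \<le> g N"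
  by (erule (1) growthD) (auto simp: reg_env_def ready_def)

lemma bounded_inputs_mono: "bounded_inputs m ws N \<Longrightarrow> N \<le> N' \<Longrightarrow> bounded_inputs m ws N'"
  by (auto simp: bounded_inputs_def)

lemma reg_env_upd: "set rs \<subseteq> {m..<b} \<Longrightarrow> b \<le> i \<Longrightarrow> reg_env rs (v(i := x)) = reg_env rs v"
  unfolding reg_env_def fun_eq_iff by (auto dest!: nth_mem)

lemma reg_env_Cons: "reg_env (r # rs) v = push (v r) (reg_env rs v)"
  by (auto simp: reg_env_def push_def fun_eq_iff split: nat.splits)

lemma feasible_zero: "feasible m (\<lambda>ws e. 0)"
proof -
  have "computes m (\<lambda>ws e. 0) rs b Skip (\<lambda>_. 0)" for rs b
    unfolding computes_def
  proof (intro allI impI)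
    fix ws v w N assume "ready m b N v"
    then have "v(b := 0) = v" by (auto simp: ready_def)
    then show "runs ws Skip v w 0 (v(b := 0)) w" using runs_Skip by simp
  qed
  then show ?thesis unfolding feasible_def poly_growth_def growth_def
    using polybounded_const[of 0] by blast
qed

lemma feasible_Suc:
  assumes "feasible m F"
  shows "feasible m (\<lambda>ws e. Suc (F ws e))"
proof -
  obtain g where g: "polybounded g" "growth m F g" using assms by (auto simp: feasible_def poly_growth_def)
  have "growth m (\<lambda>ws e. Suc (F ws e)) (\<lambda>N. Suc (g N))"
    using g(2) by (simp add: growth_def)
  moreover have "\<exists>c f. polybounded f \<and> computes m (\<lambda>ws e. Suc (F ws e)) rs b c f"
    if rs: "set rs \<subseteq> {m..<b}" "m \<le> b" for rs b
  proof -
    obtain c f where c: "polybounded f" "computes m F rs b c f"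
      by (rule feasible_computes[OF assms rs])
    have "computes m (\<lambda>ws e. Suc (F ws e)) rs b (Seq c (Inc b)) (\<lambda>N. f N + 1)"
      unfolding computes_def
      by (intro allI impI runs_cong[OF runs_Seq[OF _ runs_Inc]]) (use c(2) in \<open>auto simp: computes_def\<close>)
    moreover have "polybounded (\<lambda>N. f N + 1)" by (intro polybounded_intros c)
    ultimately show ?thesis by blast
  qed
  ultimately show ?thesis unfolding feasible_def poly_growth_def
    using polybounded_Suc[OF g(1)] by blast
qed

text \<open>A variable without a register reads as 0. Otherwise its register is counted down into
  \<open>b\<close> and \<open>b + 1\<close>, and the second copy is moved back.\<close>

lemma feasible_var: "feasible m (\<lambda>ws e. e i)"
proof -
  have "growth m (\<lambda>ws e. e i) (\<lambda>N. N)" by (simp add: growth_def)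
  moreover have "\<exists>c f. polybounded f \<and> computes m (\<lambda>ws e. e i) rs b c f"
    if rs: "set rs \<subseteq> {m..<b}" "m \<le> b" for rs b
  proof (cases "i < length rs")
    case False
    then have "computes m (\<lambda>ws e. e i) rs b c f = computes m (\<lambda>ws e. 0) rs b c f" for c f
      by (simp add: computes_def reg_env_def)
    then show ?thesis using feasible_zero that by (simp add: feasible_def)
  next
    case True
    define r where "r = rs ! i"
    have r: "m \<le> r" "r < b" using subsetD[OF rs(1) nth_mem[OF True]] by (auto simp: r_def)
    let ?c = "Seq (Until r 3 (Seq (Dec r) (Seq (Inc b) (Inc (Suc b)))))
      (Until (Suc b) 3 (Seq (Dec (Suc b)) (Inc r)))"
    have "computes m (\<lambda>ws e. e i) rs b ?c (\<lambda>N. (N * 5 + 1) + (N * 4 + 1))"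
      unfolding computes_def
    proof (intro allI impI runs_Seq)
      fix ws v w N assume a: "bounded_inputs m ws N" "ready m b N v"
      have vr: "v b = 0" "v (Suc b) = 0" "v r \<le> N" "length ws \<le> r" "length ws \<le> Suc b"
        using a rs r by (auto simp: ready_def bounded_inputs_def)
      show "runs ws (Until r 3 (Seq (Dec r) (Seq (Inc b) (Inc (Suc b))))) v w (N * 5 + 1)
          (v(r := 0, b := v r, Suc b := v r)) w"
        by (rule runs_copy) (use r vr in auto)
      show "runs ws (Until (Suc b) 3 (Seq (Dec (Suc b)) (Inc r))) (v(r := 0, b := v r, Suc b := v r)) w
          (N * 4 + 1) (v(b := reg_env rs v i)) w"
        by (rule runs_transfer) (use r vr True in \<open>auto simp: reg_env_def r_def fun_eq_iff\<close>)
    qed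
    moreover have "polybounded (\<lambda>N. (N * 5 + 1) + (N * 4 + 1))" by (intro polybounded_intros)
    ultimately show ?thesis by blast
  qed
  ultimately show ?thesis unfolding feasible_def poly_growth_def
    using polybounded_id by blast
qed

definition bit_at :: "bool list \<Rightarrow> nat \<Rightarrow> bool" where
  "bit_at w i \<longleftrightarrow> i < length w \<and> w ! i"

text \<open>The value of \<open>F\<close> drives the head of input tape \<open>j\<close> and is kept
  in \<open>b + 1\<close> to bring the head back. Symbol 2 is read exactly if the bit exists and is
  set, because the tape is blank behind the word.\<close>

lemma feasible_bit_at:
  assumes "j < m" "feasible m F"
  shows "feasible m (\<lambda>ws e. of_bool (bit_at (ws ! j) (F ws e)))"
proof -
  obtain g where g: "polybounded g" "growth m F g" using assms by (auto simp: feasible_def poly_growth_def)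
  have "growth m (\<lambda>ws e. of_bool (bit_at (ws ! j) (F ws e))) (\<lambda>N. 1)" by (simp add: growth_def)
  moreover have "\<exists>c f. polybounded f \<and> computes m (\<lambda>ws e. of_bool (bit_at (ws ! j) (F ws e))) rs b c f"
    if rs: "set rs \<subseteq> {m..<b}" "m \<le> b" for rs b
  proof -
    obtain c f where c: "polybounded f" "computes m F rs b c f"
      by (rule feasible_computes[OF assms(2) rs])
    let ?c = "Seq c (Seq (Until b 3 (Seq (Dec b) (Seq (Inc (Suc b)) (Inc j))))
        (Seq (Cond j 2 (Inc b) Skip)
        (Until (Suc b) 3 (Seq (Dec (Suc b)) (Dec j)))))"
    have "computes m (\<lambda>ws e. of_bool (bit_at (ws ! j) (F ws e))) rs b ?c
        (\<lambda>N. f N + ((g N * 5 + 1) + ((1 + 2) + (g N * 4 + 1))))"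
      unfolding computes_def
    proof (intro allI impI runs_Seq)
      fix ws v w N assume a: "bounded_inputs m ws N" "ready m b N v"
      define t where "t = F ws (reg_env rs v)"
      define r :: nat where "r = of_bool (bit_at (ws ! j) t)"
      have t: "t \<le> g N" unfolding t_def using growth_reg_env[OF g(2) a] .
      have vr: "v b = 0" "v (Suc b) = 0" "v j = 0" "j < length ws" "length ws \<le> b" "length ws \<le> Suc b" "j < b"
        using a rs assms(1) by (auto simp: ready_def bounded_inputs_def)
      show "runs ws c v w (f N) (v(b := t)) w" using c(2) a by (auto simp: computes_def t_def)
      show "runs ws (Until b 3 (Seq (Dec b) (Seq (Inc (Suc b)) (Inc j)))) (v(b := t)) w (g N * 5 + 1)
          (v(Suc b := t, j := t)) w"
        by (rule runs_copy) (use vr t in \<open>auto simp: fun_eq_iff\<close>)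
      show "runs ws (Cond j 2 (Inc b) Skip) (v(Suc b := t, j := t)) w (1 + 2) (v(b := r, Suc b := t, j := t)) w"
      proof (rule runs_Cond)
        assume 2: "symbol ws (v(Suc b := t, j := t)) j = 2"
        show "runs ws (Inc b) (v(Suc b := t, j := t)) w 1 (v(b := r, Suc b := t, j := t)) w"
          by (rule runs_cong[OF runs_Inc])
            (use vr 2 in \<open>auto simp: symbol_input r_def bit_at_def fun_eq_iff split: if_splits\<close>)
      next
        assume "symbol ws (v(Suc b := t, j := t)) j \<noteq> 2"
        then have "r = 0" using vr by (auto simp: symbol_input r_def bit_at_def split: if_splits)
        then have "v(b := r, Suc b := t, j := t) = v(Suc b := t, j := t)" using vr by (auto simp: fun_eq_iff)
        then show "runs ws Skip (v(Suc b := t, j := t)) w 1 (v(b := r, Suc b := t, j := t)) w"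
          using runs_mono[OF runs_Skip, of 1] by simp
      qed
      show "runs ws (Until (Suc b) 3 (Seq (Dec (Suc b)) (Dec j))) (v(b := r, Suc b := t, j := t)) w
          (g N * 4 + 1) (v(b := of_bool (bit_at (ws ! j) (F ws (reg_env rs v))))) w"
        by (rule runs_unwind) (use vr t in \<open>auto simp: fun_eq_iff r_def t_def\<close>)
    qed
    moreover have "polybounded (\<lambda>N. f N + ((g N * 5 + 1) + ((1 + 2) + (g N * 4 + 1))))"
      by (intro polybounded_intros c g)
    ultimately show ?thesis by blast
  qed
  ultimately show ?thesis unfolding feasible_def poly_growth_def
    using polybounded_const by blast
qed

lemma feasible_length:
  assumes "j < m"
  shows "feasible m (\<lambda>ws e. length (ws ! j))"
proof -
  have len: "length (ws ! j) \<le> N" if "bounded_inputs m ws N" for ws N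
    using that assms by (auto simp: bounded_inputs_def)
  then have "growth m (\<lambda>ws e. length (ws ! j)) (\<lambda>N. N)" by (simp add: growth_def)
  moreover have "\<exists>c f. polybounded f \<and> computes m (\<lambda>ws e. length (ws ! j)) rs b c f"
    if rs: "set rs \<subseteq> {m..<b}" "m \<le> b" for rs b
  proof -
    let ?c = "Seq (Until j 0 (Seq (Inc b) (Seq (Inc (Suc b)) (Inc j))))
        (Until (Suc b) 3 (Seq (Dec (Suc b)) (Dec j)))"
    have "computes m (\<lambda>ws e. length (ws ! j)) rs b ?c (\<lambda>N. (N * 5 + 1) + (N * 4 + 1))"
      unfolding computes_def
    proof (intro allI impI runs_Seq)
      fix ws v w N assume a: "bounded_inputs m ws N" "ready m b N v"
      define t where "t = length (ws ! j)"
      have t: "t \<le> N" unfolding t_def using len[OF a(1)] .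
      have vr: "v b = 0" "v (Suc b) = 0" "v j = 0" "j < length ws" "length ws \<le> b" "length ws \<le> Suc b" "j < b"
        using a rs assms(1) by (auto simp: ready_def bounded_inputs_def)
      show "runs ws (Until j 0 (Seq (Inc b) (Seq (Inc (Suc b)) (Inc j)))) v w (N * 5 + 1)
          (v(b := t, Suc b := t, j := t)) w"
      proof (rule runs_mono)
        show "runs ws (Until j 0 (Seq (Inc b) (Seq (Inc (Suc b)) (Inc j)))) v w
            (t * ((1 + (1 + 1)) + 2) + 1) (v(b := t, Suc b := t, j := t)) w"
        proof (rule runs_Until[where V = "\<lambda>k. v(b := k, Suc b := k, j := k)" and W = "\<lambda>_. w"])
          fix k assume k: "k < t"
          show "runs ws (Seq (Inc b) (Seq (Inc (Suc b)) (Inc j))) (v(b := k, Suc b := k, j := k)) w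
              (1 + (1 + 1)) (v(b := Suc k, Suc b := Suc k, j := Suc k)) w"
            by (rule runs_cong[OF runs_Seq[OF runs_Inc runs_Seq[OF runs_Inc runs_Inc]]])
              (use k vr in \<open>auto simp: fun_eq_iff\<close>)
        qed (use vr in \<open>auto simp: symbol_input fun_eq_iff t_def\<close>)
      qed (use t in auto)
      show "runs ws (Until (Suc b) 3 (Seq (Dec (Suc b)) (Dec j))) (v(b := t, Suc b := t, j := t)) w
          (N * 4 + 1) (v(b := length (ws ! j))) w"
        by (rule runs_unwind) (use vr t in \<open>auto simp: fun_eq_iff t_def\<close>)
    qed
    moreover have "polybounded (\<lambda>N. (N * 5 + 1) + (N * 4 + 1))" by (intro polybounded_intros)
    ultimately show ?thesis by blast
  qed
  ultimately show ?thesis unfolding feasible_def poly_growth_def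
    using polybounded_id by blast
qed

text \<open>Weakening: an expression is moved under \<open>d\<close> further binders by ignoring the
  registers of the innermost variables.\<close>

lemma feasible_shift:
  assumes "feasible m F"
  shows "feasible m (\<lambda>ws e. F ws (\<lambda>i. e (i + d)))"
proof -
  obtain g where g: "polybounded g" "growth m F g" using assms by (auto simp: feasible_def poly_growth_def)
  have "growth m (\<lambda>ws e. F ws (\<lambda>i. e (i + d))) g" using g(2) by (simp add: growth_def)
  moreover have "\<exists>c f. polybounded f \<and> computes m (\<lambda>ws e. F ws (\<lambda>i. e (i + d))) rs b c f"
    if rs: "set rs \<subseteq> {m..<b}" "m \<le> b" for rs b
  proof -
    have "set (drop d rs) \<subseteq> {m..<b}" using rs(1) set_drop_subset[of d rs] by blast
    then obtain c f where c: "polybounded f" "computes m F (drop d rs) b c f"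
      using assms rs by (meson feasible_def)
    have "reg_env (drop d rs) v = (\<lambda>i. reg_env rs v (i + d))" for v
      by (auto simp: reg_env_def fun_eq_iff add.commute)
    then have "computes m (\<lambda>ws e. F ws (\<lambda>i. e (i + d))) rs b c f"
      using c(2) by (simp add: computes_def)
    then show ?thesis using c(1) by blast
  qed
  ultimately show ?thesis using g(1) unfolding feasible_def poly_growth_def by blast
qed

text \<open>Registers \<open>b\<close>, \<open>b + 1\<close> and \<open>b + 2\<close> hold the remaining number of iterations, the index and the
  accumulator.\<close>

lemma feasible_rec_push:
  assumes T: "feasible m T" and H: "feasible m H" and G: "feasible m G" and B: "poly_growth m B"
    and le: "\<And>ws e j. length ws = m \<Longrightarrow> j \<le> T ws e \<Longrightarrow>
      rec_nat (H ws e) (\<lambda>i r. G ws (push r (push i e))) j \<le> B ws e"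
  shows "feasible m (\<lambda>ws e. rec_nat (H ws e) (\<lambda>i r. G ws (push r (push i e))) (T ws e))"
    (is "feasible m ?F")
proof -
  let ?R = "\<lambda>ws e j. rec_nat (H ws e) (\<lambda>i r. G ws (push r (push i e))) j"
  obtain gT where gT: "polybounded gT" "growth m T gT" using T by (auto simp: feasible_def poly_growth_def)
  obtain gB where gB: "polybounded gB" "growth m B gB" using B by (auto simp: poly_growth_def)
  have R: "?R ws e j \<le> gB N" if "bounded_inputs m ws N" "\<And>i. e i \<le> N" "j \<le> T ws e" for ws e j N
    using le[of ws j e] growthD[OF gB(2), of ws N e] that by (force simp: bounded_inputs_def)
  then have "growth m ?F gB" by (simp add: growth_def)
  moreover have "\<exists>c f. polybounded f \<and> computes m ?F rs b c f"
    if rs: "set rs \<subseteq> {m..<b}" "m \<le> b" for rs b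
  proof -
    obtain cT fT where cT: "polybounded fT" "computes m T rs b cT fT"
      by (rule feasible_computes[OF T rs])
    have "set rs \<subseteq> {m..<b + 2}" "m \<le> b + 2" using rs by auto
    then obtain cH fH where cH: "polybounded fH" "computes m H rs (b + 2) cH fH"
      using H by (meson feasible_def)
    have "set ((b + 2) # (b + 1) # rs) \<subseteq> {m..<b + 3}" "m \<le> b + 3" using rs by auto
    then obtain cG fG where cG: "polybounded fG" "computes m G ((b + 2) # (b + 1) # rs) (b + 3) cG fG"
      using G by (meson feasible_def)
    \<comment> \<open>\<open>M N\<close> bounds every register throughout the loop: the variables by
      \<open>N\<close>, the remaining rounds and the index by \<open>gT N\<close>, the accumulator
      by \<open>gB N\<close>. The times of \<open>cH\<close> and \<open>cG\<close> are therefore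
      taken at \<open>M N\<close>.\<close>
    define M where "M N = N + gT N + gB N" for N
    have M: "polybounded M" unfolding M_def by (intro polybounded_intros gT gB)
    let ?body = "Seq (Dec b) (Seq cG (Seq (Until (b + 2) 3 (Dec (b + 2)))
      (Seq (Until (b + 3) 3 (Seq (Dec (b + 3)) (Inc (b + 2)))) (Inc (b + 1)))))"
    define t where "t N = 1 + (fG (M N) + ((M N * 3 + 1) + ((M N * 4 + 1) + 1)))" for N
    have t: "polybounded t" unfolding t_def by (intro polybounded_intros polybounded_comp[OF cG(1)] M)
    let ?c = "Seq cT (Seq cH (Seq (Until b 3 ?body)
      (Seq (Until (b + 1) 3 (Dec (b + 1))) (Until (b + 2) 3 (Seq (Dec (b + 2)) (Inc b))))))"
    let ?f = "\<lambda>N. fT N + (fH (M N) + ((M N * (t N + 2) + 1) + ((M N * 3 + 1) + (M N * 4 + 1))))"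
    have "computes m ?F rs b ?c ?f"
      unfolding computes_def
    proof (intro allI impI runs_Seq)
      fix ws v w N assume a: "bounded_inputs m ws N" "ready m b N v"
      define e where "e = reg_env rs v"
      define n where "n = T ws e"
      have e: "e i \<le> N" for i using a(2) by (auto simp: e_def reg_env_def ready_def)
      have n: "n \<le> M N" unfolding n_def M_def using growthD[OF gT(2) a(1), of e] e by simp
      have Rj: "?R ws e j \<le> M N" if "j \<le> n" for j
        using R[OF a(1), of e j] e that unfolding M_def n_def by fastforce
      have aM: "bounded_inputs m ws (M N)" by (rule bounded_inputs_mono[OF a(1)]) (simp add: M_def)
      have len: "length ws = m" using a(1) by (simp add: bounded_inputs_def)
      have v: "\<And>i. i < m \<Longrightarrow> v i = 0" "\<And>i. b \<le> i \<Longrightarrow> v i = 0" "\<And>i. v i \<le> M N"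
        using a(2) by (auto simp: ready_def M_def add.assoc intro: trans_le_add1)
      let ?V = "\<lambda>k. v(b := n - k, b + 1 := k, b + 2 := ?R ws e k)"
      show "runs ws cT v w (fT N) (v(b := n)) w" using cT(2) a by (auto simp: computes_def n_def e_def)
      have "ready m (b + 2) (M N) (v(b := n))" using v n rs by (auto simp: ready_def)
      then have "runs ws cH (v(b := n)) w (fH (M N)) (v(b := n, b + 2 := H ws (reg_env rs (v(b := n))))) w"
        using cH(2) aM by (auto simp: computes_def)
      also have "v(b := n, b + 2 := H ws (reg_env rs (v(b := n)))) = ?V 0"
        using v(2)[of "b + 1"] by (auto simp: reg_env_upd[OF rs(1)] e_def)
      finally show "runs ws cH (v(b := n)) w (fH (M N)) (?V 0) w" .
      have body: "runs ws ?body (?V k) w (t N) (?V (Suc k)) w" if k: "k < n" for k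
        unfolding t_def
      proof (intro runs_Seq)
        let ?v = "v(b := n - Suc k, b + 1 := k, b + 2 := ?R ws e k)"
        show "runs ws (Dec b) (?V k) w 1 ?v w"
          by (rule runs_cong[OF runs_Dec]) (use k in \<open>auto simp: fun_eq_iff\<close>)
        have "ready m (b + 3) (M N) ?v" using v n rs k Rj[of k] by (auto simp: ready_def)
        then have "runs ws cG ?v w (fG (M N)) (?v(b + 3 := G ws (reg_env ((b + 2) # (b + 1) # rs) ?v))) w"
          using cG(2) aM by (auto simp: computes_def)
        moreover have "reg_env rs ?v = e" by (simp add: reg_env_upd[OF rs(1)] e_def)
        ultimately show "runs ws cG ?v w (fG (M N)) (?v(b + 3 := ?R ws e (Suc k))) w"
          by (simp add: reg_env_Cons)
        show "runs ws (Until (b + 2) 3 (Dec (b + 2))) (?v(b + 3 := ?R ws e (Suc k))) w (M N * 3 + 1)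
            (?v(b + 2 := 0, b + 3 := ?R ws e (Suc k))) w"
          by (rule runs_clear) (use len rs Rj[of k] k in \<open>auto simp: fun_eq_iff\<close>)
        show "runs ws (Until (b + 3) 3 (Seq (Dec (b + 3)) (Inc (b + 2)))) (?v(b + 2 := 0, b + 3 := ?R ws e (Suc k))) w
            (M N * 4 + 1) (?v(b + 2 := ?R ws e (Suc k))) w"
          by (rule runs_transfer) (use len rs Rj[of "Suc k"] k v(2)[of "b + 3"] in \<open>auto simp: fun_eq_iff\<close>)
        show "runs ws (Inc (b + 1)) (?v(b + 2 := ?R ws e (Suc k))) w 1 (?V (Suc k)) w"
          by (rule runs_cong[OF runs_Inc]) (auto simp: fun_eq_iff)
      qed
      show "runs ws (Until b 3 ?body) (?V 0) w (M N * (t N + 2) + 1) (?V n) w"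
      proof (rule runs_mono)
        show "runs ws (Until b 3 ?body) (?V 0) w (n * (t N + 2) + 1) (?V n) w"
          by (rule runs_Until[where V = "?V" and W = "\<lambda>_. w", OF _ body])
            (use len rs in \<open>auto simp: symbol_counter\<close>)
      qed (use n in \<open>auto intro!: add_mono mult_le_mono\<close>)
      show "runs ws (Until (b + 1) 3 (Dec (b + 1))) (?V n) w (M N * 3 + 1) (v(b + 2 := ?R ws e n)) w"
        by (rule runs_clear) (use len rs n v(2)[of b] v(2)[of "b + 1"] in \<open>auto simp: fun_eq_iff\<close>)
      show "runs ws (Until (b + 2) 3 (Seq (Dec (b + 2)) (Inc b))) (v(b + 2 := ?R ws e n)) w (M N * 4 + 1)
          (v(b := ?F ws (reg_env rs v))) w"
        by (rule runs_transfer)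
          (use len rs Rj[of n] v(2)[of b] v(2)[of "b + 2"] in \<open>auto simp: fun_eq_iff n_def e_def\<close>)
    qed
    moreover have "polybounded ?f" by (intro polybounded_intros cT polybounded_comp[OF cH(1)] M t)
    ultimately show ?thesis by blast
  qed
  ultimately show ?thesis using gB(1) unfolding feasible_def poly_growth_def by blast
qed

subsection \<open>Closure properties\<close>

abbreviation feasible_pred :: "nat \<Rightarrow> (bool list list \<Rightarrow> env \<Rightarrow> bool) \<Rightarrow> bool" where
  "feasible_pred m P \<equiv> feasible m (\<lambda>ws e. of_bool (P ws e))"

lemma poly_growth_add:
  assumes "poly_growth m F" "poly_growth m G"
  shows "poly_growth m (\<lambda>ws e. F ws e + G ws e)"
proof -
  obtain f g where "polybounded f" "growth m F f" "polybounded g" "growth m G g"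
    using assms by (auto simp: poly_growth_def)
  then show ?thesis unfolding poly_growth_def growth_def
    by (intro exI[of _ "\<lambda>N. f N + g N"]) (auto intro!: polybounded_add add_mono)
qed

lemma poly_growth_one: "poly_growth m (\<lambda>ws e. 1)"
  unfolding poly_growth_def growth_def using polybounded_const[of 1] by blast

lemma feasible_rec:
  assumes "feasible m T" "feasible m H" "feasible m (\<lambda>ws e. G ws (e (Suc 0)) (e 0) (\<lambda>i. e (Suc (Suc i))))"
    and "poly_growth m B"
    and "\<And>ws e j. length ws = m \<Longrightarrow> j \<le> T ws e \<Longrightarrow> rec_nat (H ws e) (\<lambda>i r. G ws i r e) j \<le> B ws e"
  shows "feasible m (\<lambda>ws e. rec_nat (H ws e) (\<lambda>i r. G ws i r e) (T ws e))"
  using feasible_rec_push[OF assms(1-4)] assms(5) by simp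

lemma feasible_shift1: "feasible m F \<Longrightarrow> feasible m (\<lambda>ws e. F ws (\<lambda>i. e (Suc i)))"
  using feasible_shift[of m F 1] by simp

lemma feasible_shift2: "feasible m F \<Longrightarrow> feasible m (\<lambda>ws e. F ws (\<lambda>i. e (Suc (Suc i))))"
  using feasible_shift[of m F 2] by simp

lemma feasible_const: "feasible m (\<lambda>ws e. c)"
  by (induction c) (auto intro: feasible_zero feasible_Suc)

text \<open>A truth value is 0 or 1, so recursion over it performs its step at most once.\<close>

lemma feasible_if:
  assumes "feasible_pred m P" "feasible m A" "feasible m B"
  shows "feasible m (\<lambda>ws e. if P ws e then A ws e else B ws e)"
proof -
  have *: "rec_nat y (\<lambda>i r. x) (of_bool p) = (if p then x else y)" for x y :: nat and p
    by simp
  have "feasible m (\<lambda>ws e. rec_nat (B ws e) (\<lambda>i r. A ws e) (of_bool (P ws e)))"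
  proof (rule feasible_rec[OF assms(1,3) feasible_shift2[OF assms(2)]
        poly_growth_add[OF feasible_growth[OF assms(2)] feasible_growth[OF assms(3)]]])
    show "rec_nat (B ws e) (\<lambda>i r. A ws e) j \<le> A ws e + B ws e" for ws e j
      by (cases j) auto
  qed
  then show ?thesis unfolding * .
qed

lemma feasible_add:
  assumes "feasible m A" "feasible m B"
  shows "feasible m (\<lambda>ws e. A ws e + B ws e)"
proof -
  have *: "rec_nat x (\<lambda>i. Suc) y = x + y" for x y
    by (induction y) auto
  have "feasible m (\<lambda>ws e. rec_nat (A ws e) (\<lambda>i r. Suc r) (B ws e))"
    by (rule feasible_rec[OF assms(2,1) _
        poly_growth_add[OF feasible_growth[OF assms(1)] feasible_growth[OF assms(2)]]],
        rule feasible_Suc[OF feasible_var], simp add: *)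
  then show ?thesis unfolding * .
qed

text \<open>The step of the recursion forgets the accumulator and returns the index, so the last
  index remains.\<close>

lemma feasible_minus_one:
  assumes "feasible m A"
  shows "feasible m (\<lambda>ws e. A ws e - 1)"
proof -
  have *: "rec_nat 0 (\<lambda>i r. i) y = y - 1" for y
    by (cases y) auto
  have "feasible m (\<lambda>ws e. rec_nat 0 (\<lambda>i r. i) (A ws e))"
    by (rule feasible_rec[OF assms feasible_zero _ feasible_growth[OF assms]],
        rule feasible_var, simp only: *)
  then show ?thesis unfolding * .
qed

lemma feasible_diff:
  assumes "feasible m A" "feasible m B"
  shows "feasible m (\<lambda>ws e. A ws e - B ws e)"
proof -
  have *: "rec_nat x (\<lambda>i r. r - 1) y = x - y" for x y :: nat
    by (induction y) auto
  have "feasible m (\<lambda>ws e. rec_nat (A ws e) (\<lambda>i r. r - 1) (B ws e))"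
    by (rule feasible_rec[OF assms(2,1) _ feasible_growth[OF assms(1)]],
        rule feasible_minus_one[OF feasible_var], simp only: *)
  then show ?thesis unfolding * .
qed

lemma feasible_sum:
  assumes "feasible m T" "feasible m (\<lambda>ws e. G ws (e 0) (\<lambda>i. e (Suc i)))"
  shows "feasible m (\<lambda>ws e. \<Sum>i<T ws e. G ws i e)"
proof -
  have *: "rec_nat 0 (\<lambda>i r. r + g i) n = sum g {..<n}" for g :: "nat \<Rightarrow> nat" and n
    by (induction n) auto
  obtain f g where f: "polybounded f" "growth m T f" and
    g: "polybounded g" "growth m (\<lambda>ws e. G ws (e 0) (\<lambda>i. e (Suc i))) g"
    using assms[THEN feasible_growth] by (auto simp: poly_growth_def)
  have growth: "poly_growth m (\<lambda>ws e. \<Sum>i<T ws e. G ws i e)"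
    unfolding poly_growth_def
  proof (intro exI conjI)
    \<comment> \<open>There are at most \<open>f N\<close> summands. The summation index is itself
      below \<open>f N\<close>, so the environment of a summand is bounded by
      \<open>N + f N\<close>.\<close>
    show "polybounded (\<lambda>N. f N * g (N + f N))"
      by (intro polybounded_intros polybounded_comp[OF g(1)] f)
    show "growth m (\<lambda>ws e. \<Sum>i<T ws e. G ws i e) (\<lambda>N. f N * g (N + f N))"
      unfolding growth_def
    proof (intro allI impI)
      fix ws and e :: env and N
      assume a: "bounded_inputs m ws N" "\<forall>i. e i \<le> N"
      have T: "T ws e \<le> f N" using growthD[OF f(2) a(1), of e] a(2) by blast
      have "G ws i e \<le> g (N + f N)" if "i < T ws e" for i
      proof -
        have "push i e j \<le> N + f N" for j
          using a(2) that T by (cases j) (auto intro: trans_le_add1)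
        from growthD[OF g(2) bounded_inputs_mono[OF a(1), of "N + f N"], of "push i e"] this
        show ?thesis by simp
      qed
      then have "(\<Sum>i<T ws e. G ws i e) \<le> T ws e * g (N + f N)"
        using sum_bounded_above[of "{..<T ws e}" "\<lambda>i. G ws i e" "g (N + f N)"] by simp
      also have "\<dots> \<le> f N * g (N + f N)" using T by simp
      finally show "(\<Sum>i<T ws e. G ws i e) \<le> f N * g (N + f N)" .
    qed
  qed
  have "feasible m (\<lambda>ws e. rec_nat 0 (\<lambda>i r. r + G ws i e) (T ws e))"
    by (rule feasible_rec[OF assms(1) feasible_zero _ growth],
        rule feasible_add[OF feasible_var feasible_shift1[OF assms(2)]], auto simp: * intro: sum_mono2)
  then show ?thesis unfolding * .
qed

lemma feasible_mult: "feasible m A \<Longrightarrow> feasible m B \<Longrightarrow> feasible m (\<lambda>ws e. A ws e * B ws e)"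
  using feasible_sum[of m A "\<lambda>ws i e. B ws e"] feasible_shift1[of m B] by simp

lemma feasible_power: "feasible m A \<Longrightarrow> feasible m (\<lambda>ws e. A ws e ^ c)"
  by (induction c) (auto intro: feasible_const feasible_mult)

lemma feasible_poly: "feasible m A \<Longrightarrow> feasible m (\<lambda>ws e. poly p (A ws e))"
  by (induction p) (auto intro: feasible_const feasible_mult feasible_add)

lemma feasible_eq_0:
  assumes "feasible m A"
  shows "feasible_pred m (\<lambda>ws e. A ws e = 0)"
proof -
  have *: "rec_nat 1 (\<lambda>i r. 0) x = (of_bool (x = 0) :: nat)" for x :: nat
    by (cases x) auto
  have "feasible m (\<lambda>ws e. rec_nat 1 (\<lambda>i r. 0) (A ws e))"
    by (rule feasible_rec[OF assms feasible_const feasible_const poly_growth_one]) (simp only: *, simp)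
  then show ?thesis unfolding * .
qed

lemma feasible_True: "feasible_pred m (\<lambda>ws e. b)"
  by (rule feasible_const)

lemma feasible_not: "feasible_pred m P \<Longrightarrow> feasible_pred m (\<lambda>ws e. \<not> P ws e)"
  by (drule feasible_eq_0) simp

lemma feasible_le: "feasible m A \<Longrightarrow> feasible m B \<Longrightarrow> feasible_pred m (\<lambda>ws e. A ws e \<le> B ws e)"
  using feasible_eq_0[OF feasible_diff, of m A B] by simp

lemma feasible_less: "feasible m A \<Longrightarrow> feasible m B \<Longrightarrow> feasible_pred m (\<lambda>ws e. A ws e < B ws e)"
  using feasible_not[OF feasible_le, of m B A] by (simp add: not_le)

lemma feasible_conj:
  "feasible_pred m P \<Longrightarrow> feasible_pred m Q \<Longrightarrow> feasible_pred m (\<lambda>ws e. P ws e \<and> Q ws e)"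
  using feasible_mult[of m "\<lambda>ws e. of_bool (P ws e)" "\<lambda>ws e. of_bool (Q ws e)"] by (simp add: of_bool_conj)

lemma feasible_disj:
  "feasible_pred m P \<Longrightarrow> feasible_pred m Q \<Longrightarrow> feasible_pred m (\<lambda>ws e. P ws e \<or> Q ws e)"
  using feasible_not[OF feasible_conj[OF feasible_not feasible_not], of m P Q] by simp

lemma feasible_imp:
  "feasible_pred m P \<Longrightarrow> feasible_pred m Q \<Longrightarrow> feasible_pred m (\<lambda>ws e. P ws e \<longrightarrow> Q ws e)"
  using feasible_disj[OF feasible_not, of m P Q] by (simp only: imp_conv_disj)

lemma feasible_iff:
  "feasible_pred m P \<Longrightarrow> feasible_pred m Q \<Longrightarrow> feasible_pred m (\<lambda>ws e. P ws e \<longleftrightarrow> Q ws e)"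
  using feasible_conj[OF feasible_imp feasible_imp, of m P Q Q P] by (simp add: iff_conv_conj_imp)

lemma feasible_eq: "feasible m A \<Longrightarrow> feasible m B \<Longrightarrow> feasible_pred m (\<lambda>ws e. A ws e = B ws e)"
  using feasible_conj[OF feasible_le feasible_le, of m A B B A] by (simp add: eq_iff)

lemma feasible_ex:
  assumes "feasible m T" "feasible_pred m (\<lambda>ws e. P ws (e 0) (\<lambda>i. e (Suc i)))"
  shows "feasible_pred m (\<lambda>ws e. \<exists>i<T ws e. P ws i e)"
proof -
  have "(\<exists>i<T ws e. P ws i e) \<longleftrightarrow> \<not> (\<Sum>i<T ws e. of_bool (P ws i e)) = (0 :: nat)" for ws e
    by auto
  then show ?thesis
    using feasible_not[OF feasible_eq_0[OF feasible_sum[OF assms]]] by presburger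
qed

lemma feasible_all:
  assumes "feasible m T" "feasible_pred m (\<lambda>ws e. P ws (e 0) (\<lambda>i. e (Suc i)))"
  shows "feasible_pred m (\<lambda>ws e. \<forall>i<T ws e. P ws i e)"
  using feasible_not[OF feasible_ex[OF assms(1) feasible_not[OF assms(2)]]] by simp

text \<open>For a positive divisor the quotient is the number of \<open>q\<close> below
  \<open>x\<close> with \<open>Suc q * y \<le> x\<close>.\<close>

lemma feasible_div:
  assumes "feasible m A" "feasible m B"
  shows "feasible m (\<lambda>ws e. A ws e div B ws e)"
proof -
  have *: "x div y = (if y = 0 then 0 else \<Sum>q<x. of_bool (Suc q * y \<le> x))" for x y :: nat
  proof (cases "y = 0")
    case False
    then have "Suc q * y \<le> x \<longleftrightarrow> q < x div y" for q
      using less_eq_div_iff_mult_less_eq[of y "Suc q" x] by (simp add: Suc_le_eq)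
    then have "{q. q < x \<and> Suc q * y \<le> x} = {..<x div y}"
      using div_le_dividend[of x y] le_trans by (fastforce simp del: div_le_dividend mult_Suc)
    then have "{..<x} \<inter> {q. Suc q * y \<le> x} = {..<x div y}" by auto
    then show ?thesis using False by (simp add: of_bool_def sum.If_cases del: mult_Suc)
  qed simp
  have "feasible m (\<lambda>ws e. if B ws e = 0 then 0 else \<Sum>q<A ws e. of_bool (Suc q * B ws e \<le> A ws e))"
    by (intro feasible_if feasible_eq_0 feasible_sum feasible_le feasible_mult feasible_Suc feasible_var
        feasible_const assms feasible_shift1)
  then show ?thesis using * by presburger
qed

lemma feasible_mod: "feasible m A \<Longrightarrow> feasible m B \<Longrightarrow> feasible m (\<lambda>ws e. A ws e mod B ws e)"
  by (simp only: minus_div_mult_eq_mod[symmetric] feasible_diff feasible_mult feasible_div)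

lemma feasible_odd:
  assumes "feasible m A" shows "feasible_pred m (\<lambda>ws e. odd (A ws e))"
  using feasible_eq[OF feasible_mod[OF assms feasible_const] feasible_const, of 2 1]
  by (simp only: odd_iff_mod_2_eq_one)

text \<open>For a constant \<open>c\<close> this is a fixed nest of conditionals. It hard-wires
  finite tables such as the transition table of a machine.\<close>

lemma feasible_cases:
  assumes "\<And>x. x < c \<Longrightarrow> feasible m (\<lambda>ws e. A x ws e)" "feasible m F" "feasible m D"
  shows "feasible m (\<lambda>ws e. if F ws e < c then A (F ws e) ws e else D ws e)"
  using assms(1)
proof (induction c)
  case 0
  then show ?case using assms(3) by simp
next
  case (Suc c)
  have "(if x < Suc c then A x ws e else d) = (if x = c then A c ws e else if x < c then A x ws e else d)"
    for x ws e d by auto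
  then show ?case
    using feasible_if[OF feasible_eq[OF assms(2) feasible_const] Suc.prems[of c] Suc.IH] Suc.prems by simp
qed

lemmas feasible_intros = feasible_const feasible_True feasible_var feasible_Suc feasible_add feasible_diff feasible_mult
  feasible_power feasible_poly feasible_div feasible_mod feasible_if feasible_sum feasible_length feasible_bit_at
  feasible_not feasible_conj feasible_disj feasible_imp feasible_iff feasible_le feasible_less feasible_eq
  feasible_ex feasible_all feasible_odd

text \<open>The interface to Turing machines: a word is output bit by bit, so it suffices that its
  length and its bit at a given position are feasible. Register \<open>m\<close> counts the
  remaining bits, \<open>m + 1\<close> holds the position and \<open>m + 2\<close> the bit.\<close>

theorem polytime_computable_map:
  assumes L: "feasible m (\<lambda>ws e. L ws)" and P: "feasible_pred m (\<lambda>ws e. P ws (e 0))"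
  shows "polytime_computable m (\<lambda>ws. map (P ws) [0..<L ws])"
proof -
  obtain cL fL where cL: "polybounded fL" "computes m (\<lambda>ws e. L ws) [] m cL fL"
    by (rule feasible_computes[OF L, of "[]" m]) auto
  obtain cP fP where cP: "polybounded fP" "computes m (\<lambda>ws e. of_bool (P ws (e 0))) [m + 1] (m + 2) cP fP"
    by (rule feasible_computes[OF P, of "[m + 1]" "m + 2"]) auto
  obtain g where g: "polybounded g" "growth m (\<lambda>ws e. L ws) g"
    using feasible_growth[OF L] by (auto simp: poly_growth_def)
  define M where "M N = N + g N" for N
  have M: "polybounded M" unfolding M_def by (intro polybounded_intros g)
  let ?body = "Seq (Dec m) (Seq cP (Seq (Cond (m + 2) 3 (Out False) (Seq (Dec (m + 2)) (Out True))) (Inc (m + 1))))"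
  let ?c = "Seq cL (Until m 3 ?body)"
  define t where "t N = 1 + (fP (M N) + (((1 + 1) + 2) + 1))" for N
  let ?f = "\<lambda>N. fL N + (M N * (t N + 2) + 1)"
  have "polybounded ?f" unfolding t_def by (intro polybounded_intros polybounded_comp[OF cP(1)] M cL(1))
  then obtain p :: "nat poly" where p: "\<And>N. ?f N < poly p N" using polybounded_poly by blast
  have "\<exists>t v. t < poly p (sum_list (map length ws)) \<and> run ws ?c (\<lambda>_. 0) [] t v (map (P ws) [0..<L ws])"
    if len: "length ws = m" for ws
  proof -
    define N where "N = sum_list (map length ws)"
    have N: "bounded_inputs m ws N" "bounded_inputs m ws (M N)"
      unfolding bounded_inputs_def N_def M_def using len member_le_sum_list[of _ "map length ws"]
      by (auto intro: trans_le_add1)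
    have Lb: "L ws \<le> M N"
      using growthD[OF g(2) N(1), of "\<lambda>_. 0"] by (simp add: M_def)
    let ?V = "\<lambda>k. (\<lambda>_. 0)(m := L ws - k, m + 1 := k)"
    let ?W = "\<lambda>k. map (P ws) [0..<k]"
    have "ready m m N (\<lambda>_. 0)" by (simp add: ready_def)
    then have "runs ws cL (\<lambda>_. 0) [] (fL N) (?V 0) (?W 0)"
      using cL(2) N(1) by (auto simp: computes_def fun_upd_idem)
    moreover have "runs ws (Until m 3 ?body) (?V 0) (?W 0) (M N * (t N + 2) + 1) (?V (L ws)) (?W (L ws))"
    proof (rule runs_mono)
      show "runs ws (Until m 3 ?body) (?V 0) (?W 0) (L ws * (t N + 2) + 1) (?V (L ws)) (?W (L ws))"
      proof (rule runs_Until[where V = "?V" and W = "?W"])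
        fix k assume k: "k < L ws"
        let ?v = "(\<lambda>_. 0)(m := L ws - Suc k, m + 1 := k)"
        let ?v' = "?v(m + 2 := of_bool (P ws k))"
        have cond: "runs ws (Cond (m + 2) 3 (Out False) (Seq (Dec (m + 2)) (Out True))) ?v' (?W k)
            ((1 + 1) + 2) ?v (?W (Suc k))"
        proof (cases "P ws k")
          case True
          have "runs ws (Seq (Dec (m + 2)) (Out True)) ?v' (?W k) (1 + 1) ?v (?W k @ [True])"
            by (rule runs_Seq[OF runs_cong[OF runs_Dec] runs_Out]) (use True in \<open>auto simp: fun_eq_iff\<close>)
          then show ?thesis using True len by (intro runs_Cond) (auto simp: symbol_counter)
        next
          case False
          then have "runs ws (Out False) ?v' (?W k) (1 + 1) ?v (?W (Suc k))"
            using runs_mono[OF runs_Out[of ws False ?v "?W k"], of "1 + 1"] by (simp add: fun_upd_idem)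
          then show ?thesis using False len by (intro runs_Cond) (auto simp: symbol_counter)
        qed
        have "runs ws (Dec m) (?V k) (?W k) 1 ?v (?W k)"
          by (rule runs_cong[OF runs_Dec]) (use k in \<open>auto simp: fun_eq_iff\<close>)
        moreover have "runs ws cP ?v (?W k) (fP (M N)) ?v' (?W k)"
        proof -
          have "ready m (m + 2) (M N) ?v" using k Lb by (auto simp: ready_def)
          then have "runs ws cP ?v (?W k) (fP (M N)) (?v(m + 2 := of_bool (P ws (reg_env [m + 1] ?v 0)))) (?W k)"
            using cP(2) N(2) unfolding computes_def by blast
          then show ?thesis by (simp add: reg_env_def)
        qed
        moreover note cond
        moreover have "runs ws (Inc (m + 1)) ?v (?W (Suc k)) 1 (?V (Suc k)) (?W (Suc k))"
          by (rule runs_cong[OF runs_Inc]) (auto simp: fun_eq_iff)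
        ultimately show "runs ws ?body (?V k) (?W k) (t N) (?V (Suc k)) (?W (Suc k))"
          unfolding t_def by (intro runs_Seq)
      qed (use len in \<open>auto simp: symbol_counter\<close>)
    qed (use Lb in \<open>auto intro!: add_mono mult_le_mono\<close>)
    ultimately have "runs ws ?c (\<lambda>_. 0) [] (?f N) (?V (L ws)) (?W (L ws))" by (rule runs_Seq)
    then show ?thesis using p[of N] unfolding runs_def N_def by (meson le_less_trans)
  qed
  then show ?thesis by (rule polytime_computableI)
qed

section \<open>Covering problems as strong geodetic sets\<close>

definition walk :: "'a set \<Rightarrow> 'a set set \<Rightarrow> 'a list \<Rightarrow> bool" where
  "walk V E p \<longleftrightarrow> p \<noteq> [] \<and> set p \<subseteq> V \<and> successively (\<lambda>u v. {u, v} \<in> E) p"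

text \<open>The piece between two occurrences of a vertex is cut out until no vertex is
  repeated.\<close>

lemma walk_imp_path:
  assumes "walk V E p"
  shows "\<exists>q. path_between V E (hd p) (last p) q \<and> length q \<le> length p"
  using assms
proof (induction "length p" arbitrary: p rule: less_induct)
  case less
  show ?case
  proof (cases "distinct p")
    case True
    then show ?thesis using less.prems unfolding walk_def path_between_def by blast
  next
    case False
    then obtain xs ys zs y where p: "p = xs @ [y] @ ys @ [y] @ zs"
      using not_distinct_decomp by blast
    let ?q = "xs @ [y] @ zs"
    have w: "walk V E ?q" using less.prems unfolding p walk_def
      by (auto simp: successively_append_iff successively_Cons)
    have hl: "hd ?q = hd p" "last ?q = last p" unfolding p by (auto simp: hd_append)
    have "length ?q < length p" by (simp add: p)
    from less.hyps[OF this w] this show ?thesis unfolding hl by fastforce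
  qed
qed

lemma shortest_path_le_walk:
  assumes "shortest_path_between V E x y p" "walk V E q" "{hd q, last q} = {x, y}"
  shows "length p \<le> length q"
proof -
  obtain r where r: "path_between V E (hd q) (last q) r" "length r \<le> length q"
    using walk_imp_path[OF assms(2)] by blast
  then have "path_between V E x y r" using assms(3) by (simp add: path_between_def)
  then show ?thesis using assms(1) r(2) by (auto simp: shortest_path_between_def)
qed

text \<open>Replacing the segment by \<open>mid'\<close> gives a walk with the same ends. Comparing
  with walks instead of paths makes it harmless if the replacement repeats vertices.\<close>

lemma shortest_path_segment:
  assumes "shortest_path_between V E x y (as @ [a] @ mid @ [b] @ bs)" "walk V E ([a] @ mid' @ [b])"
  shows "length mid \<le> length mid'"
proof -
  have p: "path_between V E x y (as @ [a] @ mid @ [b] @ bs)"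
    using assms(1) by (simp add: shortest_path_between_def)
  have "walk V E (as @ [a] @ mid' @ [b] @ bs)"
    using p assms(2) unfolding path_between_def walk_def
    by (cases mid'; cases mid) (auto simp: successively_append_iff successively_Cons hd_append)
  moreover have "{hd (as @ [a] @ mid' @ [b] @ bs), last (as @ [a] @ mid' @ [b] @ bs)} = {x, y}"
    using p unfolding path_between_def by (auto simp: hd_append)
  ultimately show ?thesis using shortest_path_le_walk[OF assms(1)] by fastforce
qed

lemma shortest_path_sym: "shortest_path_between V E x y p = shortest_path_between V E y x p"
  by (simp add: shortest_path_between_def path_between_def insert_commute)

text \<open>The paths selected in the construction have at most five vertices, so their minimality
  amounts to excluding an edge, a common neighbour or a connection with two inner vertices.\<close>

lemma path_length_cases:
  assumes "path_between V E x y q" "x \<noteq> y"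
  shows "5 \<le> length q \<or> length q = 2 \<and> {x, y} \<in> E \<or> length q = 3 \<and> (\<exists>u. {x, u} \<in> E \<and> {u, y} \<in> E) \<or>
    length q = 4 \<and> (\<exists>u v. {x, u} \<in> E \<and> {u, v} \<in> E \<and> {v, y} \<in> E)"
proof -
  \<comment> \<open>\<open>path_between\<close> leaves the orientation open, so \<open>q\<close> may
    have to be reversed.\<close>
  obtain p where p: "p \<noteq> []" "successively (\<lambda>u v. {u, v} \<in> E) p" "hd p = x" "last p = y" "length p = length q"
  proof (cases "hd q = x")
    case True
    then show ?thesis using assms that[of q] by (auto simp: path_between_def doubleton_eq_iff)
  next
    case False
    then show ?thesis using assms that[of "rev q"]
      by (auto simp: path_between_def doubleton_eq_iff hd_rev last_rev insert_commute)
  qed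
  consider "5 \<le> length p" | a where "p = [a]" | a b where "p = [a, b]" | a b c where "p = [a, b, c]"
    | a b c d where "p = [a, b, c, d]"
    using p(1)
    by (cases p rule: remdups_adj.cases; cases "tl (tl p)" rule: remdups_adj.cases; cases "drop 4 p") auto
  then show ?thesis by cases (use p assms(2) in auto)
qed

lemma shortest_path_3I:
  assumes "path_between V E x y [x, a, y]" "x \<noteq> y" "{x, y} \<notin> E"
  shows "shortest_path_between V E x y [x, a, y]"
  using assms path_length_cases[of V E x y] unfolding shortest_path_between_def by fastforce

lemma shortest_path_4I:
  assumes "path_between V E x y [x, a, b, y]" "x \<noteq> y" "{x, y} \<notin> E"
    and "\<And>u. {x, u} \<in> E \<Longrightarrow> {u, y} \<notin> E"
  shows "shortest_path_between V E x y [x, a, b, y]"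
  using assms path_length_cases[of V E x y] unfolding shortest_path_between_def by fastforce

lemma shortest_path_5I:
  assumes "path_between V E x y [x, a, b, c, y]" "x \<noteq> y" "{x, y} \<notin> E"
    and "\<And>u. {x, u} \<in> E \<Longrightarrow> {u, y} \<notin> E"
    and "\<And>u v. {x, u} \<in> E \<Longrightarrow> {u, v} \<in> E \<Longrightarrow> {v, y} \<notin> E"
  shows "shortest_path_between V E x y [x, a, b, c, y]"
  using assms path_length_cases[of V E x y] unfolding shortest_path_between_def by fastforce

lemma strong_geodetic_set_selectI:
  assumes "S \<subseteq> V" "card V \<noteq> 1"
    and sp: "\<And>x y. x \<in> S \<Longrightarrow> y \<in> S \<Longrightarrow> x \<noteq> y \<Longrightarrow> shortest_path_between V E x y (g {x, y})"
    and cov: "\<And>v. v \<in> V \<Longrightarrow> \<exists>x\<in>S. \<exists>y\<in>S. x \<noteq> y \<and> v \<in> set (g {x, y})"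
  shows "strong_geodetic_set V E S"
proof -
  have "\<Union> {set (g {x, y}) | x y. x \<in> S \<and> y \<in> S \<and> x \<noteq> y} = V"
  proof (intro antisym Union_least subsetI)
    fix X v assume "X \<in> {set (g {x, y}) | x y. x \<in> S \<and> y \<in> S \<and> x \<noteq> y}" "v \<in> X"
    then show "v \<in> V"
      using sp by (auto simp only: mem_Collect_eq shortest_path_between_def path_between_def)
  next
    fix v assume "v \<in> V"
    then show "v \<in> \<Union> {set (g {x, y}) | x y. x \<in> S \<and> y \<in> S \<and> x \<noteq> y}" using cov by blast
  qed
  then show ?thesis unfolding strong_geodetic_set_def using assms(1,2) sp
    by (simp, intro exI[of _ g]) simp
qed

text \<open>\<open>d v\<close> is the pair of elements of \<open>S\<close> whose path is responsible for covering \<open>v\<close>.\<close>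

lemma strong_geodetic_setI:
  assumes "S \<subseteq> V" "card V \<noteq> 1"
    and "\<And>x y. x \<in> S \<Longrightarrow> y \<in> S \<Longrightarrow> x \<noteq> y \<Longrightarrow>
      \<exists>p. shortest_path_between V E x y p \<and> (\<forall>v\<in>V. d v = {x, y} \<longrightarrow> v \<in> set p)"
    and "\<And>v. v \<in> V \<Longrightarrow> \<exists>x\<in>S. \<exists>y\<in>S. x \<noteq> y \<and> d v = {x, y}"
  shows "strong_geodetic_set V E S"
proof -
  \<comment> \<open>The selection depends on the unordered pair only. The choice is therefore made
    for sets \<open>e\<close>, with a condition that speaks of both orders.\<close>
  define ok where "ok e p \<longleftrightarrow> (\<forall>x y. x \<in> S \<longrightarrow> y \<in> S \<longrightarrow> x \<noteq> y \<longrightarrow> e = {x, y} \<longrightarrow>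
    shortest_path_between V E x y p \<and> (\<forall>v\<in>V. d v = {x, y} \<longrightarrow> v \<in> set p))" for e p
  have "\<exists>p. ok e p" for e
  proof (cases "\<exists>x y. x \<in> S \<and> y \<in> S \<and> x \<noteq> y \<and> e = {x, y}")
    case True
    then obtain x y where xy: "x \<in> S" "y \<in> S" "x \<noteq> y" "e = {x, y}" by blast
    from assms(3)[OF xy(1-3)] obtain p where
      p: "shortest_path_between V E x y p" "\<forall>v\<in>V. d v = {x, y} \<longrightarrow> v \<in> set p" by blast
    have "ok e p" unfolding ok_def
    proof (intro allI impI)
      fix x' y' assume "e = {x', y'}"
      then have "x' = x \<and> y' = y \<or> x' = y \<and> y' = x" unfolding xy(4) by (auto simp: doubleton_eq_iff)
      then show "shortest_path_between V E x' y' p \<and> (\<forall>v\<in>V. d v = {x', y'} \<longrightarrow> v \<in> set p)"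
        using p shortest_path_sym[of V E x y p] by (auto simp: insert_commute)
    qed
    then show ?thesis ..
  qed (auto simp: ok_def)
  then obtain g where g: "\<And>e. ok e (g e)" by metis
  have sp: "shortest_path_between V E x y (g {x, y})" "\<forall>v\<in>V. d v = {x, y} \<longrightarrow> v \<in> set (g {x, y})"
    if "x \<in> S" "y \<in> S" "x \<noteq> y" for x y
    using g[of "{x, y}"] that unfolding ok_def by blast+
  show ?thesis
  proof (rule strong_geodetic_set_selectI[OF assms(1,2) sp(1)])
    fix v assume v: "v \<in> V"
    then obtain x y where xy: "x \<in> S" "y \<in> S" "x \<noteq> y" "d v = {x, y}" using assms(4) by blast
    then have "v \<in> set (g {x, y})" using sp(2)[OF xy(1-3)] v by blast
    then show "\<exists>x\<in>S. \<exists>y\<in>S. x \<noteq> y \<and> v \<in> set (g {x, y})" using xy by blast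
  qed
qed

lemma bipartiteI:
  assumes "A \<subseteq> V"
    and "\<And>e. e \<in> E \<Longrightarrow> \<exists>u v. e = {u, v} \<and> u \<in> V \<and> v \<in> V \<and> (u \<in> A \<longleftrightarrow> v \<notin> A)"
  shows "bipartite V E"
  unfolding bipartite_def
proof (rule exI[of _ A], rule exI[of _ "V - A"], intro conjI ballI)
  fix e assume "e \<in> E"
  then obtain u v where e: "e = {u, v}" "u \<in> V" "v \<in> V" "u \<in> A \<longleftrightarrow> v \<notin> A" using assms(2) by blast
  show "\<exists>a\<in>A. \<exists>b\<in>V - A. e = {a, b}"
  proof (cases "u \<in> A")
    case True
    then show ?thesis using e by blast
  next
    case False
    then show ?thesis using e by (subst e(1), subst insert_commute) blast
  qed
qed (use assms(1) in auto)

section \<open>The bipartite graph of a covering problem\<close>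

datatype kind = Literal | Clause | PendH | PendG | PendG' | HubH | HubG | HubG'

definition kind_edge :: "kind \<Rightarrow> kind \<Rightarrow> bool" where
  "kind_edge k k' \<longleftrightarrow> k = Literal \<and> (k' = HubG \<or> k' = HubG') \<or> k = Clause \<and> k' = HubH \<or>
    k = PendH \<and> k' = HubH \<or> k = PendG \<and> k' = HubG \<or> k = PendG' \<and> k' = HubG' \<or>
    k = HubH \<and> (k' = HubG \<or> k' = HubG')"

definition arc :: "('a \<Rightarrow> kind) \<Rightarrow> ('a \<Rightarrow> 'a \<Rightarrow> bool) \<Rightarrow> 'a \<Rightarrow> 'a \<Rightarrow> bool" where
  "arc kind N u v \<longleftrightarrow> kind_edge (kind u) (kind v) \<or> kind u = Literal \<and> kind v = Clause \<and> N u v"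

text \<open>Literals are joined to the clauses that they satisfy. The hub \<open>h\<close> of the clauses gives a chosen literal
  one path to each pendant of \<open>h\<close>, through an arbitrary clause of that literal. The hubs \<open>g\<close> and \<open>g'\<close>
  serve to cover the literals; being joined to \<open>h\<close>, they keep the shortest paths
  between pendants away from the clauses.\<close>

locale cover_graph =
  fixes V :: "'a set" and kind :: "'a \<Rightarrow> kind" and N :: "'a \<Rightarrow> 'a \<Rightarrow> bool" and E :: "'a set set" and h g g' :: 'a
  assumes fin: "finite V"
    and E: "\<And>u v. {u, v} \<in> E \<longleftrightarrow> u \<in> V \<and> v \<in> V \<and> (arc kind N u v \<or> arc kind N v u)"
    and edges: "\<And>e. e \<in> E \<Longrightarrow> \<exists>u v. e = {u, v}"
    and hubs: "h \<in> V" "g \<in> V" "g' \<in> V"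
    and kind_hub: "\<And>v. v \<in> V \<Longrightarrow> kind v = HubH \<longleftrightarrow> v = h" "\<And>v. v \<in> V \<Longrightarrow> kind v = HubG \<longleftrightarrow> v = g"
      "\<And>v. v \<in> V \<Longrightarrow> kind v = HubG' \<longleftrightarrow> v = g'"
begin

definition "of_kind k = {v \<in> V. kind v = k}"

definition "pendants = of_kind PendH \<union> of_kind PendG \<union> of_kind PendG'"

lemma kind_hubs: "kind h = HubH" "kind g = HubG" "kind g' = HubG'"
  using kind_hub hubs by auto

lemma card_V: "card V \<noteq> 1"
proof -
  have "card {h, g} \<le> card V" using hubs fin by (intro card_mono) auto
  moreover have "h \<noteq> g" using kind_hubs by auto
  ultimately show ?thesis by auto
qed

lemma bipartite_E: "bipartite V E"
proof (rule bipartiteI)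
  \<comment> \<open>The other side consists of the clauses, \<open>g\<close>, \<open>g'\<close> and
    the pendants of \<open>h\<close>.\<close>
  let ?A = "{v \<in> V. kind v \<in> {Literal, HubH, PendG, PendG'}}"
  show "?A \<subseteq> V" by auto
  fix e assume "e \<in> E"
  then obtain u v where uv: "e = {u, v}" "u \<in> V" "v \<in> V" "arc kind N u v \<or> arc kind N v u"
    using edges E by metis
  then have "u \<in> ?A \<longleftrightarrow> v \<notin> ?A" by (cases "kind u"; cases "kind v") (auto simp: arc_def kind_edge_def)
  then show "\<exists>u v. e = {u, v} \<and> u \<in> V \<and> v \<in> V \<and> (u \<in> ?A \<longleftrightarrow> v \<notin> ?A)" using uv by blast
qed

lemma simple_graph_E: "simple_graph V E"
proof -
  obtain A B where AB: "A \<union> B = V" "A \<inter> B = {}" "\<forall>e\<in>E. \<exists>a\<in>A. \<exists>b\<in>B. e = {a, b}"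
    using bipartite_E unfolding bipartite_def by blast
  have "e \<subseteq> V \<and> card e = 2" if "e \<in> E" for e
  proof -
    obtain a b where "a \<in> A" "b \<in> B" "e = {a, b}" using AB(3) \<open>e \<in> E\<close> by blast
    then show ?thesis using AB(1,2) card_2_iff[of e] by blast
  qed
  then show ?thesis using fin by (simp add: simple_graph_def)
qed

lemma edge_PendH: "kind v = PendH \<Longrightarrow> {u, v} \<in> E \<longleftrightarrow> u = h \<and> v \<in> V"
  and edge_PendG: "kind v = PendG \<Longrightarrow> {u, v} \<in> E \<longleftrightarrow> u = g \<and> v \<in> V"
  and edge_PendG': "kind v = PendG' \<Longrightarrow> {u, v} \<in> E \<longleftrightarrow> u = g' \<and> v \<in> V"
  using kind_hub[of u] hubs by (auto simp: E arc_def kind_edge_def)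

text \<open>Each vertex relies on one pair: a clause \<open>c\<close> on the path
  \<open>t c\<close>, \<open>c\<close>, \<open>h\<close>, \<open>\<psi> c\<close> and a literal
  \<open>l\<close> on the path \<open>\<phi> l\<close>, \<open>g\<close>, \<open>l\<close>,
  \<open>g'\<close>, \<open>q0'\<close>. As \<open>\<psi>\<close> and \<open>\<phi>\<close> are
  injective, no pair is responsible for two clauses or for two literals. Hubs and pendants lie on
  paths between a pendant of \<open>h\<close> and one of \<open>g\<close> or
  \<open>g'\<close>.\<close>

lemma cover_imp_strong_geodetic:
  assumes T: "T \<subseteq> of_kind Literal"
    and cov: "\<And>c. c \<in> of_kind Clause \<Longrightarrow> \<exists>t\<in>T. N t c"
    and \<phi>: "inj_on \<phi> (of_kind Literal)" "\<phi> ` of_kind Literal \<subseteq> of_kind PendG"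
    and \<psi>: "inj_on \<psi> (of_kind Clause)" "\<psi> ` of_kind Clause \<subseteq> of_kind PendH"
    and ne: "p0 \<in> of_kind PendH" "q0 \<in> of_kind PendG" "q0' \<in> of_kind PendG'"
  shows "strong_geodetic_set V E (T \<union> pendants)"
proof -
  obtain t where t: "\<And>c. c \<in> of_kind Clause \<Longrightarrow> t c \<in> T \<and> N (t c) c" using cov by metis
  define a where "a v = (case kind v of Literal \<Rightarrow> \<phi> v | Clause \<Rightarrow> t v | PendH \<Rightarrow> v | _ \<Rightarrow> p0)" for v
  define b where "b v = (case kind v of
    Literal \<Rightarrow> q0' | Clause \<Rightarrow> \<psi> v | PendG \<Rightarrow> v | PendG' \<Rightarrow> v | HubG' \<Rightarrow> q0' | _ \<Rightarrow> q0)" for v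
  define d where "d v = {a v, b v}" for v
  have kinds: "kind p0 = PendH" "kind q0 = PendG" "kind q0' = PendG'"
    "v \<in> V \<Longrightarrow> kind v = Literal \<Longrightarrow> kind (\<phi> v) = PendG \<and> \<phi> v \<in> V"
    "v \<in> V \<Longrightarrow> kind v = Clause \<Longrightarrow> kind (\<psi> v) = PendH \<and> \<psi> v \<in> V \<and> kind (t v) = Literal \<and> t v \<in> T \<and> N (t v) v" for v
    using ne \<phi>(2) \<psi>(2) subsetD[OF T] t by (auto simp: of_kind_def)
  have ab: "(kind v, kind (a v), kind (b v)) \<in> {(Literal, PendG, PendG'), (Clause, Literal, PendH),
      (HubH, PendH, PendG), (HubG, PendH, PendG), (HubG', PendH, PendG'), (PendH, PendH, PendG),
      (PendG, PendH, PendG), (PendG', PendH, PendG')}"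
    "a v \<in> T \<union> pendants" "b v \<in> T \<union> pendants" if "v \<in> V" for v
    using that ne kinds(1-3) kinds(4,5)[of v]
    by (cases "kind v"; auto simp: a_def b_def pendants_def of_kind_def)+
  show ?thesis
  proof (rule strong_geodetic_setI[where d = d])
    show "T \<union> pendants \<subseteq> V" using T by (auto simp: pendants_def of_kind_def)
    show "card V \<noteq> 1" by (rule card_V)
  next
    fix v assume "v \<in> V"
    then show "\<exists>x\<in>T \<union> pendants. \<exists>y\<in>T \<union> pendants. x \<noteq> y \<and> d v = {x, y}"
    proof (intro bexI conjI)
      show "a v \<noteq> b v" using ab(1)[OF \<open>v \<in> V\<close>] by auto
    qed (use ab \<open>v \<in> V\<close> in \<open>simp_all add: d_def\<close>)
  next
    let ?P = "\<lambda>x y. \<exists>p. shortest_path_between V E x y p \<and> (\<forall>v\<in>V. d v = {x, y} \<longrightarrow> v \<in> set p)"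
    have sym: "?P x y \<Longrightarrow> ?P y x" for x y
      by (metis insert_commute shortest_path_sym)
    fix x y assume "x \<in> T \<union> pendants" "y \<in> T \<union> pendants" and neq: "x \<noteq> y"
    then have xy: "x \<in> V" "y \<in> V" "kind x \<in> {Literal, PendH, PendG, PendG'}"
      "kind y \<in> {Literal, PendH, PendG, PendG'}"
      using T by (auto simp: pendants_def of_kind_def)
    note edge = E arc_def kind_hubs hubs kind_edge_def
    \<comment> \<open>These are the combinations of kinds up to exchanging \<open>x\<close> and
      \<open>y\<close>; the exchange is supplied by \<open>sym\<close>.\<close>
    have main: "?P x y" if xy: "x \<in> V" "y \<in> V" "x \<noteq> y" and
      k: "(kind x, kind y) \<in> {(Literal, Literal), (Literal, PendH), (Literal, PendG), (Literal, PendG'),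
        (PendH, PendH), (PendH, PendG), (PendH, PendG'), (PendG, PendG), (PendG, PendG'), (PendG', PendG')}" for x y
    proof -
      have P3: "?P x y" if "a \<in> V" "{x, a} \<in> E" "{a, y} \<in> E" "{x, y} \<notin> E" "x \<noteq> a" "y \<noteq> a"
        "\<And>v. v \<in> V \<Longrightarrow> d v = {x, y} \<Longrightarrow> v \<in> {x, a, y}" for a
        using that xy by (intro exI[of _ "[x, a, y]"] conjI shortest_path_3I) (auto simp: path_between_def)
      have P4: "?P x y" if "a \<in> V" "b \<in> V" "{x, a} \<in> E" "{a, b} \<in> E" "{b, y} \<in> E" "{x, y} \<notin> E"
        "distinct [x, a, b, y]" "\<And>u. {x, u} \<in> E \<Longrightarrow> {u, y} \<notin> E"
        "\<And>v. v \<in> V \<Longrightarrow> d v = {x, y} \<Longrightarrow> v \<in> {x, a, b, y}" for a b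
        using that xy by (intro exI[of _ "[x, a, b, y]"] conjI shortest_path_4I) (auto simp: path_between_def)
      have P5: "?P x y" if "a \<in> V" "b \<in> V" "c \<in> V" "{x, a} \<in> E" "{a, b} \<in> E" "{b, c} \<in> E" "{c, y} \<in> E"
        "{x, y} \<notin> E" "distinct [x, a, b, c, y]" "\<And>u. {x, u} \<in> E \<Longrightarrow> {u, y} \<notin> E"
        "\<And>u v. {x, u} \<in> E \<Longrightarrow> {u, v} \<in> E \<Longrightarrow> {v, y} \<notin> E"
        "\<And>v. v \<in> V \<Longrightarrow> d v = {x, y} \<Longrightarrow> v \<in> {x, a, b, c, y}" for a b c
        using that xy by (intro exI[of _ "[x, a, b, c, y]"] conjI shortest_path_5I) (auto simp: path_between_def)
      \<comment> \<open>Which vertices rely on the pair of \<open>x\<close> and \<open>y\<close>.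
        Only in two of the ten cases does the path have to be chosen accordingly.\<close>
      have dv: "(kind x = Literal \<longrightarrow> kind y = PendH \<longrightarrow> kind v = Clause \<and> t v = x \<and> \<psi> v = y) \<and>
        (kind x = PendG \<longrightarrow> kind y = PendG' \<longrightarrow> kind v = Literal \<and> \<phi> v = x) \<and>
        (kind x = PendH \<longrightarrow> kind y = PendG \<longrightarrow> v \<in> {x, y, h, g}) \<and>
        (kind x = PendH \<longrightarrow> kind y = PendG' \<longrightarrow> v \<in> {x, y, h, g'}) \<and>
        kind x \<noteq> kind y \<and> (kind x = Literal \<longrightarrow> kind y \<noteq> PendG \<and> kind y \<noteq> PendG')"
        if v: "v \<in> V" "d v = {x, y}" for v
      proof -
        have "x = a v \<and> y = b v \<or> x = b v \<and> y = a v" using v(2) by (auto simp: d_def doubleton_eq_iff)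
        then show ?thesis using ab(1)[OF v(1)] kind_hub[OF v(1)]
          by (elim disjE conjE) (cases "kind v"; simp add: a_def b_def)+
      qed
      consider "kind x = Literal" "kind y = Literal" | "kind x = Literal" "kind y = PendH"
        | "kind x = Literal" "kind y = PendG" | "kind x = Literal" "kind y = PendG'"
        | "kind x = PendH" "kind y = PendH" | "kind x = PendH" "kind y = PendG"
        | "kind x = PendH" "kind y = PendG'" | "kind x = PendG" "kind y = PendG"
        | "kind x = PendG" "kind y = PendG'" | "kind x = PendG'" "kind y = PendG'"
        using k by auto
      moreover have neqs: "x \<noteq> h" "x \<noteq> g" "x \<noteq> g'" "y \<noteq> h" "y \<noteq> g" "y \<noteq> g'" "g \<noteq> h" "g' \<noteq> h" "g \<noteq> g'"
        using k kind_hubs by auto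
      ultimately show ?thesis
      proof cases
        case 1
        then show ?thesis by (intro P3[of g]) (use xy dv in \<open>auto simp: edge\<close>)
      next
        case 2
        \<comment> \<open>A literal has distance 3 from a pendant of \<open>h\<close>, and the
          vertex between it and \<open>h\<close> may be any adjacent clause or the hub
          \<open>g\<close>. A clause is used if it relies on this pair.\<close>
        show ?thesis
        proof (cases "\<exists>c\<in>V. d c = {x, y}")
          case True
          then obtain c where c: "c \<in> V" "d c = {x, y}" by blast
          have c': "kind c = Clause" "t c = x" "\<psi> c = y" using dv[OF c] 2 by auto
          have "v = c" if "v \<in> V" "d v = {x, y}" for v
            using dv[OF that] 2 c' c(1) that(1) \<psi>(1) by (auto simp: of_kind_def inj_on_def)
          then have vs: "\<And>v. v \<in> V \<Longrightarrow> d v = {x, y} \<Longrightarrow> v \<in> {x, c, h, y}" by blast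
          have "N x c" using kinds(5)[of c] c c' by simp
          moreover have "c \<noteq> h" using c' kind_hubs by auto
          ultimately show ?thesis using c(1) c' 2 xy neqs
            by (intro P4[of c h, OF _ _ _ _ _ _ _ _ vs]) (auto simp: edge)
        next
          case False
          then have vs: "\<And>v. v \<in> V \<Longrightarrow> d v = {x, y} \<Longrightarrow> v \<in> {x, g, h, y}" by blast
          show ?thesis using 2 xy neqs
            by (intro P4[of g h, OF _ _ _ _ _ _ _ _ vs]) (auto simp: edge)
        qed
      next
        case 3
        then show ?thesis by (intro P3[of g]) (use xy dv in \<open>auto simp: edge\<close>)
      next
        case 4
        then show ?thesis by (intro P3[of g']) (use xy dv in \<open>auto simp: edge\<close>)
      next
        case 5
        then show ?thesis by (intro P3[of h]) (use xy dv in \<open>auto simp: edge\<close>)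
      next
        case 6
        have vs: "\<And>v. v \<in> V \<Longrightarrow> d v = {x, y} \<Longrightarrow> v \<in> {x, h, g, y}" using dv 6 by blast
        show ?thesis using 6 xy neqs
          by (intro P4[of h g, OF _ _ _ _ _ _ _ _ vs]) (auto simp: edge)
      next
        case 7
        have vs: "\<And>v. v \<in> V \<Longrightarrow> d v = {x, y} \<Longrightarrow> v \<in> {x, h, g', y}" using dv 7 by blast
        show ?thesis using 7 xy neqs
          by (intro P4[of h g', OF _ _ _ _ _ _ _ _ vs]) (auto simp: edge)
      next
        case 8
        then show ?thesis by (intro P3[of g]) (use xy dv in \<open>auto simp: edge\<close>)
      next
        case 9
        have e: "{x, u} \<in> E \<longleftrightarrow> u = g" "{u, y} \<in> E \<longleftrightarrow> u = g'" for u
          using edge_PendG[OF 9(1), of u] edge_PendG'[OF 9(2), of u] xy by (auto simp: insert_commute)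
        \<comment> \<open>The vertex between \<open>g\<close> and \<open>g'\<close> may be any
          literal, and is \<open>h\<close> if no literal relies on this pair.\<close>
        show ?thesis
        proof (cases "\<exists>l\<in>V. d l = {x, y}")
          case True
          then obtain l where l: "l \<in> V" "d l = {x, y}" by blast
          have l': "kind l = Literal" "\<phi> l = x" using dv[OF l] 9 by auto
          have "v = l" if "v \<in> V" "d v = {x, y}" for v
            using dv[OF that] 9 l' l(1) that(1) \<phi>(1) by (auto simp: of_kind_def inj_on_def)
          then have vs: "\<And>v. v \<in> V \<Longrightarrow> d v = {x, y} \<Longrightarrow> v \<in> {x, g, l, g', y}" by blast
          have "x \<noteq> l" "l \<noteq> g" "l \<noteq> g'" "l \<noteq> y" using l' 9 kind_hubs by auto
          then show ?thesis using l(1) l' 9 xy neqs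
            by (intro P5[of g l g', OF _ _ _ _ _ _ _ _ _ _ _ vs]) (simp_all add: e, auto simp: edge)
        next
          case False
          then have vs: "\<And>v. v \<in> V \<Longrightarrow> d v = {x, y} \<Longrightarrow> v \<in> {x, g, h, g', y}" by blast
          show ?thesis using 9 xy neqs
            by (intro P5[of g h g', OF _ _ _ _ _ _ _ _ _ _ _ vs]) (simp_all add: e, auto simp: edge)
        qed
      next
        case 10
        then show ?thesis by (intro P3[of g']) (use xy dv in \<open>auto simp: edge\<close>)
      qed
    qed
    show "?P x y"
      using main[OF xy(1,2) neq] sym[OF main[OF xy(2,1) neq[symmetric]]] xy(3,4)
      by auto
  qed
qed

text \<open>A pendant has a single neighbour, so it cannot be an inner vertex of a path; being
  covered, it is an end.\<close>

lemma pendant_in_set: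
  assumes S: "S \<subseteq> V" "\<And>v. v \<in> V \<Longrightarrow> \<exists>x\<in>S. \<exists>y\<in>S. \<exists>p. shortest_path_between V E x y p \<and> v \<in> set p"
    and v: "v \<in> pendants"
  shows "v \<in> S"
proof -
  have "v \<in> V" using v by (auto simp: pendants_def of_kind_def)
  then obtain x y p where p: "x \<in> S" "y \<in> S" "path_between V E x y p" "v \<in> set p"
    using S(2)[of v] unfolding shortest_path_between_def by blast
  obtain w where w: "\<And>u. {u, v} \<in> E \<Longrightarrow> u = w"
    using v edge_PendH edge_PendG edge_PendG' by (auto simp: pendants_def of_kind_def)
  obtain as bs where ab: "p = as @ v # bs" using p(4) by (meson split_list)
  have "as = [] \<or> bs = []"
  proof (rule ccontr)
    assume "\<not> (as = [] \<or> bs = [])"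
    then have "{last as, v} \<in> E" "{hd bs, v} \<in> E" "last as \<in> set as" "hd bs \<in> set bs"
      using p(3) unfolding ab path_between_def
      by (auto simp: successively_append_iff successively_Cons insert_commute)
    moreover have "set as \<inter> set bs = {}" using p(3) unfolding ab path_between_def by auto
    ultimately show False using w by (metis disjoint_iff)
  qed
  then have "v \<in> {hd p, last p}" unfolding ab by auto
  also have "\<dots> = {x, y}" using p(3) by (simp add: path_between_def)
  finally show ?thesis using p(1,2) by auto
qed

text \<open>At most one of the two neighbours of \<open>c\<close> on its path is \<open>h\<close>,
  so a literal satisfying \<open>c\<close> is next to it. If no such literal were an end of the
  path, each would be followed by another of its neighbours, which is adjacent to \<open>h\<close>;
  a shortcut through \<open>h\<close> that avoids \<open>c\<close> then contradicts
  minimality.\<close>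

lemma clause_covered:
  assumes S: "S \<subseteq> V" "\<And>v. v \<in> V \<Longrightarrow> \<exists>x\<in>S. \<exists>y\<in>S. \<exists>p. shortest_path_between V E x y p \<and> v \<in> set p"
    and c: "c \<in> of_kind Clause" "c \<notin> S"
  shows "\<exists>t\<in>S \<inter> of_kind Literal. N t c"
proof -
  have cV: "c \<in> V" "kind c = Clause" using c by (auto simp: of_kind_def)
  then obtain x y p where xy: "x \<in> S" "y \<in> S" and sp: "shortest_path_between V E x y p" and cp: "c \<in> set p"
    using S(2) by blast
  then have p: "path_between V E x y p" by (simp add: shortest_path_between_def)
  then have ends: "hd p \<in> S" "last p \<in> S" using xy by (auto simp: path_between_def doubleton_eq_iff)
  obtain as bs where ab: "p = as @ c # bs" using cp by (meson split_list)
  then have "as \<noteq> []" "bs \<noteq> []" using ends c(2) by auto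
  then obtain as' u w bs' where "as = as' @ [u]" "bs = w # bs'"
    by (metis neq_Nil_conv rev_exhaust)
  then have pe: "p = as' @ u # c # w # bs'" using ab by simp
  then have uw: "{u, c} \<in> E" "{c, w} \<in> E" "u \<noteq> w" and V: "set p \<subseteq> V"
    using p by (auto simp: path_between_def successively_append_iff successively_Cons)
  have nbr: "u = h \<or> kind u = Literal \<and> N u c" if "{u, c} \<in> E" for u
    using that cV unfolding E arc_def kind_edge_def by (auto simp: kind_hub)
  \<comment> \<open>The neighbours of a literal are clauses, \<open>g\<close> and \<open>g'\<close>.
    The edges from \<open>h\<close> to \<open>g\<close> and \<open>g'\<close> are what makes this
    hold for all of them.\<close>
  have nb2: "{b, h} \<in> E" if "{a, b} \<in> E" "kind a = Literal" for a b
    using that unfolding E arc_def kind_edge_def by (auto simp: kind_hubs hubs)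
  have u: "u = h \<or> kind u = Literal \<and> N u c" and w: "w = h \<or> kind w = Literal \<and> N w c"
    using nbr uw by (auto simp: insert_commute)
  show ?thesis
  proof (rule ccontr)
    assume no: "\<not> ?thesis"
    have as': "as' \<noteq> []" if "u \<noteq> h"
      using that u no ends(1) V unfolding pe by (auto simp: of_kind_def)
    have bs': "bs' \<noteq> []" if "w \<noteq> h"
      using that w no ends(2) V unfolding pe by (auto simp: of_kind_def)
    have a: "\<exists>as'' a. as' = as'' @ [a] \<and> {a, u} \<in> E \<and> {a, h} \<in> E \<and> a \<in> V" if "u \<noteq> h"
    proof -
      obtain as'' a where as'': "as' = as'' @ [a]" using as'[OF \<open>u \<noteq> h\<close>] by (metis rev_exhaust)
      then have "{a, u} \<in> E" using p unfolding pe path_between_def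
        by (auto simp: successively_append_iff successively_Cons)
      then show ?thesis using nb2[of u a] u that V as'' unfolding pe by (auto simp: insert_commute)
    qed
    have b: "\<exists>b bs''. bs' = b # bs'' \<and> {w, b} \<in> E \<and> {b, h} \<in> E \<and> b \<in> V" if "w \<noteq> h"
    proof -
      obtain b bs'' where bs'': "bs' = b # bs''" using bs'[OF \<open>w \<noteq> h\<close>] by (metis neq_Nil_conv)
      then have "{w, b} \<in> E" using p unfolding pe path_between_def
        by (auto simp: successively_append_iff successively_Cons)
      then show ?thesis using nb2[of w b] w that V bs'' unfolding pe by auto
    qed
    consider "u = h" "w \<noteq> h" | "u \<noteq> h" "w = h" | "u \<noteq> h" "w \<noteq> h" using uw(3) by blast
    then show False
    proof cases
      case 1
      then obtain b bs'' where b: "bs' = b # bs''" "{b, h} \<in> E" "b \<in> V" using b by blast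
      have "shortest_path_between V E x y (as' @ [h] @ [c, w] @ [b] @ bs'')"
        using sp unfolding pe b 1 by simp
      then show False using shortest_path_segment[of V E x y as' h "[c, w]" b bs'' "[]"] b hubs
        by (auto simp: walk_def insert_commute)
    next
      case 2
      then obtain a as'' where a: "as' = as'' @ [a]" "{a, h} \<in> E" "a \<in> V" using a by blast
      have "shortest_path_between V E x y (as'' @ [a] @ [u, c] @ [h] @ bs')"
        using sp unfolding pe a 2 by simp
      then show False using shortest_path_segment[of V E x y as'' a "[u, c]" h bs' "[]"] a hubs
        by (auto simp: walk_def insert_commute)
    next
      case 3
      then obtain a as'' b bs'' where a: "as' = as'' @ [a]" "{a, h} \<in> E" "a \<in> V"
        and b: "bs' = b # bs''" "{b, h} \<in> E" "b \<in> V" using a b by blast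
      have "shortest_path_between V E x y (as'' @ [a] @ [u, c, w] @ [b] @ bs'')"
        using sp unfolding pe a b by simp
      then show False using shortest_path_segment[of V E x y as'' a "[u, c, w]" b bs'' "[h]"] a b hubs
        by (auto simp: walk_def insert_commute)
    qed
  qed
qed

text \<open>All pendants are in \<open>S\<close>, so at most \<open>K\<close> other vertices are.
  Chosen clause vertices are exchanged for literals satisfying them, and hubs for the arbitrary
  literal \<open>l0\<close>, which does not increase the number.\<close>

lemma strong_geodetic_imp_cover:
  assumes sgs: "strong_geodetic_set V E S" and K: "card S \<le> K + card pendants"
    and nbr: "\<And>c. c \<in> of_kind Clause \<Longrightarrow> \<exists>l\<in>of_kind Literal. N l c"
    and ne: "l0 \<in> of_kind Literal"
  shows "\<exists>T \<subseteq> of_kind Literal. card T \<le> K \<and> (\<forall>c\<in>of_kind Clause. \<exists>t\<in>T. N t c)"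
proof -
  obtain f where S: "S \<subseteq> V" and f: "\<forall>x\<in>S. \<forall>y\<in>S. x \<noteq> y \<longrightarrow> shortest_path_between V E x y (f {x, y})"
    "\<Union> {set (f {x, y}) | x y. x \<in> S \<and> y \<in> S \<and> x \<noteq> y} = V"
    using sgs card_V unfolding strong_geodetic_set_def by auto
  have cov: "\<exists>x\<in>S. \<exists>y\<in>S. \<exists>p. shortest_path_between V E x y p \<and> v \<in> set p" if "v \<in> V" for v
  proof -
    have "v \<in> \<Union> {set (f {x, y}) | x y. x \<in> S \<and> y \<in> S \<and> x \<noteq> y}" using that f(2) by simp
    then obtain x y where "x \<in> S" "y \<in> S" "x \<noteq> y" "v \<in> set (f {x, y})" by blast
    then show ?thesis using f(1) by blast
  qed
  have pend: "pendants \<subseteq> S" using pendant_in_set[OF S cov] by blast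
  have finS: "finite S" using S fin finite_subset by blast
  define T where "T = S - pendants"
  have cT: "card T \<le> K" using K pend finS unfolding T_def
    by (simp add: card_Diff_subset finite_subset)
  obtain n where n: "\<And>c. c \<in> of_kind Clause \<Longrightarrow> n c \<in> of_kind Literal \<and> N (n c) c" using nbr by metis
  define r where "r v = (if v \<in> of_kind Literal then v else if v \<in> of_kind Clause then n v else l0)" for v
  have 1: "r ` T \<subseteq> of_kind Literal" using n ne by (auto simp: r_def)
  have 2: "card (r ` T) \<le> K" using card_image_le[of T r] cT finS by (simp add: T_def)
  have 3: "\<exists>t\<in>r ` T. N t c" if c: "c \<in> of_kind Clause" for c
  proof (cases "c \<in> S")
    case True
    then have "c \<in> T" using c by (auto simp: T_def pendants_def of_kind_def)
    have "r c = n c" using c by (auto simp: r_def of_kind_def)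
    with \<open>c \<in> T\<close> have "n c \<in> r ` T" by force
    then show ?thesis using n[OF c] by blast
  next
    case False
    obtain t where t: "t \<in> S" "t \<in> of_kind Literal" "N t c" using clause_covered[OF S cov c False] by blast
    then have "t \<in> T" "r t = t" by (auto simp: T_def pendants_def of_kind_def r_def)
    then have "t \<in> r ` T" by force
    then show ?thesis using t(3) by blast
  qed
  show ?thesis using 1 2 3 by (intro exI[of _ "r ` T"]) simp
qed

end

section \<open>Numbering the vertices of the graph\<close>

definition vertex_kind :: "nat \<Rightarrow> nat \<Rightarrow> kind" where
  "vertex_kind M v = (if v < M then Literal else if v < 2 * M then Clause else if v < 3 * M then PendH
     else if v < 4 * M then PendG else if v < 5 * M then PendG' else if v = 5 * M then HubH
     else if v = 5 * M + 1 then HubG else HubG')"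

text \<open>Clause \<open>c\<close> is the vertex \<open>c + M\<close>, hence the
  subtraction.\<close>

definition cover_adj :: "nat \<Rightarrow> (nat \<Rightarrow> nat \<Rightarrow> bool) \<Rightarrow> nat \<Rightarrow> nat \<Rightarrow> bool" where
  "cover_adj M sat = arc (vertex_kind M) (\<lambda>l c. sat (c - M) l)"

definition cover_edges :: "nat \<Rightarrow> (nat \<Rightarrow> nat \<Rightarrow> bool) \<Rightarrow> nat set set" where
  "cover_edges M sat = {{u, v} | u v. u < 5 * M + 3 \<and> v < 5 * M + 3 \<and> cover_adj M sat u v}"

lemma cover_edges_iff: "{u, v} \<in> cover_edges M sat \<longleftrightarrow>
    u < 5 * M + 3 \<and> v < 5 * M + 3 \<and> (cover_adj M sat u v \<or> cover_adj M sat v u)"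
  unfolding cover_edges_def by (auto simp: doubleton_eq_iff)

lemma of_kind_vertex:
  assumes "cover_graph {..<5 * M + 3} (vertex_kind M) N E h g g'"
  shows "cover_graph.of_kind {..<5 * M + 3} (vertex_kind M) Literal = {..<M}"
    "cover_graph.of_kind {..<5 * M + 3} (vertex_kind M) Clause = {M..<2 * M}"
    "cover_graph.of_kind {..<5 * M + 3} (vertex_kind M) PendH = {2 * M..<3 * M}"
    "cover_graph.of_kind {..<5 * M + 3} (vertex_kind M) PendG = {3 * M..<4 * M}"
    "cover_graph.of_kind {..<5 * M + 3} (vertex_kind M) PendG' = {4 * M..<5 * M}"
  unfolding cover_graph.of_kind_def[OF assms] by (auto simp: vertex_kind_def split: if_splits)

text \<open>Literals, clauses and the three families of pendants occupy five blocks of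
  \<open>M\<close> numbers, followed by the hubs. The threshold adds the \<open>3 * M\<close>
  pendants to the size \<open>K\<close> of the cover.\<close>

theorem cover_iff_strong_geodetic:
  assumes M: "0 < M" and nbr: "\<And>c. c < M \<Longrightarrow> \<exists>l<M. sat c l"
  shows "encode_instance (5 * M + 3) (cover_edges M sat) (int (K + 3 * M)) \<in> BIPARTITE_STRONG_GEODETIC_SET \<longleftrightarrow>
    (\<exists>T. T \<subseteq> {..<M} \<and> card T \<le> K \<and> (\<forall>c<M. \<exists>l\<in>T. sat c l))"
proof -
  let ?V = "{..<5 * M + 3}" and ?E = "cover_edges M sat"
  let ?N = "\<lambda>l c. sat (c - M) l"
  have cg: "cover_graph ?V (vertex_kind M) ?N ?E (5 * M) (5 * M + 1) (5 * M + 2)"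
  proof
    show "\<exists>u v. e = {u, v}" if "e \<in> ?E" for e using that by (auto simp: cover_edges_def)
  qed (auto simp: cover_edges_iff cover_adj_def vertex_kind_def split: if_splits)
  interpret G: cover_graph ?V "vertex_kind M" ?N ?E "5 * M" "5 * M + 1" "5 * M + 2" by (rule cg)
  note kinds = of_kind_vertex[OF cg]
  have pend: "G.pendants = {2 * M..<5 * M}" unfolding G.pendants_def kinds using M by auto
  have "encode_instance (5 * M + 3) ?E (int (K + 3 * M)) \<in> BIPARTITE_STRONG_GEODETIC_SET \<longleftrightarrow>
      (\<exists>S. strong_geodetic_set ?V ?E S \<and> card S \<le> K + 3 * M)"
  proof
    assume "encode_instance (5 * M + 3) ?E (int (K + 3 * M)) \<in> BIPARTITE_STRONG_GEODETIC_SET"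
    then obtain n E k S where n: "encode_instance (5 * M + 3) ?E (int (K + 3 * M)) = encode_instance n E k"
      "simple_graph {..<n} E" "strong_geodetic_set {..<n} E S" "int (card S) \<le> k"
      unfolding BIPARTITE_STRONG_GEODETIC_SET_def by blast
    from encode_instance_inj[OF G.simple_graph_E n(2,1)] n(3,4)
    show "\<exists>S. strong_geodetic_set ?V ?E S \<and> card S \<le> K + 3 * M" by fastforce
  next
    assume "\<exists>S. strong_geodetic_set ?V ?E S \<and> card S \<le> K + 3 * M"
    then have "\<exists>S. strong_geodetic_set ?V ?E S \<and> int (card S) \<le> int (K + 3 * M)" by (simp only: of_nat_le_iff)
    then show "encode_instance (5 * M + 3) ?E (int (K + 3 * M)) \<in> BIPARTITE_STRONG_GEODETIC_SET"
      unfolding BIPARTITE_STRONG_GEODETIC_SET_def using G.simple_graph_E G.bipartite_E by blast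
  qed
  also have "\<dots> \<longleftrightarrow> (\<exists>T. T \<subseteq> {..<M} \<and> card T \<le> K \<and> (\<forall>c<M. \<exists>l\<in>T. sat c l))"
  proof
    assume "\<exists>S. strong_geodetic_set ?V ?E S \<and> card S \<le> K + 3 * M"
    then obtain S where S: "strong_geodetic_set ?V ?E S" "card S \<le> K + card G.pendants"
      unfolding pend by auto
    have "\<exists>l\<in>{..<M}. ?N l c" if "c \<in> {M..<2 * M}" for c
    proof -
      have "c - M < M" using that by auto
      then show ?thesis using nbr by blast
    qed
    then obtain T where T: "T \<subseteq> {..<M}" "card T \<le> K" "\<forall>c\<in>{M..<2 * M}. \<exists>t\<in>T. ?N t c"
      using G.strong_geodetic_imp_cover[OF S, of 0] M unfolding kinds by auto
    have "\<exists>l\<in>T. sat c l" if "c < M" for c using bspec[OF T(3), of "c + M"] that by auto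
    then show "\<exists>T. T \<subseteq> {..<M} \<and> card T \<le> K \<and> (\<forall>c<M. \<exists>l\<in>T. sat c l)" using T(1,2) by blast
  next
    assume "\<exists>T. T \<subseteq> {..<M} \<and> card T \<le> K \<and> (\<forall>c<M. \<exists>l\<in>T. sat c l)"
    then obtain T where T: "T \<subseteq> {..<M}" "card T \<le> K" "\<forall>c<M. \<exists>l\<in>T. sat c l" by blast
    have "strong_geodetic_set ?V ?E (T \<union> G.pendants)"
    proof (rule G.cover_imp_strong_geodetic, unfold kinds)
      \<comment> \<open>The shifts send a literal to a pendant of \<open>g\<close> and a clause to a
        pendant of \<open>h\<close>.\<close>
      show "inj_on (\<lambda>l. l + 3 * M) {..<M}" "inj_on (\<lambda>c. c + M) {M..<2 * M}" by (auto simp: inj_on_def)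
      show "2 * M \<in> {2 * M..<3 * M}" "3 * M \<in> {3 * M..<4 * M}" "4 * M \<in> {4 * M..<5 * M}" using M by auto
      show "\<exists>t\<in>T. sat (c - M) t" if "c \<in> {M..<2 * M}" for c using T(3) that by auto
    qed (use T(1) in auto)
    moreover have "card (T \<union> G.pendants) \<le> K + 3 * M"
      using card_Un_le[of T G.pendants] T(2) unfolding pend by simp
    ultimately show "\<exists>S. strong_geodetic_set ?V ?E S \<and> card S \<le> K + 3 * M" by blast
  qed
  finally show ?thesis .
qed

section \<open>Computations as covering problems\<close>

text \<open>Treating a state together with the scanned symbols as a single value keeps the clauses
  short: a transition depends on one variable. Two tapes are required for the instance and the
  certificate.\<close>

locale tableau =
  fixes M :: tm and zs :: "(nat \<times> nat list) list"
  assumes wf: "wf_tm M" and two_tapes: "2 \<le> ntapes M"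
    and zs: "set zs = {(q, ss). q < nstates M \<and> length ss = ntapes M \<and> set ss \<subseteq> {..<nsyms M}}"
begin

definition "state z = fst (zs ! z)"
definition "scanned z j = snd (zs ! z) ! j"
text \<open>A halted machine repeats its configuration, so a run can be followed up to any time
  bound regardless of when it halts.\<close>

definition "result z = (if state z = halt M then (state z, map (\<lambda>s. (s, Stay)) (snd (zs ! z)))
   else delta M (state z) (snd (zs ! z)))"
definition "next_state z = fst (result z)"
definition "written z j = fst (snd (result z) ! j)"

text \<open>The displacement of the head, shifted by one to be a natural number.\<close>
definition "shift z j = nat (offset (snd (snd (result z) ! j)) + 1)"

definition valid :: "config \<Rightarrow> bool" where
  "valid c \<longleftrightarrow> fst c < nstates M \<and> length (snd c) = ntapes M \<and> (\<forall>j<ntapes M. \<forall>p. fst (snd c ! j) p < nsyms M)"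

lemma length_result:
  assumes "z < length zs"
  shows "length (snd (result z)) = ntapes M" "next_state z < nstates M"
    "j < ntapes M \<Longrightarrow> written z j < nsyms M" "length (snd (zs ! z)) = ntapes M"
proof -
  have z: "fst (zs ! z) < nstates M" "length (snd (zs ! z)) = ntapes M" "\<forall>s\<in>set (snd (zs ! z)). s < nsyms M"
    using nth_mem[OF assms] unfolding zs by (auto simp: split_beta)
  then have d: "fst (delta M (state z) (snd (zs ! z))) < nstates M \<and>
      length (snd (delta M (state z) (snd (zs ! z)))) = ntapes M \<and>
      (\<forall>(s, d)\<in>set (snd (delta M (state z) (snd (zs ! z)))). s < nsyms M)"
    using wf unfolding wf_tm_def state_def by blast
  show len: "length (snd (result z)) = ntapes M" "next_state z < nstates M" "length (snd (zs ! z)) = ntapes M"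
    using d z by (auto simp: result_def next_state_def state_def)
  show "written z j < nsyms M" if "j < ntapes M"
  proof (cases "state z = halt M")
    case True
    then show ?thesis using z that by (simp add: written_def result_def)
  next
    case False
    then have "snd (delta M (state z) (snd (zs ! z))) ! j \<in> set (snd (delta M (state z) (snd (zs ! z))))"
      using d that by simp
    then show ?thesis using False d by (auto simp: written_def result_def split_beta)
  qed
qed

lemma step_result:
  assumes z: "z < length zs" "zs ! z = (fst c, map read_tape (snd c))"
  shows "step M c = (next_state z, map2 act (snd (result z)) (snd c))"
proof (cases "fst c = halt M")
  case True
  have "map2 act (map (\<lambda>s. (s, Stay)) (map read_tape (snd c))) (snd c) = snd c"
    by (rule nth_equalityI) (auto simp: act_def read_tape_def)
  then show ?thesis using True z by (simp add: step_def next_state_def result_def state_def prod_eq_iff)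
next
  case False
  then show ?thesis using z by (simp add: step_def next_state_def result_def state_def Let_def)
qed

lemma valid_code:
  assumes "valid c"
  shows "\<exists>z<length zs. zs ! z = (fst c, map read_tape (snd c))"
proof -
  have "(fst c, map read_tape (snd c)) \<in> set zs"
    using assms unfolding zs valid_def by (auto simp: in_set_conv_nth read_tape_def) (metis fst_conv)
  then show ?thesis by (metis in_set_conv_nth)
qed

lemma valid_step:
  assumes "valid c" shows "valid (step M c)"
proof -
  obtain z where z: "z < length zs" "zs ! z = (fst c, map read_tape (snd c))" using valid_code[OF assms] by blast
  show ?thesis unfolding step_result[OF z]
    using assms length_result[OF z(1)] by (auto simp: valid_def act_def written_def)
qed

lemma valid_init: "valid (init_config M ws)" if "length ws = 2"
  using wf that two_tapes unfolding valid_def init_config_def wf_tm_def word_contents_def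
  by (auto simp: nth_append)

section \<open>The run on a pair of words\<close>

context
  fixes x y :: "bool list"
begin

definition "cfg t = (step M ^^ t) (init_config M [x, y])"
definition "st t = fst (cfg t)"
definition "cell j t = fst (snd (cfg t) ! j)"
definition "pos j t = snd (snd (cfg t) ! j)"

lemma valid_cfg: "valid (cfg t)"
  by (induction t) (auto simp: cfg_def valid_init valid_step)

text \<open>The index need not be unique, since \<open>zs\<close> may repeat entries.\<close>

definition "code_at t z \<longleftrightarrow> z < length zs \<and> state z = st t \<and> (\<forall>j<ntapes M. scanned z j = cell j t (pos j t))"

lemma code_at_iff: "code_at t z \<longleftrightarrow> z < length zs \<and> zs ! z = (fst (cfg t), map read_tape (snd (cfg t)))"
  using valid_cfg[of t] length_result(4)[of z]
  by (auto simp: code_at_def state_def scanned_def st_def cell_def pos_def prod_eq_iff list_eq_iff_nth_eq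
      valid_def read_tape_def)

lemma code_at_exists: "\<exists>z. code_at t z"
  using valid_code[OF valid_cfg] unfolding code_at_iff .

lemma cfg_step:
  assumes "code_at t z"
  shows "st (Suc t) = next_state z"
    "j < ntapes M \<Longrightarrow> pos j (Suc t) = pos j t + int (shift z j) - 1"
    "j < ntapes M \<Longrightarrow> cell j (Suc t) = (cell j t)(pos j t := written z j)"
proof -
  have z: "z < length zs" "zs ! z = (fst (cfg t), map read_tape (snd (cfg t)))" using assms code_at_iff by auto
  have c: "cfg (Suc t) = (next_state z, map2 act (snd (result z)) (snd (cfg t)))"
    using step_result[OF z] by (simp add: cfg_def)
  show "st (Suc t) = next_state z" by (simp add: st_def c)
  have "offset d + 1 \<ge> 0" for d by (cases d) auto
  then show "j < ntapes M \<Longrightarrow> pos j (Suc t) = pos j t + int (shift z j) - 1"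
    "j < ntapes M \<Longrightarrow> cell j (Suc t) = (cell j t)(pos j t := written z j)"
    using length_result(1)[OF z(1)] valid_cfg[of t]
    by (auto simp: pos_def cell_def c act_def shift_def written_def valid_def)
qed

lemma shift_le_2: "shift z j \<le> 2"
  by (cases "snd (snd (result z) ! j)") (auto simp: shift_def)

lemma cfg_0: "st 0 = start M" "j < ntapes M \<Longrightarrow> pos j 0 = 0"
  "j < ntapes M \<Longrightarrow> cell j 0 = word_contents (if j = 0 then x else if j = 1 then y else [])"
  using two_tapes by (auto simp: st_def pos_def cell_def cfg_def init_config_def nth_append nth_Cons')

text \<open>A head moves by at most one cell per step. Hence an offset \<open>W\<close> larger than
  the time bound keeps all shifted positions nonnegative.\<close>

lemma abs_pos_le: "j < ntapes M \<Longrightarrow> \<bar>pos j t\<bar> \<le> int t"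
proof (induction t)
  case (Suc t)
  obtain z where "code_at t z" using code_at_exists by blast
  then show ?case using Suc cfg_step(2)[of t z j] shift_le_2[of z j] by auto
qed (simp add: cfg_0)

lemma cell_less: "j < ntapes M \<Longrightarrow> cell j t p < nsyms M"
  using valid_cfg[of t] by (auto simp: valid_def cell_def)

end

section \<open>Clauses that describe a run\<close>

definition symbol_at :: "bool list \<Rightarrow> nat \<Rightarrow> nat" where
  "symbol_at x k = (if k < length x then if bit_at x k then 2 else 1 else 0)"

text \<open>Extension by 0 outside the finite range, in the shape of \<open>feasible_cases\<close>,
  makes lookups with arbitrary arguments feasible.\<close>

definition table :: "(nat \<Rightarrow> nat) \<Rightarrow> nat \<Rightarrow> nat" where
  "table f z = (if z < length zs then f z else 0)"

definition table2 :: "(nat \<Rightarrow> nat \<Rightarrow> nat) \<Rightarrow> nat \<Rightarrow> nat \<Rightarrow> nat" where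
  "table2 f z j = (if z < length zs then if j < ntapes M then f z j else 0 else 0)"

lemma table_simps [simp]: "z < length zs \<Longrightarrow> table f z = f z"
  "z < length zs \<Longrightarrow> j < ntapes M \<Longrightarrow> table2 g z j = g z j"
  by (simp_all add: table_def table2_def)

text \<open>The cells of tape 1 from \<open>W\<close> to \<open>W + Q - 1\<close> are left open: the
  choice of their symbols is the guess of the certificate.\<close>

definition init_symbol :: "bool list \<Rightarrow> nat \<Rightarrow> nat \<Rightarrow> nat \<Rightarrow> nat \<Rightarrow> nat \<Rightarrow> bool" where
  "init_symbol x W Q j i a \<longleftrightarrow>
     (if j = 0 then a = (if i < W then 0 else symbol_at x (i - W))
      else if j = 1 \<and> W \<le> i \<and> i < W + Q then a \<le> 2 else a = 0)"

text \<open>A variable is a quadruple: \<open>(0, 0, t, 0)\<close> is the state and the scanned symbols at time \<open>t\<close>,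
  as an index into \<open>zs\<close>; \<open>(1, j, t, 0)\<close> is the position of head \<open>j\<close>, and \<open>(2, j, t, i)\<close> the content of
  cell \<open>i\<close> of tape \<open>j\<close>, with positions and cells shifted by \<open>W\<close>. The value \<open>a\<close> of the variable
  \<open>(v, j, t, i)\<close> satisfies the clause numbered \<open>(k, f1, \<dots>, f5)\<close> if the following holds. Clauses
  with \<open>k = 0\<close> demand that the variable has a value; clauses whose guard fails are trivial.\<close>

definition sat :: "bool list \<Rightarrow> nat \<Rightarrow> nat \<Rightarrow> nat \<Rightarrow> nat \<Rightarrow> nat \<Rightarrow> nat \<Rightarrow> nat \<Rightarrow> nat \<Rightarrow> nat \<Rightarrow>
    nat \<Rightarrow> nat \<Rightarrow> nat \<Rightarrow> nat \<Rightarrow> nat \<Rightarrow> bool" where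
  "sat x W Q T k f1 f2 f3 f4 f5 v j t i a \<longleftrightarrow>
    (if k = 0 then v = f1 \<and> j = f2 \<and> t = f3 \<and> i = f4
     else if k = 1 then v = 0 \<and> j = 0 \<and> t = 0 \<and> i = 0 \<and> a < length zs \<and> table state a = start M
     else if k = 2 then f1 < ntapes M \<longrightarrow> v = 1 \<and> j = f1 \<and> t = 0 \<and> i = 0 \<and> a = W
     else if k = 3 then f1 < ntapes M \<longrightarrow> v = 2 \<and> j = f1 \<and> t = 0 \<and> i = f2 \<and> init_symbol x W Q f1 f2 a
     else if k = 4 then W \<le> f1 \<and> f1 < W + Q \<longrightarrow>
       v = 2 \<and> j = 1 \<and> t = 0 \<and> (i = f1 \<and> a \<noteq> 0 \<or> i = Suc f1 \<and> a = 0)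
     else if k = 5 then f1 < ntapes M \<and> f2 \<le> T \<longrightarrow>
       v = 1 \<and> j = f1 \<and> t = f2 \<and> i = 0 \<and> a \<noteq> f3 \<or>
       v = 2 \<and> j = f1 \<and> t = f2 \<and> i = f3 \<and> a \<noteq> f4 \<or>
       v = 0 \<and> j = 0 \<and> t = f2 \<and> i = 0 \<and> a < length zs \<and> table2 scanned a f1 = f4
     else if k = 6 then f1 < T \<and> f2 < length zs \<longrightarrow>
       v = 0 \<and> j = 0 \<and> i = 0 \<and> (t = f1 \<and> a \<noteq> f2 \<or> t = Suc f1 \<and> a < length zs \<and> table state a = table next_state f2)
     else if k = 7 then f1 < ntapes M \<and> f2 < T \<and> f3 < length zs \<longrightarrow>
       v = 0 \<and> j = 0 \<and> t = f2 \<and> i = 0 \<and> a \<noteq> f3 \<or>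
       v = 1 \<and> j = f1 \<and> i = 0 \<and> (t = f2 \<and> a \<noteq> f4 \<or> t = Suc f2 \<and> Suc a = f4 + table2 shift f3 f1)
     else if k = 8 then f1 < ntapes M \<and> f2 < T \<and> f3 < length zs \<longrightarrow>
       v = 0 \<and> j = 0 \<and> t = f2 \<and> i = 0 \<and> a \<noteq> f3 \<or>
       v = 1 \<and> j = f1 \<and> t = f2 \<and> i = 0 \<and> a \<noteq> f4 \<or>
       v = 2 \<and> j = f1 \<and> t = Suc f2 \<and> i = f4 \<and> a = table2 written f3 f1
     else if k = 9 then f1 < ntapes M \<and> f2 < T \<and> f3 \<noteq> f4 \<longrightarrow>
       v = 1 \<and> j = f1 \<and> t = f2 \<and> i = 0 \<and> a \<noteq> f3 \<or>
       v = 2 \<and> j = f1 \<and> i = f4 \<and> (t = f2 \<and> a \<noteq> f5 \<or> t = Suc f2 \<and> a = f5)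
     else if k = 10 then v = 2 \<and> j = ntapes M - 1 \<and> t = T \<and> i = W \<and> a = 2
     else True)"

text \<open>Kinds 1 to 4 of the clauses fix the initial configuration, where kind 4 propagates
  blanks so that the guess is a word. Kind 5 ties the scanned symbols to the cells under the heads,
  kinds 6 to 8 perform the transition, kind 9 keeps the other cells, and kind 10 demands
  acceptance.\<close>

definition satisfying :: "bool list \<Rightarrow> nat \<Rightarrow> nat \<Rightarrow> nat \<Rightarrow> nat \<Rightarrow> (nat \<Rightarrow> nat \<Rightarrow> nat \<Rightarrow> nat \<Rightarrow> nat) \<Rightarrow> bool" where
  "satisfying x W Q T D A \<longleftrightarrow> (\<forall>k<D. \<forall>f1<D. \<forall>f2<D. \<forall>f3<D. \<forall>f4<D. \<forall>f5<D.
     \<exists>v<D. \<exists>j<D. \<exists>t<D. \<exists>i<D. sat x W Q T k f1 f2 f3 f4 f5 v j t i (A v j t i))"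

text \<open>\<open>D\<close> exceeds all numbers that matter: the clause kinds up to 10, cells and
  head positions up to \<open>2 * W\<close>, and the sizes of the machine. \<open>T < W\<close>
  leaves room for the heads on the left, \<open>Q \<le> W\<close> room for the certificate on the
  right.\<close>

definition large :: "nat \<Rightarrow> nat \<Rightarrow> nat \<Rightarrow> nat \<Rightarrow> bool" where
  "large W Q T D \<longleftrightarrow> T < W \<and> Q \<le> W \<and> 2 * W + 11 \<le> D \<and> ntapes M < D \<and> length zs < D \<and> nsyms M < D"

lemma clause_kinds:
  obtains "k = 0" | "k = 1" | "k = 2" | "k = 3" | "k = 4" | "k = 5" | "k = 6" | "k = 7" | "k = 8" | "k = 9"
    | "k = 10" | "k > (10 :: nat)"
proof -
  have "k = 0 \<or> k = 1 \<or> k = 2 \<or> k = 3 \<or> k = 4 \<or> k = 5 \<or> k = 6 \<or> k = 7 \<or> k = 8 \<or> k = 9 \<or> k = 10 \<or> k > 10"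
    by presburger
  then show ?thesis using that by blast
qed

lemma word_contents_symbol_at:
  "word_contents w (int i - int W) = (if i < W then 0 else symbol_at w (i - W))"
  by (auto simp: word_contents_def symbol_at_def bit_at_def nat_diff_distrib simp flip: of_nat_diff)

text \<open>A disjunct \<open>a \<noteq> f\<close> of a clause acts as a premise: instantiating
  \<open>f\<close> with the value that \<open>A\<close> gives leaves the conclusion. The certificate
  is read off tape 1 at time 0, and \<open>inv\<close> identifies the values of \<open>A\<close>
  with the run on it.\<close>

lemma satisfying_imp_run:
  assumes A: "satisfying x W Q T D A" and bound: "\<And>v j t i. A v j t i < D" and D: "large W Q T D"
  shows "\<exists>y. length y \<le> Q \<and> cell x y (ntapes M - 1) T 0 = 2"
proof -
  note D' = D[unfolded large_def]
  have sat: "\<exists>v<D. \<exists>j<D. \<exists>t<D. \<exists>i<D. sat x W Q T k f1 f2 f3 f4 f5 v j t i (A v j t i)"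
    if "k \<le> 10" "f1 < D" "f2 < D" "f3 < D" "f4 < D" "f5 < D" for k f1 f2 f3 f4 f5
    using A that D' by (auto simp: satisfying_def)
  have c1: "A 0 0 0 0 < length zs \<and> state (A 0 0 0 0) = start M"
    using sat[of 1 0 0 0 0 0] D' by (auto simp: sat_def)
  have c2: "A 1 j 0 0 = W" if "j < ntapes M" for j
    using sat[of 2 j 0 0 0 0] D' that by (auto simp: sat_def)
  have c3: "init_symbol x W Q j i (A 2 j 0 i)" if "j < ntapes M" "i < D" for j i
    using sat[of 3 j i 0 0 0] D' that by (auto simp: sat_def)
  have c4: "A 2 1 0 (Suc i) = 0" if "A 2 1 0 i = 0" "W \<le> i" "i < W + Q" for i
    using sat[of 4 i 0 0 0 0] D' that by (auto simp: sat_def)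
  have c5: "A 0 0 t 0 < length zs \<and> scanned (A 0 0 t 0) j = A 2 j t (A 1 j t 0)"
    if "j < ntapes M" "t \<le> T" for j t
    using sat[of 5 j t "A 1 j t 0" "A 2 j t (A 1 j t 0)" 0] D' that bound by (auto simp: sat_def)
  have c6: "A 0 0 (Suc t) 0 < length zs \<and> state (A 0 0 (Suc t) 0) = next_state (A 0 0 t 0)"
    if "t < T" "A 0 0 t 0 < length zs" for t
    using sat[of 6 t "A 0 0 t 0" 0 0 0] D' that bound by (auto simp: sat_def)
  have c7: "Suc (A 1 j (Suc t) 0) = A 1 j t 0 + shift (A 0 0 t 0) j"
    if "j < ntapes M" "t < T" "A 0 0 t 0 < length zs" for j t
    using sat[of 7 j t "A 0 0 t 0" "A 1 j t 0" 0] D' that bound by (auto simp: sat_def)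
  have c8: "A 2 j (Suc t) (A 1 j t 0) = written (A 0 0 t 0) j"
    if "j < ntapes M" "t < T" "A 0 0 t 0 < length zs" for j t
    using sat[of 8 j t "A 0 0 t 0" "A 1 j t 0" 0] D' that bound by (auto simp: sat_def)
  have c9: "A 2 j (Suc t) i = A 2 j t i"
    if "j < ntapes M" "t < T" "i < D" "A 1 j t 0 \<noteq> i" for j t i
    using sat[of 9 j t "A 1 j t 0" i "A 2 j t i"] D' that bound by (auto simp: sat_def)
  have c10: "A 2 (ntapes M - 1) T W = 2"
    using sat[of 10 0 0 0 0 0] D' by (auto simp: sat_def)
  \<comment> \<open>The first cell behind the certificate area is blank, so a least blank exists and
    the certificate has length at most \<open>Q\<close>.\<close>
  have zeroQ: "A 2 1 0 (W + Q) = 0"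
    using c3[of 1 "W + Q"] two_tapes D' by (simp add: init_symbol_def)
  define L where "L = (LEAST i. A 2 1 0 (W + i) = 0)"
  have L: "A 2 1 0 (W + L) = 0" "L \<le> Q" "\<And>i. i < L \<Longrightarrow> A 2 1 0 (W + i) \<noteq> 0"
    unfolding L_def using LeastI[of "\<lambda>i. A 2 1 0 (W + i) = 0", OF zeroQ]
      Least_le[of "\<lambda>i. A 2 1 0 (W + i) = 0", OF zeroQ] not_less_Least by auto
  define y where "y = map (\<lambda>i. A 2 1 0 (W + i) = 2) [0..<L]"
  \<comment> \<open>Inside the certificate area blanks propagate by the clauses of kind 4; behind it
    all cells are blank.\<close>
  have zero: "A 2 1 0 (W + i) = 0" if "L \<le> i" "W + i < D" for i
    using that
  proof (induction i rule: dec_induct)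
    case (step i)
    then have "A 2 1 0 (W + i) = 0" by simp
    then show ?case using c4[of "W + i"] c3[of 1 "W + Suc i"] two_tapes step
      by (cases "i < Q") (auto simp: init_symbol_def)
  qed (use L in simp)
  have y: "A 2 1 0 i = word_contents y (int i - int W)" if "i < D" for i
  proof (cases "i < W")
    case True
    then show ?thesis using c3[of 1 i] two_tapes that by (simp add: init_symbol_def word_contents_def)
  next
    case False
    then obtain k where k: "i = W + k" by (metis le_Suc_ex not_less)
    show ?thesis
    proof (cases "k < L")
      case True
      then have "A 2 1 0 i \<le> 2" "A 2 1 0 i \<noteq> 0"
        using c3[of 1 i] L(2,3) two_tapes that k by (auto simp: init_symbol_def)
      then show ?thesis using True by (auto simp: k word_contents_def y_def)
    next
      case F: False
      then show ?thesis using zero[of k] that by (simp add: k word_contents_def y_def)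
    qed
  qed
  have inv: "A 0 0 t 0 < length zs \<and> state (A 0 0 t 0) = st x y t \<and>
      (\<forall>j<ntapes M. int (A 1 j t 0) = int W + pos x y j t \<and>
        (\<forall>i<D. A 2 j t i = cell x y j t (int i - int W)))" if "t \<le> T" for t
    using that
  proof (induction t)
    case 0
    have "A 2 j 0 i = cell x y j 0 (int i - int W)" if "j < ntapes M" "i < D" for i j
      using y[OF that(2)] c3[OF that] that unfolding cfg_0(3)[OF that(1)]
      by (auto simp: word_contents_symbol_at init_symbol_def symbol_at_def)
    then show ?case using c1 c2 by (auto simp: cfg_0)
  next
    case (Suc t)
    then have IH: "A 0 0 t 0 < length zs" "state (A 0 0 t 0) = st x y t"
      "\<And>j. j < ntapes M \<Longrightarrow> int (A 1 j t 0) = int W + pos x y j t"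
      "\<And>j i. j < ntapes M \<Longrightarrow> i < D \<Longrightarrow> A 2 j t i = cell x y j t (int i - int W)" and t: "t < T" "t \<le> T"
      by auto
    have z: "code_at x y t (A 0 0 t 0)"
      unfolding code_at_def using IH c5[OF _ t(2)] bound by auto
    have "int (A 1 j (Suc t) 0) = int W + pos x y j (Suc t)" if "j < ntapes M" for j
      using c7[OF that t(1) IH(1)] IH(3)[OF that] cfg_step(2)[OF z that] by linarith
    moreover have "A 2 j (Suc t) i = cell x y j (Suc t) (int i - int W)" if "j < ntapes M" "i < D" for j i
      using c8[OF that(1) t(1) IH(1)] c9[OF that(1) t(1) that(2)] IH(3)[OF that(1)] IH(4)[OF that]
        cfg_step(3)[OF z that(1)] by (cases "A 1 j t 0 = i") auto
    ultimately show ?case using c6[OF t(1) IH(1)] cfg_step(1)[OF z] by auto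
  qed
  have "cell x y (ntapes M - 1) T 0 = 2"
    using inv[of T] c10 two_tapes D' by auto
  then show ?thesis using L(2) by (intro exI[of _ y]) (simp add: y_def)
qed

text \<open>Every certificate of admissible length satisfies all clauses except possibly acceptance.
  Separating that clause lets the same construction show that each single clause can be
  satisfied.\<close>

lemma run_satisfies:
  assumes y: "length y \<le> Q" and D: "large W Q T D"
  shows "\<exists>A. (\<forall>v j t i. A v j t i < D) \<and> (\<forall>k<D. \<forall>f1<D. \<forall>f2<D. \<forall>f3<D. \<forall>f4<D. \<forall>f5<D.
    (k = 10 \<longrightarrow> cell x y (ntapes M - 1) T 0 = 2) \<longrightarrow>
    (\<exists>v<D. \<exists>j<D. \<exists>t<D. \<exists>i<D. sat x W Q T k f1 f2 f3 f4 f5 v j t i (A v j t i)))"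
proof -
  note D' = D[unfolded large_def]
  obtain z where z: "\<And>t. code_at x y t (z t)" using code_at_exists by metis
  then have zs: "\<And>t. z t < length zs" "\<And>t. state (z t) = st x y t"
    "\<And>t j. j < ntapes M \<Longrightarrow> scanned (z t) j = cell x y j t (pos x y j t)"
    by (auto simp: code_at_def)
  define B where "B v j t i = (if v = 0 then z t else if v = 1 then nat (int W + pos x y j t)
    else cell x y j t (int i - int W))" for v j t i :: nat
  \<comment> \<open>Variables without meaning, such as those of a tape index beyond
    \<open>ntapes M\<close>, may have large values in \<open>B\<close>; they are reset to 0 to keep
    all values below \<open>D\<close>.\<close>
  define A where "A v j t i = (if B v j t i < D then B v j t i else 0)" for v j t i
  have A0: "A 0 j t i = z t" for j t i
    using zs(1)[of t] D' by (auto simp: A_def B_def)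
  have A1: "A 1 j t i = nat (int W + pos x y j t)" "int (A 1 j t i) = int W + pos x y j t"
    if "j < ntapes M" "t \<le> T" for j t i
    using abs_pos_le[OF that(1), of x y t] that(2) D' by (auto simp: A_def B_def)
  have A2: "A 2 j t i = cell x y j t (int i - int W)" if "j < ntapes M" for j t i
    using cell_less[OF that, of x y t "int i - int W"] D' by (auto simp: A_def B_def)
  have init: "init_symbol x W Q j i (A 2 j 0 i)" if "j < ntapes M" for j i
    unfolding A2[OF that] cfg_0(3)[OF that] using y
    by (auto simp: init_symbol_def word_contents_symbol_at symbol_at_def)
  have main: "\<exists>v<D. \<exists>j<D. \<exists>t<D. \<exists>i<D. sat x W Q T k f1 f2 f3 f4 f5 v j t i (A v j t i)"
    if f: "k < D" "f1 < D" "f2 < D" "f3 < D" "f4 < D" "f5 < D"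
      and k: "k = 10 \<longrightarrow> cell x y (ntapes M - 1) T 0 = 2" for k f1 f2 f3 f4 f5
  proof -
    let ?ex = "\<exists>v<D. \<exists>j<D. \<exists>t<D. \<exists>i<D. sat x W Q T k f1 f2 f3 f4 f5 v j t i (A v j t i)"
    have I: ?ex if "sat x W Q T k f1 f2 f3 f4 f5 v j t i (A v j t i)" "v < 3" "j < D" "t < D" "i < D" for v j t i
      using that D' by (intro exI[of _ v] exI[of _ j] exI[of _ t] exI[of _ i]) auto
    show ?thesis
    proof (cases k rule: clause_kinds)
      case 1
      then show ?thesis using f by (auto simp: sat_def)
    next
      case 2
      then show ?thesis using D' zs(1,2)[of 0] by (intro I[of 0 0 0 0]) (auto simp: sat_def A0 cfg_0)
    next
      case 3
      then show ?thesis using D' f by (intro I[of 1 f1 0 0]) (auto simp: sat_def A1[unfolded One_nat_def] cfg_0)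
    next
      case 4
      then show ?thesis using D' f init[of f1 f2] by (intro I[of 2 f1 0 f2]) (auto simp: sat_def)
    next
      case 5
      have 1: "1 < ntapes M" using two_tapes by simp
      show ?thesis
      proof (cases "A 2 1 0 f1 = 0 \<and> W \<le> f1 \<and> f1 < W + Q")
        case True
        then have "A 2 1 0 (Suc f1) = 0"
          unfolding A2[OF 1] cfg_0(3)[OF 1] word_contents_symbol_at by (auto simp: symbol_at_def split: if_splits)
        then show ?thesis using 5 D' f True by (intro I[of 2 1 0 "Suc f1"]) (auto simp: sat_def)
      next
        case False
        then show ?thesis using 5 D' f by (intro I[of 2 1 0 f1]) (auto simp: sat_def)
      qed
    next
      case 6
      consider "A 1 f1 f2 0 \<noteq> f3 \<or> \<not> (f1 < ntapes M \<and> f2 \<le> T)" | "A 2 f1 f2 f3 \<noteq> f4"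
        | "f1 < ntapes M" "f2 \<le> T" "A 1 f1 f2 0 = f3" "A 2 f1 f2 f3 = f4" by blast
      then show ?thesis
      proof cases
        case 1
        then show ?thesis using 6 D' f by (intro I[of 1 f1 f2 0]) (auto simp: sat_def)
      next
        case 2
        then show ?thesis using 6 D' f by (intro I[of 2 f1 f2 f3]) (auto simp: sat_def)
      next
        case 3
        then have "scanned (z f2) f1 = f4" using zs(3)[of f1 f2] A1(2)[of f1 f2 0] A2[of f1 f2 f3] by auto
        then show ?thesis using 3 6 D' f zs(1) by (intro I[of 0 0 f2 0]) (auto simp: sat_def A0)
      qed
    next
      case 7
      show ?thesis
      proof (cases "f1 < T \<and> f2 < length zs \<and> z f1 = f2")
        case True
        then show ?thesis using 7 D' f zs(1,2)[of "Suc f1"] cfg_step(1)[OF z[of f1]]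
          by (intro I[of 0 0 "Suc f1" 0]) (auto simp: sat_def A0)
      next
        case False
        then show ?thesis using 7 D' f by (intro I[of 0 0 f1 0]) (auto simp: sat_def A0)
      qed
    next
      case 8
      consider "z f2 \<noteq> f3 \<or> \<not> (f1 < ntapes M \<and> f2 < T)" | "A 1 f1 f2 0 \<noteq> f4"
        | "f1 < ntapes M" "f2 < T" "z f2 = f3" "A 1 f1 f2 0 = f4" by blast
      then show ?thesis
      proof cases
        case 1
        then show ?thesis using 8 D' f by (intro I[of 0 0 f2 0]) (auto simp: sat_def A0)
      next
        case 2
        then show ?thesis using 8 D' f by (intro I[of 1 f1 f2 0]) (auto simp: sat_def)
      next
        case 3
        then have "Suc (A 1 f1 (Suc f2) 0) = f4 + shift f3 f1"
          using cfg_step(2)[OF z[of f2], of f1] A1(2)[of f1 f2 0] A1(2)[of f1 "Suc f2" 0] by auto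
        then show ?thesis using 3 8 D' f by (intro I[of 1 f1 "Suc f2" 0]) (auto simp: sat_def)
      qed
    next
      case 9
      consider "z f2 \<noteq> f3 \<or> \<not> (f1 < ntapes M \<and> f2 < T)" | "A 1 f1 f2 0 \<noteq> f4"
        | "f1 < ntapes M" "f2 < T" "z f2 = f3" "A 1 f1 f2 0 = f4" by blast
      then show ?thesis
      proof cases
        case 1
        then show ?thesis using 9 D' f by (intro I[of 0 0 f2 0]) (auto simp: sat_def A0)
      next
        case 2
        then show ?thesis using 9 D' f by (intro I[of 1 f1 f2 0]) (auto simp: sat_def)
      next
        case 3
        then have "A 2 f1 (Suc f2) f4 = written f3 f1"
          using cfg_step(3)[OF z[of f2], of f1] A1(2)[of f1 f2 0] A2[of f1 "Suc f2" f4] by auto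
        then show ?thesis using 3 9 D' f by (intro I[of 2 f1 "Suc f2" f4]) (auto simp: sat_def)
      qed
    next
      case 10
      consider "A 1 f1 f2 0 \<noteq> f3 \<or> \<not> (f1 < ntapes M \<and> f2 < T \<and> f3 \<noteq> f4)" | "A 2 f1 f2 f4 \<noteq> f5"
        | "f1 < ntapes M" "f2 < T" "f3 \<noteq> f4" "A 1 f1 f2 0 = f3" "A 2 f1 f2 f4 = f5" by blast
      then show ?thesis
      proof cases
        case 1
        then show ?thesis using 10 D' f by (intro I[of 1 f1 f2 0]) (auto simp: sat_def)
      next
        case 2
        then show ?thesis using 10 D' f by (intro I[of 2 f1 f2 f4]) (auto simp: sat_def)
      next
        case 3
        then have "A 2 f1 (Suc f2) f4 = f5"
          using cfg_step(3)[OF z[of f2], of f1] A1(2)[of f1 f2 0] A2[of f1 "Suc f2" f4] A2[of f1 f2 f4] by auto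
        then show ?thesis using 3 10 D' f by (intro I[of 2 f1 "Suc f2" f4]) (auto simp: sat_def)
      qed
    next
      case 11
      have "ntapes M - 1 < ntapes M" using two_tapes by simp
      then show ?thesis using 11 D' f k by (intro I[of 2 "ntapes M - 1" T W]) (auto simp: sat_def A2)
    next
      case 12
      then show ?thesis using D' by (intro I[of 0 0 0 0]) (auto simp: sat_def)
    qed
  qed
  have "A v j t i < D" for v j t i using D' by (auto simp: A_def)
  then show ?thesis by (intro exI[of _ A] conjI allI impI main) auto
qed

lemma run_imp_satisfying:
  assumes "length y \<le> Q" "cell x y (ntapes M - 1) T 0 = 2" "large W Q T D"
  shows "\<exists>A. satisfying x W Q T D A \<and> (\<forall>v j t i. A v j t i < D)"
  using run_satisfies[OF assms(1,3), of x] assms(2) unfolding satisfying_def by auto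

text \<open>This allows a clause vertex of a strong geodetic set to be exchanged for a literal. The
  run on the empty certificate provides the literal, except for the acceptance clause, which names
  its only literal.\<close>

lemma sat_exists:
  assumes D: "large W Q T D" and f: "k < D" "f1 < D" "f2 < D" "f3 < D" "f4 < D" "f5 < D"
  shows "\<exists>v<D. \<exists>j<D. \<exists>t<D. \<exists>i<D. \<exists>a<D. sat x W Q T k f1 f2 f3 f4 f5 v j t i a"
proof (cases "k = 10")
  case True
  have "2 < D" "ntapes M - 1 < D" "T < D" "W < D" using D by (auto simp: large_def)
  moreover have "sat x W Q T k f1 f2 f3 f4 f5 2 (ntapes M - 1) T W 2" using True by (simp add: sat_def)
  ultimately show ?thesis by blast
next
  case False
  obtain A where A: "\<And>v j t i. A v j t i < D" and sat: "\<forall>k<D. \<forall>f1<D. \<forall>f2<D. \<forall>f3<D. \<forall>f4<D. \<forall>f5<D.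
    (k = 10 \<longrightarrow> cell x [] (ntapes M - 1) T 0 = 2) \<longrightarrow>
    (\<exists>v<D. \<exists>j<D. \<exists>t<D. \<exists>i<D. sat x W Q T k f1 f2 f3 f4 f5 v j t i (A v j t i))"
    using run_satisfies[OF _ D, of "[]" x] by auto
  have "\<exists>v<D. \<exists>j<D. \<exists>t<D. \<exists>i<D. sat x W Q T k f1 f2 f3 f4 f5 v j t i (A v j t i)"
    by (rule sat[rule_format, OF f]) (use False in simp)
  then show ?thesis using A by blast
qed

end

section \<open>The reduction\<close>

primrec digit :: "nat \<Rightarrow> nat \<Rightarrow> nat \<Rightarrow> nat" where
  "digit D 0 x = x mod D"
| "digit D (Suc k) x = digit D k (x div D)"

lemma digit_less: "0 < D \<Longrightarrow> digit D k x < D"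
  by (induction k arbitrary: x) auto

lemma digits_exist:
  assumes "\<And>k. k < n \<Longrightarrow> f k < D"
  shows "\<exists>x<D ^ n. \<forall>k<n. digit D k x = f k"
  using assms
proof (induction n arbitrary: f)
  case (Suc n)
  have "f (Suc k) < D" if "k < n" for k using Suc.prems that by simp
  from Suc.IH[of "\<lambda>k. f (Suc k)", OF this] obtain x where
    x: "x < D ^ n" "\<forall>k<n. digit D k x = f (Suc k)" by blast
  have f0: "f 0 < D" using Suc.prems by simp
  have "x * D + f 0 < D * (x + 1)" using f0 by simp
  also have "\<dots> \<le> D * D ^ n" using x(1) by (intro mult_le_mono2) simp
  finally have "x * D + f 0 < D ^ Suc n" by simp
  moreover have "digit D k (x * D + f 0) = f k" if "k < Suc n" for k
    using that x(2) f0 by (cases k) auto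
  ultimately show ?case by blast
qed simp

context tableau
begin

text \<open>A clause number has the six digits \<open>k\<close>, \<open>f1\<close> to
  \<open>f5\<close>, a literal the five digits \<open>v\<close>, \<open>j\<close>, \<open>t\<close>,
  \<open>i\<close>, \<open>a\<close>. Literals also range below \<open>D ^ 6\<close>, with a free
  leading digit, so that there are as many literals as clauses.\<close>

definition clause_sat :: "bool list \<Rightarrow> nat \<Rightarrow> nat \<Rightarrow> nat \<Rightarrow> nat \<Rightarrow> nat \<Rightarrow> nat \<Rightarrow> bool" where
  "clause_sat x W Q T D c l = sat x W Q T (digit D 5 c) (digit D 4 c) (digit D 3 c) (digit D 2 c) (digit D 1 c)
     (digit D 0 c) (digit D 4 l) (digit D 3 l) (digit D 2 l) (digit D 1 l) (digit D 0 l)"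

lemma six_digits:
  assumes "a < D" "b < D" "c < D" "d < D" "e < D" "f < D"
  obtains x where "x < D ^ 6" "digit D 5 x = a" "digit D 4 x = b" "digit D 3 x = c" "digit D 2 x = d"
    "digit D 1 x = e" "digit D 0 x = f"
proof -
  have "[f, e, d, c, b, a] ! k < D" if "k < 6" for k
    using that assms by (auto simp: less_Suc_eq numeral_eq_Suc)
  from digits_exist[of 6 "\<lambda>k. [f, e, d, c, b, a] ! k", OF this] obtain x where
    x: "x < D ^ 6" "\<And>k. k < 6 \<Longrightarrow> digit D k x = [f, e, d, c, b, a] ! k" by blast
  show ?thesis by (rule that[OF x(1)]) (subst x(2); simp)+
qed

lemma clause_sat_exists:
  assumes "large W Q T D"
  shows "\<exists>l<D ^ 6. clause_sat x W Q T D c l"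
proof -
  have D: "0 < D" using assms by (simp add: large_def)
  obtain v j t i a where l: "v < D" "j < D" "t < D" "i < D" "a < D"
    "sat x W Q T (digit D 5 c) (digit D 4 c) (digit D 3 c) (digit D 2 c) (digit D 1 c) (digit D 0 c) v j t i a"
    using sat_exists[OF assms, of "digit D 5 c" "digit D 4 c" "digit D 3 c" "digit D 2 c" "digit D 1 c" "digit D 0 c"]
      digit_less[OF D] by blast
  obtain y where "y < D ^ 6" "digit D 4 y = v" "digit D 3 y = j" "digit D 2 y = t" "digit D 1 y = i" "digit D 0 y = a"
    by (rule six_digits[OF D l(1-5)])
  then show ?thesis using l(6) unfolding clause_sat_def by blast
qed

text \<open>There are \<open>D ^ 4\<close> variables, so a covering set of at most \<open>D ^ 4\<close> literals
  contains exactly one value of each.\<close>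

lemma cover_iff_satisfying:
  assumes large: "large W Q T D"
  shows "(\<exists>L. L \<subseteq> {..<D ^ 6} \<and> card L \<le> D ^ 4 \<and> (\<forall>c<D ^ 6. \<exists>l\<in>L. clause_sat x W Q T D c l)) \<longleftrightarrow>
    (\<exists>A. satisfying x W Q T D A \<and> (\<forall>v j t i. A v j t i < D))"
proof
  have D: "0 < D" using large by (simp add: large_def)
  let ?var = "\<lambda>l. (digit D 4 l, digit D 3 l, digit D 2 l, digit D 1 l)"
  let ?vars = "{..<D} \<times> {..<D} \<times> {..<D} \<times> {..<D}"
  have card: "card ?vars = D ^ 4" by (simp add: numeral_eq_Suc)
  {
    assume "\<exists>L. L \<subseteq> {..<D ^ 6} \<and> card L \<le> D ^ 4 \<and> (\<forall>c<D ^ 6. \<exists>l\<in>L. clause_sat x W Q T D c l)"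
    then obtain L where L: "L \<subseteq> {..<D ^ 6}" "card L \<le> D ^ 4" "\<And>c. c < D ^ 6 \<Longrightarrow> \<exists>l\<in>L. clause_sat x W Q T D c l"
      by blast
    have fin: "finite L" using L(1) finite_subset by blast
    have ex: "\<exists>l\<in>L. sat x W Q T k f1 f2 f3 f4 f5 (digit D 4 l) (digit D 3 l) (digit D 2 l) (digit D 1 l) (digit D 0 l)"
      if f: "k < D" "f1 < D" "f2 < D" "f3 < D" "f4 < D" "f5 < D" for k f1 f2 f3 f4 f5
    proof -
      obtain c where "c < D ^ 6" "digit D 5 c = k" "digit D 4 c = f1" "digit D 3 c = f2" "digit D 2 c = f3"
        "digit D 1 c = f4" "digit D 0 c = f5"
        by (rule six_digits[OF f])
      then show ?thesis using L(3)[of c] unfolding clause_sat_def by blast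
    qed
    \<comment> \<open>The clauses of kind 0 force a literal for each variable.\<close>
    have "?vars \<subseteq> ?var ` L"
    proof
      fix u assume "u \<in> ?vars"
      then obtain v j t i where u: "u = (v, j, t, i)" "v < D" "j < D" "t < D" "i < D" by auto
      then obtain l where "l \<in> L" "?var l = u" using ex[OF D u(2-5) D] by (auto simp: sat_def)
      then show "u \<in> ?var ` L" by blast
    qed
    then have "D ^ 4 \<le> card (?var ` L)" using card_mono[of "?var ` L" ?vars] fin card by simp
    then have "card (?var ` L) = card L" using card_image_le[OF fin, of ?var] L(2) by simp
    then have inj: "inj_on ?var L" by (rule eq_card_imp_inj_on[OF fin])
    \<comment> \<open>By injectivity the choice returns the only literal of the variable. For
      arguments that are not variables it is arbitrary, but a digit is always below
      \<open>D\<close>.\<close>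
    define A where "A v j t i = digit D 0 (SOME l. l \<in> L \<and> ?var l = (v, j, t, i))" for v j t i
    have A: "A (digit D 4 l) (digit D 3 l) (digit D 2 l) (digit D 1 l) = digit D 0 l" if "l \<in> L" for l
    proof -
      have "(SOME l'. l' \<in> L \<and> ?var l' = ?var l) = l"
        by (rule some_equality) (use that inj in \<open>auto dest: inj_onD\<close>)
      then show ?thesis by (simp add: A_def)
    qed
    have "satisfying x W Q T D A" unfolding satisfying_def
    proof (intro allI impI)
      fix k f1 f2 f3 f4 f5 assume f: "k < D" "f1 < D" "f2 < D" "f3 < D" "f4 < D" "f5 < D"
      obtain l where "l \<in> L"
        "sat x W Q T k f1 f2 f3 f4 f5 (digit D 4 l) (digit D 3 l) (digit D 2 l) (digit D 1 l) (digit D 0 l)"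
        using ex[OF f] by blast
      then have "sat x W Q T k f1 f2 f3 f4 f5 (digit D 4 l) (digit D 3 l) (digit D 2 l) (digit D 1 l)
          (A (digit D 4 l) (digit D 3 l) (digit D 2 l) (digit D 1 l))" by (simp only: A)
      with digit_less[OF D, of 4 l] digit_less[OF D, of 3 l] digit_less[OF D, of 2 l] digit_less[OF D, of 1 l]
      show "\<exists>v<D. \<exists>j<D. \<exists>t<D. \<exists>i<D. sat x W Q T k f1 f2 f3 f4 f5 v j t i (A v j t i)"
        by blast
    qed
    moreover have "A v j t i < D" for v j t i unfolding A_def by (rule digit_less[OF D])
    ultimately show "\<exists>A. satisfying x W Q T D A \<and> (\<forall>v j t i. A v j t i < D)" by blast
  next
    assume "\<exists>A. satisfying x W Q T D A \<and> (\<forall>v j t i. A v j t i < D)"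
    then obtain A where A: "satisfying x W Q T D A" "\<And>v j t i. A v j t i < D" by blast
    have ex: "\<exists>l<D ^ 6. digit D 4 l = v \<and> digit D 3 l = j \<and> digit D 2 l = t \<and> digit D 1 l = i \<and> digit D 0 l = A v j t i"
      if "v < D" "j < D" "t < D" "i < D" for v j t i
      by (rule six_digits[OF D that A(2)[of v j t i]]) blast
    define l where "l v j t i = (SOME l. l < D ^ 6 \<and> digit D 4 l = v \<and> digit D 3 l = j \<and> digit D 2 l = t \<and>
        digit D 1 l = i \<and> digit D 0 l = A v j t i)" for v j t i
    have l: "l v j t i < D ^ 6 \<and> digit D 4 (l v j t i) = v \<and> digit D 3 (l v j t i) = j \<and> digit D 2 (l v j t i) = t \<and>
        digit D 1 (l v j t i) = i \<and> digit D 0 (l v j t i) = A v j t i"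
      if "v < D" "j < D" "t < D" "i < D" for v j t i
      using someI_ex[OF ex[OF that]] unfolding l_def .
    let ?L = "(\<lambda>(v, j, t, i). l v j t i) ` ?vars"
    have "?L \<subseteq> {..<D ^ 6}" using l by auto
    moreover have "card ?L \<le> D ^ 4" using card_image_le[of ?vars "\<lambda>(v, j, t, i). l v j t i"] card by simp
    moreover have "\<exists>l'\<in>?L. clause_sat x W Q T D c l'" for c
    proof -
      obtain v j t i where v: "v < D" "j < D" "t < D" "i < D"
        "sat x W Q T (digit D 5 c) (digit D 4 c) (digit D 3 c) (digit D 2 c) (digit D 1 c) (digit D 0 c)
          v j t i (A v j t i)"
        using A(1)[unfolded satisfying_def, rule_format,
            of "digit D 5 c" "digit D 4 c" "digit D 3 c" "digit D 2 c" "digit D 1 c" "digit D 0 c"]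
          digit_less[OF D] by blast
      then have "clause_sat x W Q T D c (l v j t i)" using l[OF v(1-4)] by (simp add: clause_sat_def)
      moreover have "l v j t i \<in> ?L" using v(1-4) by force
      ultimately show ?thesis by blast
    qed
    ultimately show "\<exists>L. L \<subseteq> {..<D ^ 6} \<and> card L \<le> D ^ 4 \<and> (\<forall>c<D ^ 6. \<exists>l\<in>L. clause_sat x W Q T D c l)"
      by (intro exI[of _ ?L]) simp
  }
qed

end

subsection \<open>Instances are written in polynomial time\<close>

text \<open>Powers of two may be exponentially large and are never computed; repeated halving takes
  their place.\<close>

lemma rec_div_two: "rec_nat K (\<lambda>i r. r div 2) j = K div 2 ^ j" for K :: nat
proof (induction j)
  case (Suc j)
  then show ?case by (simp only: nat.rec power_Suc2 div_mult2_eq)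
qed simp

lemma nth_binary:
  "(j < length (binary K) \<longleftrightarrow> 2 ^ j \<le> K) \<and> (j < length (binary K) \<longrightarrow> binary K ! j = odd (K div 2 ^ j))"
proof (induction K arbitrary: j rule: less_induct)
  case (less K)
  show ?case
  proof (cases "K = 0")
    case False
    have b: "binary K = odd K # binary (K div 2)" using False by (simp add: binary.simps[of K])
    show ?thesis
    proof (cases j)
      case (Suc i)
      have "2 ^ i \<le> K div 2 \<longleftrightarrow> 2 ^ Suc i \<le> K" by (auto simp: less_eq_div_iff_mult_less_eq mult.commute)
      then show ?thesis using less.IH[of "K div 2" i] False by (simp add: b Suc div_mult2_eq)
    qed (use False in \<open>auto simp: b\<close>)
  qed (simp add: binary.simps)
qed

text \<open>The length is written as a sum over all \<open>j\<close> below \<open>K\<close>. This is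
  affordable because the reduction produces only polynomially bounded \<open>K\<close>.\<close>

lemma binary_conv_map: "binary K = map (\<lambda>j. odd (K div 2 ^ j)) [0..<\<Sum>j<K. of_bool (2 ^ j \<le> K)]"
proof -
  have "j < K" if "2 ^ j \<le> K" for j using less_le_trans[OF less_exp that] .
  then have "{..<K} \<inter> {j. 2 ^ j \<le> K} = {..<length (binary K)}" using nth_binary[of _ K] by auto
  then have "(\<Sum>j<K. of_bool (2 ^ j \<le> K)) = length (binary K)" by (simp add: of_bool_def sum.If_cases)
  then show ?thesis using nth_binary[of _ K] by (intro nth_equalityI) auto
qed

lemma adjacency_matrix_conv_map: "adjacency_matrix n E = map (\<lambda>k. {k div n, k mod n} \<in> E) [0..<n * n]"
proof -
  have "concat (map (\<lambda>i. map (\<lambda>j. {i, j} \<in> E) [0..<n]) [0..<m]) =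
      map (\<lambda>k. {k div n, k mod n} \<in> E) [0..<m * n]" for m
  proof (induction m)
    case (Suc m)
    have "map (\<lambda>j. {m, j} \<in> E) [0..<n] = map (\<lambda>k. {k div n, k mod n} \<in> E) [m * n..<m * n + n]"
      by (rule nth_equalityI) auto
    moreover have "[0..<Suc m * n] = [0..<m * n] @ [m * n..<m * n + n]"
      using upt_add_eq_append[of 0 "m * n" n] by (simp add: add.commute)
    ultimately show ?case using Suc by simp
  qed simp
  then show ?thesis by (simp add: adjacency_matrix_def)
qed

definition instance_bit :: "nat \<Rightarrow> (nat \<Rightarrow> nat \<Rightarrow> bool) \<Rightarrow> nat \<Rightarrow> nat \<Rightarrow> bool" where
  "instance_bit n adj K i = (if i < n then True else if i = n then False
     else if i < n + 1 + n * n then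
       adj ((i - (n + 1)) div n) ((i - (n + 1)) mod n) \<or> adj ((i - (n + 1)) mod n) ((i - (n + 1)) div n)
     else if i = n + 1 + n * n then False
     else odd (K div 2 ^ (i - (n + 1 + n * n + 1))))"

lemma map_upt_append: "map f [0..<a + b] = map f [0..<a] @ map (\<lambda>i. f (a + i)) [0..<b]"
  by (rule nth_equalityI) (auto simp: nth_append)

lemma encode_instance_conv_map:
  assumes "\<And>u v. u < n \<Longrightarrow> v < n \<Longrightarrow> {u, v} \<in> E \<longleftrightarrow> adj u v \<or> adj v u"
  shows "encode_instance n E (int K) =
    map (instance_bit n adj K) [0..<n + 1 + n * n + 1 + (\<Sum>j<K. of_bool (2 ^ j \<le> K))]"
proof -
  have "map (instance_bit n adj K) [0..<n] = replicate n True"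
    by (rule nth_equalityI) (auto simp: instance_bit_def)
  moreover have "map (\<lambda>i. instance_bit n adj K (n + 1 + i)) [0..<n * n] = adjacency_matrix n E"
  proof -
    have "0 < n" if "i < n * n" for i using that by (cases n) auto
    then show ?thesis unfolding adjacency_matrix_conv_map
      by (intro map_cong refl) (auto simp: instance_bit_def assms less_mult_imp_div_less)
  qed
  moreover have "map (\<lambda>i. instance_bit n adj K (n + 1 + n * n + 1 + i)) [0..<\<Sum>j<K. of_bool (2 ^ j \<le> K)] = binary K"
    by (subst binary_conv_map) (simp add: instance_bit_def)
  ultimately show ?thesis unfolding map_upt_append
    by (simp add: encode_instance_def instance_bit_def)
qed

lemma feasible_div_two_power:
  assumes "feasible m K" "feasible m J"
  shows "feasible m (\<lambda>ws e. K ws e div 2 ^ J ws e)"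
proof -
  have "feasible m (\<lambda>ws e. rec_nat (K ws e) (\<lambda>i r. r div 2) (J ws e))"
    by (rule feasible_rec[OF assms(2,1) _ feasible_growth[OF assms(1)]],
        rule feasible_div[OF feasible_var feasible_const], simp add: rec_div_two)
  then show ?thesis unfolding rec_div_two .
qed

lemma feasible_two_power_le:
  assumes "feasible m K" "feasible m J"
  shows "feasible_pred m (\<lambda>ws e. 2 ^ J ws e \<le> K ws e)"
proof -
  have "2 ^ j \<le> k \<longleftrightarrow> 1 \<le> k div 2 ^ j" for j k :: nat by (simp add: less_eq_div_iff_mult_less_eq)
  then show ?thesis using feasible_le[OF feasible_const feasible_div_two_power[OF assms], of 1] by simp
qed

lemma feasible_digit: "feasible m D \<Longrightarrow> feasible m x \<Longrightarrow> feasible m (\<lambda>ws e. digit (D ws e) k (x ws e))"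
  by (induction k arbitrary: x) (auto intro: feasible_mod feasible_div)

lemma polytime_computable_encode_instance:
  assumes n: "feasible m (\<lambda>ws e. n ws)" and K: "feasible m (\<lambda>ws e. K ws)"
    and adj: "\<And>u v. feasible m u \<Longrightarrow> feasible m v \<Longrightarrow> feasible_pred m (\<lambda>ws e. adj ws (u ws e) (v ws e))"
    and E: "\<And>ws u v. u < n ws \<Longrightarrow> v < n ws \<Longrightarrow> {u, v} \<in> E ws \<longleftrightarrow> adj ws u v \<or> adj ws v u"
  shows "polytime_computable m (\<lambda>ws. encode_instance (n ws) (E ws) (int (K ws)))"
proof -
  have "feasible m (\<lambda>ws e. n ws + 1 + n ws * n ws + 1 + (\<Sum>j<K ws. of_bool (2 ^ j \<le> K ws)))"
    by (intro feasible_intros feasible_two_power_le n K)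
  moreover have "feasible_pred m (\<lambda>ws e. instance_bit (n ws) (adj ws) (K ws) (e 0))"
    unfolding instance_bit_def if_bool_eq_conj
    by (intro feasible_intros feasible_div_two_power adj n K)
  ultimately have "polytime_computable m (\<lambda>ws. map (instance_bit (n ws) (adj ws) (K ws))
      [0..<n ws + 1 + n ws * n ws + 1 + (\<Sum>j<K ws. of_bool (2 ^ j \<le> K ws))])"
    by (rule polytime_computable_map)
  then show ?thesis by (simp only: encode_instance_conv_map[OF E])
qed

lemma feasible_vertex_kind:
  assumes "feasible m M" "feasible m v"
  shows "feasible_pred m (\<lambda>ws e. vertex_kind (M ws e) (v ws e) = k)"
  unfolding vertex_kind_def if_distrib[of "\<lambda>z. z = k"] if_bool_eq_conj
  by (intro feasible_intros assms)

lemma feasible_cover_adj: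
  assumes "feasible m (\<lambda>ws e. M ws)" "feasible m u" "feasible m v"
    and "\<And>c l. feasible m c \<Longrightarrow> feasible m l \<Longrightarrow> feasible_pred m (\<lambda>ws e. sat ws (c ws e) (l ws e))"
  shows "feasible_pred m (\<lambda>ws e. cover_adj (M ws) (sat ws) (u ws e) (v ws e))"
  unfolding cover_adj_def arc_def kind_edge_def
  by (intro feasible_conj feasible_disj feasible_vertex_kind assms feasible_diff)

context tableau
begin

lemma feasible_table: "feasible m z \<Longrightarrow> feasible m (\<lambda>ws e. table f (z ws e))"
  unfolding table_def by (intro feasible_cases feasible_const)

lemma feasible_table2: "feasible m z \<Longrightarrow> feasible m j \<Longrightarrow> feasible m (\<lambda>ws e. table2 f (z ws e) (j ws e))"
  unfolding table2_def
  by (intro feasible_cases[where A = "\<lambda>x ws e. if j ws e < ntapes M then f x (j ws e) else 0"]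
      feasible_cases[where A = "\<lambda>y ws e. f _ y"] feasible_const)

lemma feasible_clause_sat:
  assumes "0 < m" "feasible m W" "feasible m Q" "feasible m T" "feasible m D" "feasible m c" "feasible m l"
  shows "feasible_pred m (\<lambda>ws e. clause_sat (ws ! 0) (W ws e) (Q ws e) (T ws e) (D ws e) (c ws e) (l ws e))"
proof -
  have sat: "feasible_pred m (\<lambda>ws e. sat (ws ! 0) (W ws e) (Q ws e) (T ws e) (k ws e) (f1 ws e) (f2 ws e) (f3 ws e)
      (f4 ws e) (f5 ws e) (v ws e) (j ws e) (t ws e) (i ws e) (a ws e))"
    if "feasible m k" "feasible m f1" "feasible m f2" "feasible m f3" "feasible m f4" "feasible m f5"
      "feasible m v" "feasible m j" "feasible m t" "feasible m i" "feasible m a"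
    for k f1 f2 f3 f4 f5 v j t i a
    \<comment> \<open>Conditionals between truth values become conjunctions of implications, to
      which the closure rules apply.\<close>
    unfolding sat_def init_symbol_def symbol_at_def if_bool_eq_conj
    by (intro feasible_intros feasible_table feasible_table2 assms that)
  show ?thesis unfolding clause_sat_def by (intro sat feasible_digit assms)
qed

end

lemma poly_nat_mono: "a \<le> b \<Longrightarrow> poly p a \<le> poly p b" for p :: "nat poly"
  by (induction p) (auto intro: add_mono mult_mono)

lemma polytime_computable_2_reducible:
  fixes R :: "bool list \<Rightarrow> bool list \<Rightarrow> bool" and q :: "nat poly"
  assumes R: "polytime_computable 2 (\<lambda>ws. [R (ws ! 0) (ws ! 1)])"
    and L: "\<And>x. x \<in> L \<longleftrightarrow> (\<exists>y. length y \<le> poly q (length x) \<and> R x y)"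
  shows "polytime_reducible L BIPARTITE_STRONG_GEODETIC_SET"
proof -
  obtain M and p :: "nat poly" where M: "wf_tm M" "2 \<le> ntapes M"
    and halts: "\<And>ws. length ws = 2 \<Longrightarrow>
      halts_with M ws (poly p (sum_list (map length ws))) [R (ws ! 0) (ws ! 1)]"
    using R unfolding polytime_computable_def by blast
  have "finite ({..<nstates M} \<times> {ss. set ss \<subseteq> {..<nsyms M} \<and> length ss = ntapes M})"
    by (intro finite_cartesian_product finite_lists_length_eq) auto
  then have "finite {(q, ss). q < nstates M \<and> length ss = ntapes M \<and> set ss \<subseteq> {..<nsyms M}}"
    by (rule finite_subset[rotated]) auto
  from finite_list[OF this]
  obtain zs where zs: "set zs = {(q, ss). q < nstates M \<and> length ss = ntapes M \<and> set ss \<subseteq> {..<nsyms M}}" ..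
  interpret tableau M zs by unfold_locales (use M zs in auto)
  \<comment> \<open>\<open>T\<close> bounds the running time for all certificates of length at most
    \<open>Q\<close>, since polynomials over the naturals are monotone. \<open>W\<close> and
    \<open>D\<close> are chosen to make \<open>large\<close> hold; the machine enters
    \<open>D\<close> only through additive constants.\<close>
  define Q where "Q x = poly q (length x)" for x :: "bool list"
  define T where "T x = poly p (length x + Q x)" for x
  define W where "W x = T x + Q x + 1" for x
  define D where "D x = 2 * W x + (11 + ntapes M + length zs + nsyms M)" for x
  have large: "large (W x) (Q x) (T x) (D x)" for x by (simp add: large_def W_def D_def)
  let ?sat = "\<lambda>x. clause_sat x (W x) (Q x) (T x) (D x)"
  \<comment> \<open>With \<open>D ^ 6\<close> literals and clauses there are
    \<open>3 * D ^ 6\<close> pendants; the remaining budget \<open>D ^ 4\<close> is the number of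
    variables.\<close>
  define f where "f x = encode_instance (5 * D x ^ 6 + 3) (cover_edges (D x ^ 6) (?sat x))
    (int (D x ^ 4 + 3 * D x ^ 6))" for x
  \<comment> \<open>The machine may halt before time \<open>T x\<close>; its output then
    persists.\<close>
  have accept: "cell x y (ntapes M - 1) (T x) 0 = 2 \<longleftrightarrow> R x y" if y: "length y \<le> Q x" for x y
  proof -
    define t where "t = poly p (length x + length y)"
    have t: "t \<le> T x" unfolding t_def T_def using y by (intro poly_nat_mono) simp
    have h: "fst (cfg x y t) = halt M" "fst (last (snd (cfg x y t))) = word_contents [R x y]"
      using halts[of "[x, y]"] by (auto simp: halts_with_def cfg_def t_def Let_def)
    have "step M (cfg x y t) = cfg x y t" using h(1) by (simp add: step_def)
    then have "(step M ^^ (T x - t)) (cfg x y t) = cfg x y t" by (rule funpow_fixpoint)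
    then have "cfg x y (T x) = cfg x y t"
      using funpow_step_trans[of t "step M" "init_config M [x, y]" "cfg x y t" "T x - t"] t by (simp add: cfg_def)
    moreover have "length (snd (cfg x y t)) = ntapes M" using valid_cfg by (simp add: valid_def)
    moreover have "snd (cfg x y t) \<noteq> []" using calculation(2) M(2) by auto
    ultimately have "cell x y (ntapes M - 1) (T x) = word_contents [R x y]"
      using h(2) by (simp add: cell_def last_conv_nth)
    then show ?thesis by (simp add: word_contents_def)
  qed
  have "x \<in> L \<longleftrightarrow> f x \<in> BIPARTITE_STRONG_GEODETIC_SET" for x
  proof -
    have "f x \<in> BIPARTITE_STRONG_GEODETIC_SET \<longleftrightarrow> (\<exists>S. S \<subseteq> {..<D x ^ 6} \<and> card S \<le> D x ^ 4 \<and>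
        (\<forall>c<D x ^ 6. \<exists>l\<in>S. ?sat x c l))"
      unfolding f_def
      by (rule cover_iff_strong_geodetic) (use clause_sat_exists[OF large] in \<open>auto simp: D_def\<close>)
    also have "\<dots> \<longleftrightarrow> (\<exists>A. satisfying x (W x) (Q x) (T x) (D x) A \<and> (\<forall>v j t i. A v j t i < D x))"
      by (rule cover_iff_satisfying[OF large])
    also have "\<dots> \<longleftrightarrow> (\<exists>y. length y \<le> Q x \<and> cell x y (ntapes M - 1) (T x) 0 = 2)"
      using satisfying_imp_run[OF _ _ large] run_imp_satisfying[OF _ _ large] by blast
    also have "\<dots> \<longleftrightarrow> x \<in> L" using accept L by (auto simp: Q_def)
    finally show ?thesis by simp
  qed
  moreover have "polytime_computable 1 (\<lambda>ws. f (ws ! 0))"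
    unfolding f_def
  proof (rule polytime_computable_encode_instance[where adj = "\<lambda>ws. cover_adj (D (ws ! 0) ^ 6) (?sat (ws ! 0))"])
    have Q: "feasible 1 (\<lambda>ws e. Q (ws ! 0))" unfolding Q_def by (intro feasible_intros) simp
    have T: "feasible 1 (\<lambda>ws e. T (ws ! 0))" unfolding T_def by (intro feasible_intros Q) simp
    have W: "feasible 1 (\<lambda>ws e. W (ws ! 0))" unfolding W_def by (intro feasible_intros Q T)
    have D: "feasible 1 (\<lambda>ws e. D (ws ! 0))" unfolding D_def by (intro feasible_intros W)
    show "feasible 1 (\<lambda>ws e. 5 * D (ws ! 0) ^ 6 + 3)" "feasible 1 (\<lambda>ws e. D (ws ! 0) ^ 4 + 3 * D (ws ! 0) ^ 6)"
      by (intro feasible_intros D)+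
    show "feasible_pred 1 (\<lambda>ws e. cover_adj (D (ws ! 0) ^ 6) (?sat (ws ! 0)) (u ws e) (v ws e))"
      if "feasible 1 u" "feasible 1 v" for u v
      by (intro feasible_cover_adj feasible_clause_sat that feasible_power Q T W D) auto
  qed (simp add: cover_edges_iff)
  ultimately show ?thesis unfolding polytime_reducible_def by blast
qed

theorem NP_hard_BIPARTITE_STRONG_GEODETIC_SET: "NP_hard BIPARTITE_STRONG_GEODETIC_SET"
  unfolding NP_hard_def in_NP_def using polytime_computable_2_reducible by blast

section \<open>Membership in NP\<close>

text \<open>A certificate \<open>y\<close> holds numbers below \<open>n + 1\<close>, each written in unary in \<open>n\<close> bits.\<close>

definition entry :: "bool list \<Rightarrow> nat \<Rightarrow> nat \<Rightarrow> nat \<Rightarrow> nat \<Rightarrow> nat \<Rightarrow> nat" where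
  "entry y n k a b c = (\<Sum>v<n. of_bool (bit_at y ((((k * Suc n + a) * Suc n + b) * Suc n + c) * Suc n + v)))"

lemma feasible_entry:
  assumes "j < m" "feasible m n" "feasible m k" "feasible m a" "feasible m b" "feasible m c"
  shows "feasible m (\<lambda>ws e. entry (ws ! j) (n ws e) (k ws e) (a ws e) (b ws e) (c ws e))"
  unfolding entry_def by (intro feasible_intros feasible_shift1 assms)

text \<open>The length comes from five tags, three indices below \<open>n + 1\<close> and blocks of
  \<open>n + 1\<close> bits. A value is stored as that many set bits at the start of its block, and
  \<open>entry\<close> counts them.\<close>

lemma certificate_exists:
  assumes "\<And>k a b c. G k a b c \<le> n"
  shows "\<exists>y. length y = 5 * Suc n ^ 4 \<and>
    (\<forall>k<5. \<forall>a\<le>n. \<forall>b\<le>n. \<forall>c\<le>n. entry y n k a b c = G k a b c)"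
proof (intro exI conjI allI impI)
  let ?b = "Suc n"
  let ?y = "map (\<lambda>i. i mod ?b < G (i div ?b div ?b div ?b div ?b) (digit ?b 3 i) (digit ?b 2 i) (digit ?b 1 i))
    [0..<5 * ?b ^ 4]"
  show "length ?y = 5 * ?b ^ 4" by simp
  fix k a b c :: nat assume k: "k < 5" and abc: "a \<le> n" "b \<le> n" "c \<le> n"
  have "bit_at ?y ((((k * ?b + a) * ?b + b) * ?b + c) * ?b + v) \<longleftrightarrow> v < G k a b c" if v: "v < n" for v
  proof -
    have lt: "x * ?b + u < z * ?b" if "x < z" "u \<le> n" for x u z
    proof -
      have "x * ?b + u < Suc x * ?b" using that by simp
      also have "\<dots> \<le> z * ?b" using that by (intro mult_le_mono1) simp
      finally show ?thesis .
    qed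
    have "(((k * ?b + a) * ?b + b) * ?b + c) * ?b + v < 5 * ?b * ?b * ?b * ?b"
      using k abc v by (intro lt) auto
    also have "\<dots> = 5 * ?b ^ 4" by (simp only: power4_eq_xxxx mult.assoc)
    finally have "(((k * ?b + a) * ?b + b) * ?b + c) * ?b + v < 5 * ?b ^ 4" .
    moreover have "v < ?b" "c < ?b" "b < ?b" "a < ?b" using abc v by auto
    \<comment> \<open>Division with remainder by \<open>n + 1\<close> peels the indices off a bit
      position one by one.\<close>
    moreover have d: "(x * ?b + u) div ?b = x" "(x * ?b + u) mod ?b = u" if "u < ?b" for x u
      using that by (auto simp: div_add1_eq simp del: mult_Suc_right)
    ultimately show ?thesis
      by (simp add: bit_at_def numeral_eq_Suc d del: mult_Suc_right power_Suc mult_Suc)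
  qed
  then have "entry ?y n k a b c = (\<Sum>v<n. of_bool (v < G k a b c))"
    unfolding entry_def by (intro sum.cong refl arg_cong[where f = of_bool]) auto
  also have "\<dots> = card ({..<n} \<inter> {v. v < G k a b c})" by (simp add: of_bool_def sum.If_cases)
  also have "{..<n} \<inter> {v. v < G k a b c} = {..<G k a b c}" using assms[of k a b c] by auto
  finally show "entry ?y n k a b c = G k a b c" by simp
qed

definition edge_bit :: "bool list \<Rightarrow> nat \<Rightarrow> nat \<Rightarrow> nat \<Rightarrow> bool" where
  "edge_bit x n u v \<longleftrightarrow> bit_at x (n + 1 + (u * n + v))"

text \<open>These are the encodings of simple graphs with a nonnegative number; a negative one
  cannot bound a cardinality. The final condition excludes leading zeros, as the last bit is the
  most significant one.\<close>

definition well_formed :: "bool list \<Rightarrow> nat \<Rightarrow> bool" where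
  "well_formed x n \<longleftrightarrow> (\<forall>i<n. bit_at x i) \<and> \<not> bit_at x n \<and> n + 1 + n * n + 1 \<le> length x \<and>
     \<not> bit_at x (n + 1 + n * n) \<and> (\<forall>u<n. \<not> edge_bit x n u u) \<and>
     (\<forall>u<n. \<forall>v<n. edge_bit x n u v \<longrightarrow> edge_bit x n v u) \<and>
     (length x = n + 1 + n * n + 1 \<or> bit_at x (length x - 1))"

text \<open>The number \<open>k\<close> of the instance, capped at \<open>n\<close> because it may be exponentially large.\<close>

definition capped_number :: "bool list \<Rightarrow> nat \<Rightarrow> nat" where
  "capped_number x n = rec_nat 0 (\<lambda>i r. min n (2 * r + of_bool (bit_at x (length x - 1 - i))))
     (length x - (n + 1 + n * n + 1))"

text \<open>The tags 0 to 4 stand for the set \<open>S\<close>, a bipartition, the lengths of the selected paths,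
  the distances and the vertices of the selected paths.\<close>

definition selected :: "bool list \<Rightarrow> nat \<Rightarrow> nat \<Rightarrow> bool" where
  "selected y n v \<longleftrightarrow> 0 < entry y n 0 v 0 0"

text \<open>The function with tag 3 and source \<open>a\<close> is a potential: it is 0 at
  \<open>a\<close> and grows by at most 1 along each edge, so its value at \<open>b\<close> is a
  lower bound for the length of every path, which the selected path attains.\<close>

definition path_ok :: "bool list \<Rightarrow> bool list \<Rightarrow> nat \<Rightarrow> nat \<Rightarrow> nat \<Rightarrow> bool" where
  "path_ok x y n a b \<longleftrightarrow>
     entry y n 4 a b 0 = a \<and> entry y n 4 a b (entry y n 2 a b 0) = b \<and>
     (\<forall>t<entry y n 2 a b 0. edge_bit x n (entry y n 4 a b t) (entry y n 4 a b (Suc t))) \<and>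
     (\<forall>t<Suc (entry y n 2 a b 0). entry y n 4 a b t < n) \<and>
     (\<forall>t<Suc (entry y n 2 a b 0). \<forall>s<t. entry y n 4 a b s \<noteq> entry y n 4 a b t) \<and>
     entry y n 3 a a 0 = 0 \<and>
     (\<forall>u<n. \<forall>v<n. edge_bit x n u v \<longrightarrow> entry y n 3 a v 0 \<le> entry y n 3 a u 0 + 1) \<and>
     entry y n 3 a b 0 = entry y n 2 a b 0"

text \<open>The condition \<open>a < b\<close> yields one path for each unordered pair. The graph
  with a single vertex is treated apart, as in \<open>strong_geodetic_set\<close>.\<close>

definition certifies :: "bool list \<Rightarrow> bool list \<Rightarrow> nat \<Rightarrow> bool" where
  "certifies x y n \<longleftrightarrow> well_formed x n \<and>
     (\<forall>u<n. \<forall>v<n. edge_bit x n u v \<longrightarrow> (0 < entry y n 1 u 0 0 \<longleftrightarrow> \<not> 0 < entry y n 1 v 0 0)) \<and>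
     (\<Sum>v<n. of_bool (selected y n v)) \<le> capped_number x n \<and>
     (n = 1 \<and> selected y n 0 \<or> n \<noteq> 1 \<and>
       (\<forall>a<n. \<forall>b<n. a < b \<and> selected y n a \<and> selected y n b \<longrightarrow> path_ok x y n a b) \<and>
       (\<forall>v<n. \<exists>a<n. \<exists>b<n. a < b \<and> selected y n a \<and> selected y n b \<and>
         (\<exists>t<Suc (entry y n 2 a b 0). entry y n 4 a b t = v)))"

section \<open>Feasibility of checking a certificate\<close>

lemma feasible_capped_number:
  assumes "0 < m" "feasible m n"
  shows "feasible m (\<lambda>ws e. capped_number (ws ! 0) (n ws e))"
  unfolding capped_number_def
proof (rule feasible_rec)
  show "feasible m (\<lambda>ws e. min (n ws (\<lambda>i. e (Suc (Suc i))))
      (2 * e 0 + of_bool (bit_at (ws ! 0) (length (ws ! 0) - 1 - e (Suc 0)))))"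
    unfolding min_def by (intro feasible_intros feasible_shift2 assms)
  show "rec_nat 0 (\<lambda>i r. min (n ws e) (2 * r + of_bool (bit_at (ws ! 0) (length (ws ! 0) - 1 - i)))) j \<le> n ws e"
    for ws e j
    by (cases j) auto
qed (intro feasible_intros assms feasible_growth)+

lemma feasible_edge_bit:
  assumes "0 < m" "feasible m n" "feasible m u" "feasible m v"
  shows "feasible_pred m (\<lambda>ws e. edge_bit (ws ! 0) (n ws e) (u ws e) (v ws e))"
  unfolding edge_bit_def by (intro feasible_intros assms)

lemma feasible_selected:
  assumes "1 < m" "feasible m n" "feasible m v"
  shows "feasible_pred m (\<lambda>ws e. selected (ws ! 1) (n ws e) (v ws e))"
  unfolding selected_def by (intro feasible_intros feasible_entry assms)

lemma feasible_path_ok: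
  assumes "1 < m" "feasible m n" "feasible m a" "feasible m b"
  shows "feasible_pred m (\<lambda>ws e. path_ok (ws ! 0) (ws ! 1) (n ws e) (a ws e) (b ws e))"
proof -
  have m: "0 < m" using assms(1) by simp
  show ?thesis unfolding path_ok_def
    by (intro feasible_intros feasible_entry feasible_edge_bit feasible_shift1 feasible_shift2 assms m)
qed

lemma feasible_certifies:
  assumes "1 < m" "feasible m n"
  shows "feasible_pred m (\<lambda>ws e. certifies (ws ! 0) (ws ! 1) (n ws e))"
proof -
  have m: "0 < m" using assms(1) by simp
  show ?thesis unfolding certifies_def well_formed_def
    by (intro feasible_intros feasible_entry feasible_edge_bit feasible_selected feasible_path_ok
        feasible_capped_number feasible_shift1 feasible_shift2 assms m)
qed

section \<open>Encoding and decoding of instances\<close>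

lemma bit_at_append: "bit_at (xs @ ys) i \<longleftrightarrow> (if i < length xs then bit_at xs i else bit_at ys (i - length xs))"
  by (auto simp: bit_at_def nth_append)

lemma bit_at_Cons: "bit_at (b # xs) 0 = b" "bit_at (b # xs) (Suc i) = bit_at xs i"
  by (auto simp: bit_at_def)

lemma binary_exists: "bs = [] \<or> last bs \<Longrightarrow> \<exists>K. binary K = bs"
proof (induction bs)
  case Nil
  then show ?case by (intro exI[of _ 0]) (simp add: binary.simps)
next
  case (Cons b bs)
  show ?case
  proof (cases "bs = []")
    case True
    then show ?thesis using Cons.prems by (intro exI[of _ 1]) (simp add: binary.simps)
  next
    case False
    then obtain K where K: "binary K = bs" using Cons by auto
    have "binary 0 = []" by (subst binary.simps) simp
    then have "K \<noteq> 0" using False K by (cases "K = 0") auto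
    then show ?thesis using K
      by (intro exI[of _ "2 * K + of_bool b"]) (simp add: binary.simps[of "2 * K + of_bool b"])
  qed
qed

lemma last_binary: "K \<noteq> 0 \<Longrightarrow> binary K \<noteq> [] \<and> last (binary K)"
proof (induction K rule: less_induct)
  case (less K)
  show ?case
  proof (cases "K = 1")
    case True
    then show ?thesis by (simp add: binary.simps)
  next
    case False
    then have "K div 2 \<noteq> 0" using less.prems by auto
    then show ?thesis using less.IH[of "K div 2"] less.prems by (simp add: binary.simps[of K])
  qed
qed

text \<open>Horner's rule from the most significant bit. Capping in every round is harmless because
  \<open>min n (2 * min n z + b) = min n (2 * z + b)\<close>.\<close>

lemma capped_number_eq:
  assumes len: "length x = n + 1 + n * n + 1 + B" and K: "K < 2 ^ B"
    and bits: "\<And>j. j < B \<Longrightarrow> bit_at x (n + 1 + n * n + 1 + j) \<longleftrightarrow> odd (K div 2 ^ j)"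
  shows "capped_number x n = min n K"
proof -
  have "rec_nat 0 (\<lambda>i r. min n (2 * r + of_bool (bit_at x (length x - 1 - i)))) i = min n (K div 2 ^ (B - i))"
    if "i \<le> B" for i
    using that
  proof (induction i)
    case (Suc i)
    define z where "z = K div 2 ^ (B - Suc i)"
    have "length x - 1 - i = n + 1 + n * n + 1 + (B - Suc i)" using Suc.prems len by auto
    then have bit: "bit_at x (length x - 1 - i) \<longleftrightarrow> odd z" using bits[of "B - Suc i"] Suc.prems by (simp add: z_def)
    have "K div 2 ^ (B - i) = z div 2"
      using Suc.prems by (simp add: z_def Suc_diff_Suc flip: div_mult2_eq power_Suc2)
    moreover have "min n (2 * min n (z div 2) + of_bool (odd z)) = min n z"
      by (cases "odd z") (auto simp: min_def elim!: oddE evenE)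
    moreover have "rec_nat 0 (\<lambda>i r. min n (2 * r + of_bool (bit_at x (length x - 1 - i)))) i = min n (K div 2 ^ (B - i))"
      using Suc by simp
    ultimately show ?case by (simp only: nat.rec bit) (simp only: z_def)
  qed (use K in simp)
  from this[of B] show ?thesis by (simp add: capped_number_def len)
qed

lemma well_formed_encode_instance:
  assumes g: "simple_graph {..<n} E" and x: "x = encode_instance n E (int K)"
  shows "well_formed x n" "\<And>u v. u < n \<Longrightarrow> v < n \<Longrightarrow> edge_bit x n u v \<longleftrightarrow> {u, v} \<in> E"
    "capped_number x n = min n K" "n < length x"
proof -
  have x': "x = replicate n True @ [False] @ adjacency_matrix n E @ [False] @ binary K"
    by (simp add: x encode_instance_def)
  have len: "length x = n + 1 + n * n + 1 + length (binary K)" by (simp add: x')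
  have bin: "bit_at x (n + 1 + n * n + 1 + j) \<longleftrightarrow> bit_at (binary K) j" for j
    by (simp add: x' bit_at_append bit_at_Cons)
  show E: "edge_bit x n u v \<longleftrightarrow> {u, v} \<in> E" if "u < n" "v < n" for u v
  proof -
    have "u * n + v < Suc u * n" using that by simp
    also have "\<dots> \<le> n * n" using that by (intro mult_le_mono1) simp
    finally have uv: "u * n + v < n * n" .
    then have "edge_bit x n u v \<longleftrightarrow> adjacency_matrix n E ! (u * n + v)"
      by (simp add: edge_bit_def x' bit_at_append bit_at_Cons) (simp add: bit_at_def)
    also have "\<dots> \<longleftrightarrow> {u, v} \<in> E" using uv that by (simp add: adjacency_matrix_conv_map)
    finally show ?thesis .
  qed
  have "{u} \<notin> E" for u using g by (auto simp: simple_graph_def)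
  moreover have "length x = n + 1 + n * n + 1 \<or> bit_at x (length x - 1)"
  proof (cases "K = 0")
    case False
    then have "binary K \<noteq> []" "bit_at (binary K) (length (binary K) - 1)"
      using last_binary[of K] by (auto simp: bit_at_def last_conv_nth)
    moreover from this(1) have "length x - 1 = n + 1 + n * n + 1 + (length (binary K) - 1)"
      unfolding len by (cases "binary K") auto
    ultimately show ?thesis using bin[of "length (binary K) - 1"] by simp
  qed (simp add: len binary.simps)
  moreover have "\<forall>i<n. bit_at x i" "\<not> bit_at x n" "\<not> bit_at x (n + 1 + n * n)"
    by (auto simp: x' bit_at_append bit_at_Cons) (auto simp: bit_at_def)
  ultimately show "well_formed x n" unfolding well_formed_def
    using E len by (simp add: insert_commute)
  have "\<not> 2 ^ length (binary K) \<le> K" using nth_binary[of "length (binary K)" K] by auto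
  then show "capped_number x n = min n K"
    using nth_binary[of _ K] bin by (intro capped_number_eq[OF len]) (auto simp: bit_at_def)
  show "n < length x" using len by simp
qed

text \<open>Converse of \<open>well_formed_encode_instance\<close>. The number is recovered from the
  bits behind the sign, and the symmetry of the matrix makes it agree with the symmetrised bits of
  \<open>instance_bit\<close>.\<close>

lemma well_formed_decode:
  assumes wf: "well_formed x n"
  obtains E K where "E = {{u, v} | u v. u < n \<and> v < n \<and> edge_bit x n u v}" "simple_graph {..<n} E"
    "x = encode_instance n E (int K)"
proof -
  define E where "E = {{u, v} | u v. u < n \<and> v < n \<and> edge_bit x n u v}"
  define c where "c = n + 1 + n * n + 1"
  have c: "c \<le> length x" using wf by (simp add: well_formed_def c_def)
  have "drop c x = [] \<or> last (drop c x)"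
  proof (cases "length x = c")
    case False
    moreover have "length x = c \<or> bit_at x (length x - 1)" using wf unfolding well_formed_def c_def by blast
    ultimately have x: "bit_at x (length x - 1)" by blast
    then have "x \<noteq> []" by (auto simp: bit_at_def)
    moreover have "x ! (length x - 1)" using x by (simp add: bit_at_def)
    ultimately have "last x" by (simp add: last_conv_nth)
    moreover have "c < length x" using c False by simp
    ultimately show ?thesis by (simp add: last_drop)
  qed simp
  then obtain K where K: "binary K = drop c x" using binary_exists by blast
  have E: "{u, v} \<in> E \<longleftrightarrow> edge_bit x n u v \<or> edge_bit x n v u" if "u < n" "v < n" for u v
    using that unfolding E_def by (auto simp: doubleton_eq_iff)
  have "simple_graph {..<n} E"
    unfolding simple_graph_def
  proof (intro conjI ballI)
    fix e assume "e \<in> E"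
    then obtain u v where e: "e = {u, v}" "u < n" "v < n" "edge_bit x n u v" unfolding E_def by blast
    moreover have "u \<noteq> v" using e wf unfolding well_formed_def by blast
    ultimately show "e \<subseteq> {..<n}" "card e = 2" by auto
  qed simp
  moreover have "x = encode_instance n E (int K)"
  proof (rule nth_equalityI)
    have lenK: "(\<Sum>j<K. of_bool (2 ^ j \<le> K)) = length x - c"
      using arg_cong[OF binary_conv_map, of length K] K by simp
    have enc: "encode_instance n E (int K) = map (instance_bit n (edge_bit x n) K) [0..<length x]"
    proof -
      have "n + 1 + n * n + 1 + (\<Sum>j<K. of_bool (2 ^ j \<le> K)) = length x" using c unfolding lenK c_def by simp
      then show ?thesis using encode_instance_conv_map[of n E "edge_bit x n" K] E by (simp only:)
    qed
    show "length x = length (encode_instance n E (int K))" by (simp add: enc)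
    fix i assume i: "i < length x"
    have "instance_bit n (edge_bit x n) K i = x ! i"
    proof -
      have "i < n \<or> i = n \<or> n + 1 \<le> i \<and> i < n + 1 + n * n \<or> i = n + 1 + n * n \<or> c \<le> i"
        unfolding c_def by linarith
      then consider "i < n" | "i = n" | "n + 1 \<le> i" "i < n + 1 + n * n" | "i = n + 1 + n * n" | "c \<le> i" by blast
      then show ?thesis
      proof cases
        case 3
        define k where "k = i - (n + 1)"
        have k: "i = n + 1 + k" "k < n * n" using 3 by (auto simp: k_def)
        then have n: "0 < n" by (cases n) auto
        have uv: "k div n < n" "k mod n < n" using k(2) n by (auto simp: less_mult_imp_div_less)
        then have "edge_bit x n (k div n) (k mod n) \<or> edge_bit x n (k mod n) (k div n) \<longleftrightarrow>
            edge_bit x n (k div n) (k mod n)" using wf unfolding well_formed_def by blast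
        also have "\<dots> \<longleftrightarrow> x ! i" using i by (simp add: edge_bit_def bit_at_def k(1))
        finally show ?thesis using 3 by (simp add: instance_bit_def k_def)
      next
        case 5
        define j where "j = i - c"
        have j: "i = c + j" using 5 by (simp add: j_def)
        then have "j < length x - c" using i by simp
        then have "odd (K div 2 ^ j) \<longleftrightarrow> x ! i" using nth_binary[of j K] c by (simp add: K j)
        then show ?thesis using 5 by (simp add: instance_bit_def c_def j_def)
      qed (use wf i in \<open>auto simp: well_formed_def instance_bit_def bit_at_def\<close>)
    qed
    then show "x ! i = encode_instance n E (int K) ! i" using i by (simp add: enc)
  qed
  ultimately show ?thesis using that E_def by blast
qed

section \<open>Correctness of certificates\<close>

lemma walk_potential:
  fixes d :: "'a \<Rightarrow> nat"
  assumes "walk V E q" "\<And>u v. u \<in> V \<Longrightarrow> v \<in> V \<Longrightarrow> {u, v} \<in> E \<Longrightarrow> d v \<le> d u + 1"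
  shows "d (last q) + 1 \<le> d (hd q) + length q \<and> d (hd q) + 1 \<le> d (last q) + length q"
  using assms(1)
proof (induction q rule: rev_induct)
  case (snoc v q)
  show ?case
  proof (cases "q = []")
    case False
    then have "walk V E q" "{last q, v} \<in> E" "last q \<in> V" "v \<in> V" "{v, last q} \<in> E"
      using snoc.prems last_in_set[of q] by (auto simp: walk_def successively_append_iff insert_commute)
    then show ?thesis using snoc.IH assms(2)[of "last q" v] assms(2)[of v "last q"] False by simp
  qed simp
qed (simp add: walk_def)

lemma certifies_imp_instance:
  assumes cert: "certifies x y n"
  shows "x \<in> BIPARTITE_STRONG_GEODETIC_SET"
proof -
  have wf: "well_formed x n" using cert by (simp add: certifies_def)
  obtain E K where E_def: "E = {{u, v} | u v. u < n \<and> v < n \<and> edge_bit x n u v}"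
    and g: "simple_graph {..<n} E" and x: "x = encode_instance n E (int K)"
    by (rule well_formed_decode[OF wf])
  note enc = well_formed_encode_instance[OF g x]
  have bip: "bipartite {..<n} E"
  proof (rule bipartiteI)
    let ?A = "{v. v < n \<and> 0 < entry y n 1 v 0 0}"
    show "?A \<subseteq> {..<n}" by auto
    fix e assume "e \<in> E"
    then obtain u v where e: "e = {u, v}" "u < n" "v < n" "edge_bit x n u v" unfolding E_def by blast
    then have "0 < entry y n 1 u 0 0 \<longleftrightarrow> \<not> 0 < entry y n 1 v 0 0" using cert unfolding certifies_def by blast
    then show "\<exists>u v. e = {u, v} \<and> u \<in> {..<n} \<and> v \<in> {..<n} \<and> (u \<in> ?A \<longleftrightarrow> v \<notin> ?A)"
      using e by (intro exI[of _ u] exI[of _ v]) simp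
  qed
  define S where "S = {v. v < n \<and> selected y n v}"
  have "card S = (\<Sum>v<n. of_bool (selected y n v))"
    by (simp add: S_def of_bool_def sum.If_cases Int_def lessThan_def)
  then have card: "int (card S) \<le> int K" using cert enc(3) by (simp add: certifies_def)
  have "strong_geodetic_set {..<n} E S"
  proof (cases "n = 1")
    case True
    then have "S = {..<n}" using cert by (auto simp: S_def certifies_def)
    then show ?thesis using True by (simp add: strong_geodetic_set_def)
  next
    case False
    let ?p = "\<lambda>a b. map (entry y n 4 a b) [0..<Suc (entry y n 2 a b 0)]"
    \<comment> \<open>\<open>Min\<close> and \<open>Max\<close> recover the ordered pair from the
      set, so the selection depends on the set alone.\<close>
    define f where "f e = ?p (Min e) (Max e)" for e
    have f: "f {a, b} = ?p a b" if "a < b" for a b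
      using that by (simp add: f_def min_def max_def)
    have path: "shortest_path_between {..<n} E a b (?p a b)" if ab: "a \<in> S" "b \<in> S" "a < b" for a b
    proof -
      let ?l = "entry y n 2 a b 0" and ?d = "\<lambda>v. entry y n 3 a v 0"
      have ok: "path_ok x y n a b" using cert ab False by (simp add: certifies_def S_def)
      have "path_between {..<n} E a b (?p a b)"
        unfolding path_between_def
      proof (intro conjI)
        show "distinct (?p a b)"
          unfolding distinct_map
        proof (intro conjI inj_onI)
          fix s t assume "s \<in> set [0..<Suc ?l]" "t \<in> set [0..<Suc ?l]" "entry y n 4 a b s = entry y n 4 a b t"
          then show "s = t" using ok unfolding path_ok_def by (metis atLeastLessThan_iff linorder_neqE_nat set_upt)
        qed simp
        show "set (?p a b) \<subseteq> {..<n}" using ok by (auto simp: path_ok_def simp del: upt_Suc)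
        show "successively (\<lambda>u v. {u, v} \<in> E) (?p a b)"
          using ok enc(2) unfolding successively_conv_nth path_ok_def by (auto simp del: upt_Suc)
        show "{hd (?p a b), last (?p a b)} = {a, b}"
          using ok unfolding path_ok_def by (simp add: hd_map del: upt_Suc) (simp add: last_map)
      qed simp
      moreover have "length (?p a b) \<le> length q" if q: "path_between {..<n} E a b q" for q
      proof -
        have "walk {..<n} E q" using q by (simp add: path_between_def walk_def)
        moreover have "?d v \<le> ?d u + 1" if "u \<in> {..<n}" "v \<in> {..<n}" "{u, v} \<in> E" for u v
          using ok enc(2) that unfolding path_ok_def by auto
        \<comment> \<open>The orientation of \<open>q\<close> is unknown, hence both estimates; the
          potential vanishes at whichever end is \<open>a\<close>.\<close>
        ultimately have "?d (last q) + 1 \<le> ?d (hd q) + length q \<and> ?d (hd q) + 1 \<le> ?d (last q) + length q"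
          by (rule walk_potential)
        moreover have "hd q = a \<and> last q = b \<or> hd q = b \<and> last q = a"
          using q by (auto simp: path_between_def doubleton_eq_iff)
        ultimately show ?thesis using ok unfolding path_ok_def by auto
      qed
      ultimately show ?thesis by (simp add: shortest_path_between_def)
    qed
    have path': "shortest_path_between {..<n} E a b (f {a, b})" if "a \<in> S" "b \<in> S" "a \<noteq> b" for a b
    proof (cases "a < b")
      case True
      then show ?thesis using path[OF that(1,2)] f by simp
    next
      case False
      then have "b < a" using that(3) by simp
      then have "shortest_path_between {..<n} E b a (f {b, a})" using path[OF that(2,1)] f by simp
      then show ?thesis by (simp add: shortest_path_sym insert_commute)
    qed
    show ?thesis
    proof (rule strong_geodetic_set_selectI[where g = f])
      show "S \<subseteq> {..<n}" "card {..<n} \<noteq> 1" using False by (auto simp: S_def)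
      show "shortest_path_between {..<n} E a b (f {a, b})" if "a \<in> S" "b \<in> S" "a \<noteq> b" for a b
        using path' that .
      fix v assume "v \<in> {..<n}"
      then obtain a b t where ab: "a < n" "b < n" "a < b" "selected y n a" "selected y n b"
        and t: "t < Suc (entry y n 2 a b 0)" "entry y n 4 a b t = v"
        using cert False unfolding certifies_def by auto
      have "v \<in> set (f {a, b})" using t unfolding f[OF ab(3)] by (auto simp del: upt_Suc)
      moreover have "a \<in> S" "b \<in> S" "a \<noteq> b" using ab by (auto simp: S_def)
      ultimately show "\<exists>a\<in>S. \<exists>b\<in>S. a \<noteq> b \<and> v \<in> set (f {a, b})" by blast
    qed
  qed
  then show ?thesis unfolding BIPARTITE_STRONG_GEODETIC_SET_def x using g bip card by blast
qed

lemma instance_imp_certifies: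
  assumes g: "simple_graph {..<n} E" and bip: "bipartite {..<n} E"
    and sgs: "strong_geodetic_set {..<n} E S" and card: "card S \<le> K"
    and x: "x = encode_instance n E (int K)"
  shows "\<exists>y. length y = 5 * Suc n ^ 4 \<and> certifies x y n"
proof -
  note enc = well_formed_encode_instance[OF g x]
  have S: "S \<subseteq> {..<n}" using sgs by (simp add: strong_geodetic_set_def)
  obtain A B where AB: "A \<union> B = {..<n}" "A \<inter> B = {}" "\<forall>e\<in>E. \<exists>a\<in>A. \<exists>b\<in>B. e = {a, b}"
    using bip unfolding bipartite_def by blast
  have color: "u \<in> A \<longleftrightarrow> v \<notin> A" if "{u, v} \<in> E" for u v
  proof -
    from bspec[OF AB(3) that] obtain a b where "a \<in> A" "b \<in> B" "{u, v} = {a, b}" by (elim bexE)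
    then show ?thesis using AB(2) unfolding doubleton_eq_iff by blast
  qed
  obtain f where f: "n \<noteq> 1 \<Longrightarrow> \<forall>a\<in>S. \<forall>b\<in>S. a \<noteq> b \<longrightarrow> shortest_path_between {..<n} E a b (f {a, b})"
    "n \<noteq> 1 \<Longrightarrow> \<Union> {set (f {a, b}) | a b. a \<in> S \<and> b \<in> S \<and> a \<noteq> b} = {..<n}"
    using sgs unfolding strong_geodetic_set_def by (cases "n = 1") auto
  \<comment> \<open>Selected paths are turned so as to start at the first argument.\<close>
  define P where "P a b = (if hd (f {a, b}) = a then f {a, b} else rev (f {a, b}))" for a b
  have P: "shortest_path_between {..<n} E a b (P a b)" "hd (P a b) = a" "last (P a b) = b"
      "set (P a b) = set (f {a, b})"
    if ab: "a \<in> S" "b \<in> S" "a \<noteq> b" "n \<noteq> 1" for a b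
  proof -
    have sp: "shortest_path_between {..<n} E a b (f {a, b})" using f(1) ab by blast
    then have ends: "hd (f {a, b}) = a \<and> last (f {a, b}) = b \<or> hd (f {a, b}) = b \<and> last (f {a, b}) = a"
      "f {a, b} \<noteq> []"
      by (auto simp: shortest_path_between_def path_between_def doubleton_eq_iff)
    have "path_between {..<n} E a b (rev (f {a, b}))"
      using sp unfolding shortest_path_between_def path_between_def
      by (auto simp: hd_rev last_rev insert_commute)
    then have "shortest_path_between {..<n} E a b (rev (f {a, b}))"
      using sp by (simp add: shortest_path_between_def)
    then show "shortest_path_between {..<n} E a b (P a b)" "hd (P a b) = a" "last (P a b) = b"
      "set (P a b) = set (f {a, b})"
      using sp ends ab(3) by (auto simp: P_def hd_rev last_rev)
  qed
  define W where "W a v k \<longleftrightarrow> (\<exists>w. walk {..<n} E w \<and> hd w = a \<and> last w = v \<and> length w = Suc k)" for a v k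
  \<comment> \<open>The distance from \<open>a\<close>, cut off at \<open>n\<close>, the value for
    unreachable vertices. The cut-off fits the entries and keeps the growth along edges at most 1; a
    selected path has fewer than \<open>n\<close> edges, so the distance of its ends is not
    affected.\<close>
  define d where "d a v = (LEAST k. k = n \<or> W a v k)" for a v
  \<comment> \<open>The outer minimum enforces the bound required by
    \<open>certificate_exists\<close> also where the arguments have no meaning.\<close>
  define G where "G k a b c = min n (if k = 0 then of_bool (a \<in> S) else if k = 1 then of_bool (a \<in> A)
    else if k = 2 then length (P a b) - 1 else if k = 3 then d a b else P a b ! c)" for k a b c :: nat
  have "G k a b c \<le> n" for k a b c by (simp add: G_def)
  from certificate_exists[of G n, OF this] obtain y where y: "length y = 5 * Suc n ^ 4"
    "\<And>k a b c. k < 5 \<Longrightarrow> a \<le> n \<Longrightarrow> b \<le> n \<Longrightarrow> c \<le> n \<Longrightarrow> entry y n k a b c = G k a b c"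
    by blast
  have sel: "selected y n v \<longleftrightarrow> v \<in> S" if "v < n" for v
    using that by (simp add: selected_def y(2) G_def)
  have col: "0 < entry y n 1 v 0 0 \<longleftrightarrow> v \<in> A" if "v < n" for v
    using that by (simp add: y(2) G_def)
  have props: "set (P a b) \<subseteq> {..<n}" "length (P a b) \<le> n" "P a b \<noteq> []" "entry y n 2 a b 0 = length (P a b) - 1"
    "\<And>t. t < length (P a b) \<Longrightarrow> entry y n 4 a b t = P a b ! t \<and> P a b ! t < n"
    if ab: "a \<in> S" "b \<in> S" "a \<noteq> b" "n \<noteq> 1" for a b
  proof -
    have p: "path_between {..<n} E a b (P a b)" using P(1)[OF ab] by (simp add: shortest_path_between_def)
    then show set: "set (P a b) \<subseteq> {..<n}" "P a b \<noteq> []" by (auto simp: path_between_def)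
    have "card (set (P a b)) \<le> card {..<n}" using set(1) by (intro card_mono) auto
    then show len: "length (P a b) \<le> n" using p by (simp add: path_between_def distinct_card)
    have ab': "a \<le> n" "b \<le> n" using S ab by auto
    then show "entry y n 2 a b 0 = length (P a b) - 1" using len by (simp add: y(2) G_def)
    show "entry y n 4 a b t = P a b ! t \<and> P a b ! t < n" if "t < length (P a b)" for t
    proof -
      have "P a b ! t \<in> {..<n}" using nth_mem[OF that] set(1) by blast
      then show ?thesis using that len ab' by (simp add: y(2) G_def)
    qed
  qed
  have d_le: "d a v \<le> k" if "k = n \<or> W a v k" for a v k
    unfolding d_def using that by (rule Least_le)
  have d: "entry y n 3 a v 0 = d a v" if "a < n" "v < n" for a v
    using that d_le[of n a v] by (simp add: y(2) G_def)
  have W0: "W a a 0" if "a < n" for a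
    unfolding W_def using that by (intro exI[of _ "[a]"]) (simp add: walk_def)
  have W_step: "W a v (Suc k)" if "W a u k" "{u, v} \<in> E" "v < n" for a u v k
  proof -
    obtain w where w: "walk {..<n} E w" "hd w = a" "last w = u" "length w = Suc k"
      using \<open>W a u k\<close> unfolding W_def by blast
    then show ?thesis unfolding W_def
      by (intro exI[of _ "w @ [v]"]) (use that in \<open>auto simp: walk_def successively_append_iff\<close>)
  qed
  have d_step: "d a v \<le> d a u + 1" if "{u, v} \<in> E" "v < n" for a u v
  proof -
    have "d a u = n \<or> W a u (d a u)" unfolding d_def by (rule LeastI[of _ n]) simp
    then show ?thesis using d_le[of n a v] d_le[of "Suc (d a u)" a v] W_step[of a u _ v] that by auto
  qed
  have ok: "path_ok x y n a b" if ab: "a \<in> S" "b \<in> S" "a \<noteq> b" "n \<noteq> 1" for a b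
  proof -
    note pr = props[OF ab] and sp = P(1-3)[OF ab]
    have p: "path_between {..<n} E a b (P a b)" using sp by (simp add: shortest_path_between_def)
    have lt: "a < n" "b < n" using S ab by auto
    have len: "Suc (entry y n 2 a b 0) = length (P a b)" using pr(3,4) by (cases "P a b") auto
    have "W a b (length (P a b) - 1)"
      unfolding W_def using p sp(2,3) pr(3) by (intro exI[of _ "P a b"]) (auto simp: walk_def path_between_def)
    moreover have "length (P a b) - 1 \<le> k" if k: "W a b k" for k
    proof -
      obtain w where "walk {..<n} E w" "hd w = a" "last w = b" "length w = Suc k"
        using k unfolding W_def by blast
      then show ?thesis using shortest_path_le_walk[OF sp(1), of w] by simp
    qed
    ultimately have "d a b = length (P a b) - 1"
      unfolding d_def using pr(2) by (intro Least_equality) auto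
    then have dab: "entry y n 3 a b 0 = entry y n 2 a b 0" using d[OF lt] pr(4) by simp
    have "d a a = 0" using d_le[of 0 a a] W0[OF lt(1)] by simp
    then have daa: "entry y n 3 a a 0 = 0" using d[OF lt(1,1)] by simp
    have ent: "entry y n 4 a b t = P a b ! t" "P a b ! t < n" if "t < length (P a b)" for t
      using pr(5)[OF that] by auto
    have hd: "P a b ! 0 = a" "P a b ! (length (P a b) - 1) = b"
      using sp(2,3) pr(3) by (auto simp: hd_conv_nth last_conv_nth)
    show ?thesis
      unfolding path_ok_def
    proof (intro conjI allI impI)
      show "entry y n 4 a b 0 = a" using ent(1)[of 0] hd(1) pr(3) by simp
      show "entry y n 4 a b (entry y n 2 a b 0) = b" using ent(1)[of "entry y n 2 a b 0"] hd(2) pr(4) len by simp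
      show "entry y n 3 a a 0 = 0" "entry y n 3 a b 0 = entry y n 2 a b 0" by (fact daa dab)+
      show "entry y n 4 a b t < n" if "t < Suc (entry y n 2 a b 0)" for t
        using ent that unfolding len by simp
      show "entry y n 4 a b s \<noteq> entry y n 4 a b t" if "t < Suc (entry y n 2 a b 0)" "s < t" for s t
        using ent(1)[of s] ent(1)[of t] that p unfolding len
        by (auto simp: path_between_def nth_eq_iff_index_eq)
      show "edge_bit x n (entry y n 4 a b t) (entry y n 4 a b (Suc t))" if "t < entry y n 2 a b 0" for t
      proof -
        have t: "Suc t < length (P a b)" using that len by simp
        then have "{P a b ! t, P a b ! Suc t} \<in> E"
          using p unfolding path_between_def successively_conv_nth by simp
        then show ?thesis using ent[of t] ent[of "Suc t"] t enc(2) by simp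
      qed
      show "entry y n 3 a v 0 \<le> entry y n 3 a u 0 + 1" if "u < n" "v < n" "edge_bit x n u v" for u v
        using d_step[of u v a] enc(2)[of u v] that d lt by simp
    qed
  qed
  have cover: "\<exists>a<n. \<exists>b<n. a < b \<and> selected y n a \<and> selected y n b \<and>
      (\<exists>t<Suc (entry y n 2 a b 0). entry y n 4 a b t = v)"
    if v: "v < n" and n: "n \<noteq> 1" for v
  proof -
    have "v \<in> \<Union> {set (f {a, b}) | a b. a \<in> S \<and> b \<in> S \<and> a \<noteq> b}" using f(2)[OF n] v by simp
    then obtain a' b' where ab': "a' \<in> S" "b' \<in> S" "a' \<noteq> b'" "v \<in> set (f {a', b'})" by blast
    define a where "a = min a' b'"
    define b where "b = max a' b'"
    have ab: "a \<in> S" "b \<in> S" "a < b" "v \<in> set (f {a, b})"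
      using ab' by (auto simp: a_def b_def min_def max_def insert_commute)
    then have "v \<in> set (P a b)" using P(4)[OF ab(1,2)] n by auto
    then obtain t where t: "t < length (P a b)" "P a b ! t = v" by (auto simp: in_set_conv_nth)
    have "entry y n 4 a b t = v" "Suc (entry y n 2 a b 0) = length (P a b)"
      using props[OF ab(1,2) _ n] ab(3) t by (auto simp: Suc_diff_le)
    moreover have "a < n" "b < n" using S ab by auto
    ultimately show ?thesis using ab t(1) sel by metis
  qed
  have "certifies x y n"
    unfolding certifies_def
  proof (intro conjI allI impI)
    show "well_formed x n" by (fact enc(1))
    show "0 < entry y n 1 u 0 0 \<longleftrightarrow> \<not> 0 < entry y n 1 v 0 0" if "u < n" "v < n" "edge_bit x n u v" for u v
      using color[of u v] col enc(2) that by simp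
    have "(\<Sum>v<n. of_bool (selected y n v)) = (\<Sum>v<n. of_bool (v \<in> S) :: nat)"
      by (intro sum.cong) (auto simp: sel)
    also have "\<dots> = card S" using S by (simp add: of_bool_def sum.If_cases Int_absorb1)
    finally have sum: "(\<Sum>v<n. of_bool (selected y n v)) = card S" .
    \<comment> \<open>Hence capping the number of the instance at \<open>n\<close> loses
      nothing.\<close>
    have "card S \<le> n" using card_mono[OF _ S] by simp
    then show "(\<Sum>v<n. of_bool (selected y n v)) \<le> capped_number x n" using card sum enc(3) by simp
    show "n = 1 \<and> selected y n 0 \<or> n \<noteq> 1 \<and>
       (\<forall>a<n. \<forall>b<n. a < b \<and> selected y n a \<and> selected y n b \<longrightarrow> path_ok x y n a b) \<and>
       (\<forall>v<n. \<exists>a<n. \<exists>b<n. a < b \<and> selected y n a \<and> selected y n b \<and>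
         (\<exists>t<Suc (entry y n 2 a b 0). entry y n 4 a b t = v))"
    proof (cases "n = 1")
      case True
      then have "S = {..<n}" using sgs by (simp add: strong_geodetic_set_def)
      then show ?thesis using True sel[of 0] by simp
    next
      case False
      then show ?thesis using ok sel cover by auto
    qed
  qed
  then show ?thesis using y(1) by blast
qed

theorem in_NP_BIPARTITE_STRONG_GEODETIC_SET: "in_NP BIPARTITE_STRONG_GEODETIC_SET"
proof -
  \<comment> \<open>The number of vertices is not handed to the verifier; all candidates below the
    length of \<open>x\<close> are tried.\<close>
  define R where "R x y \<longleftrightarrow> (\<exists>n<length x. certifies x y n)" for x y
  define q :: "nat poly" where "q = [:5:] * [:1, 1:] ^ 4"
  have q: "poly q n = 5 * Suc n ^ 4" for n by (simp add: q_def poly_power)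
  have "feasible_pred 2 (\<lambda>ws e. R (ws ! 0) (ws ! 1))"
    unfolding R_def by (intro feasible_intros feasible_certifies) auto
  then have "polytime_computable 2 (\<lambda>ws. map (\<lambda>i. R (ws ! 0) (ws ! 1)) [0..<1])"
    by (intro polytime_computable_map feasible_const)
  moreover have "x \<in> BIPARTITE_STRONG_GEODETIC_SET \<longleftrightarrow> (\<exists>y. length y \<le> poly q (length x) \<and> R x y)" for x
  proof
    assume "x \<in> BIPARTITE_STRONG_GEODETIC_SET"
    then obtain n E k S where x: "x = encode_instance n E k" "simple_graph {..<n} E" "bipartite {..<n} E"
      "strong_geodetic_set {..<n} E S" "int (card S) \<le> k"
      unfolding BIPARTITE_STRONG_GEODETIC_SET_def by blast
    then have k: "card S \<le> nat k" "x = encode_instance n E (int (nat k))" by auto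
    obtain y where y: "length y = 5 * Suc n ^ 4" "certifies x y n"
      using instance_imp_certifies[OF x(2-4) k] by blast
    have n: "n < length x" using well_formed_encode_instance(4)[OF x(2) k(2)] .
    have "length y \<le> poly q (length x)" unfolding y(1) q using n by (intro mult_le_mono2 power_mono) auto
    then show "\<exists>y. length y \<le> poly q (length x) \<and> R x y" using y(2) n unfolding R_def by blast
  qed (auto simp: R_def intro: certifies_imp_instance)
  ultimately show ?thesis unfolding in_NP_def by (intro exI[of _ R] exI[of _ q]) simp
qed

theorem theorem4p1: "NP_complete BIPARTITE_STRONG_GEODETIC_SET"
  using in_NP_BIPARTITE_STRONG_GEODETIC_SET NP_hard_BIPARTITE_STRONG_GEODETIC_SET
  by (simp add: NP_complete_def)

end
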